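(* Let $(X,\rho,\mu)$ be a space of homogeneous type, $\mathscr D$ a system of dyadic cubes on it, and $b\in L^1_{\mathrm{loc}}(\mu)$. For $p\in(0,\infty)$, $q\in(0,\infty]$ let $\|b\|_{\mathrm{Osc}^{p,q}}:=\big\|\big\{\frac1{\mu(B_Q)}\int_{B_Q}|b-\langle b\rangle_{B_Q}|\,d\mu\big\}_{Q\in\mathscr D}\big\|_{\ell^{p,q}}$. (1) For all $p\in(1,\infty)$, $$\|b\|_{\mathrm{Osc}^{p,p}}\approx\|b\|_{\dot B^p(\mu)}:=\Big(\iint_{X\times X}\frac{|b(x)-b(y)|^p}{V(x,y)^2}\,d\mu(x)\,d\mu(y)\Big)^{1/p}.$$ (2) If $X$ is Ahlfors regular of homogeneous dimension $d$, then $$\|b\|_{\mathrm{Osc}^{d,\infty}}\approx\|m_b\|_{L^{d,\infty}(\nu_d)},$$ where $$m_b(x,t):=\frac1{V(x,t)}\int_{B(x,t)}|b-\langle b\rangle_{B(x,t)}|\,d\mu,\qquad d\nu_d(x,t):=\frac{d\mu(x)\,dt}{t^{d+1}}$$ are defined on the product space $X\times(0,\infty)$.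
   Context: A space of homogeneous type $(X,\rho,\mu)$ is a set $X$ with a quasi-metric $\rho$ (symmetric, vanishing exactly on the diagonal, $\rho(x,y)\le A_0(\rho(x,z)+\rho(z,y))$ for a constant $A_0\ge1$) and a Borel measure $\mu$ such that the balls $B(x,r)=\{y:\rho(x,y)<r\}$ satisfy $0<V(x,r):=\mu(B(x,r))<\infty$ and $V(x,2r)\le C\,V(x,r)$. Notation: $V(x,y):=\mu(B(x,\rho(x,y)))$; $\langle f\rangle_B:=\mu(B)^{-1}\int_Bf\,d\mu$. In the double integral the diagonal contributes $0$. Ahlfors regular of homogeneous dimension $d\in(0,\infty)$ means $V(x,r)\approx r^d$ uniformly in $x\in X$, $r\in(0,\infty)$. A dyadic system is $\mathscr D=\bigcup_{k\in\mathbb Z}\mathscr D_k$, where each $\mathscr D_k$ is a measurable partition of $X$, $\mathscr D_{k+1}$ refines $\mathscr D_k$, and for parameters $\delta\in(0,1)$, $0<c_0\le C_0<\infty$, each $Q\in\mathscr D_k$ has a centre $z_Q$ with $B(z_Q,c_0\delta^k)\subseteq Q\subseteq B(z_Q,C_0\delta^k)$. $\ell(Q):=\delta^k$ for $Q\in\mathscr D_k$. Sequences indexed by $\mathscr D$ count each set $Q$ once; if $Q$ belongs to several $\mathscr D_k$, take the smallest such $k$ in $\ell(Q)$ (and $B_Q=X$ if $Q=X$). $B_Q:=B(z_Q,c\,\ell(Q))$, where $c$ is a fixed large enough constant depending only on the space and the dyadic system. In part (2), $\mathscr D$ is chosen with $\delta$ small enough so that each set $Q\in\mathscr D$ belongs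 to only one level $\mathscr D_k$ (possible for spaces of positive lower dimension). $\ell^{p,q}$ is the Lorentz sequence space, e.g. $\|\{a_Q\}\|_{\ell^{d,\infty}}=\sup_{\kappa>0}\kappa\,(\#\{Q\in\mathscr D:|a_Q|>\kappa\})^{1/d}$, and $\|m_b\|_{L^{d,\infty}(\nu_d)}:=\sup_{\kappa>0}\kappa\,\nu_d(\{m_b>\kappa\})^{1/d}$. $A\approx B$ means $C^{-1}A\le B\le CA$ with $C$ depending only on the space, the dyadic system and the exponent, not on $b$. *)

theory Defs
  imports "HOL-Analysis.Analysis"
begin

section \<open>Spaces of homogeneous type\<close>

definition quasi_metric_on :: "'a set \<Rightarrow> ('a \<Rightarrow> 'a \<Rightarrow> real) \<Rightarrow> bool" where
  "quasi_metric_on X rho \<longleftrightarrow>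
     (\<forall>x\<in>X. \<forall>y\<in>X. 0 \<le> rho x y \<and> rho x y = rho y x \<and> (rho x y = 0 \<longleftrightarrow> x = y)) \<and>
     (\<exists>A0\<ge>1. \<forall>x\<in>X. \<forall>y\<in>X. \<forall>z\<in>X. rho x y \<le> A0 * (rho x z + rho z y))"

definition qball :: "'a set \<Rightarrow> ('a \<Rightarrow> 'a \<Rightarrow> real) \<Rightarrow> 'a \<Rightarrow> real \<Rightarrow> 'a set" where
  "qball X rho x r = {y \<in> X. rho x y < r}"

text \<open>A ball of a quasi-metric need not be open (nor even Borel), so the topology is not
  generated by the balls: a set is open if it contains a ball around each of its points.\<close>

definition qopen :: "'a set \<Rightarrow> ('a \<Rightarrow> 'a \<Rightarrow> real) \<Rightarrow> 'a set \<Rightarrow> bool" where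
  "qopen X rho U \<longleftrightarrow> U \<subseteq> X \<and> (\<forall>x\<in>U. \<exists>r>0. qball X rho x r \<subseteq> U)"

definition homogeneous_type :: "'a measure \<Rightarrow> ('a \<Rightarrow> 'a \<Rightarrow> real) \<Rightarrow> bool" where
  "homogeneous_type M rho \<longleftrightarrow>
     quasi_metric_on (space M) rho \<and>
     sets M = sigma_sets (space M) {U. qopen (space M) rho U} \<and>
     (\<forall>x\<in>space M. \<forall>r>0. qball (space M) rho x r \<in> sets M \<and>
        0 < emeasure M (qball (space M) rho x r) \<and> emeasure M (qball (space M) rho x r) < \<infinity>) \<and>
     (\<exists>C::real. \<forall>x\<in>space M. \<forall>r>0.
        emeasure M (qball (space M) rho x (2 * r)) \<le> ennreal C * emeasure M (qball (space M) rho x r))"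

definition vol :: "'a measure \<Rightarrow> ('a \<Rightarrow> 'a \<Rightarrow> real) \<Rightarrow> 'a \<Rightarrow> real \<Rightarrow> real" where
  "vol M rho x r = measure M (qball (space M) rho x r)"

definition ahlfors_regular :: "'a measure \<Rightarrow> ('a \<Rightarrow> 'a \<Rightarrow> real) \<Rightarrow> real \<Rightarrow> bool" where
  "ahlfors_regular M rho d \<longleftrightarrow>
     (\<exists>C\<ge>1. \<forall>x\<in>space M. \<forall>r>0. (1 / C) * r powr d \<le> vol M rho x r \<and> vol M rho x r \<le> C * r powr d)"

text \<open>Locally integrable means integrable on every ball, so that all averages over balls exist.\<close>

definition L1_loc :: "'a measure \<Rightarrow> ('a \<Rightarrow> 'a \<Rightarrow> real) \<Rightarrow> ('a \<Rightarrow> complex) set" where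
  "L1_loc M rho = {b. \<forall>x\<in>space M. \<forall>r>0. set_integrable M (qball (space M) rho x r) b}"

section \<open>Dyadic systems\<close>

text \<open>The centre \<open>z k Q\<close> may depend on the level \<open>k\<close> when \<open>Q\<close> belongs to several levels.\<close>

definition dyadic_system ::
  "'a measure \<Rightarrow> ('a \<Rightarrow> 'a \<Rightarrow> real) \<Rightarrow> real \<Rightarrow> real \<Rightarrow> real \<Rightarrow>
   (int \<Rightarrow> 'a set set) \<Rightarrow> (int \<Rightarrow> 'a set \<Rightarrow> 'a) \<Rightarrow> bool" where
  "dyadic_system M rho \<delta> c0 C0 D z \<longleftrightarrow>
     0 < \<delta> \<and> \<delta> < 1 \<and> 0 < c0 \<and> c0 \<le> C0 \<and>
     (\<forall>k. partition_on (space M) (D k) \<and> D k \<subseteq> sets M) \<and>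
     (\<forall>k. refines (space M) (D (k + 1)) (D k)) \<and>
     (\<forall>k. \<forall>Q\<in>D k. z k Q \<in> space M \<and>
        qball (space M) rho (z k Q) (c0 * \<delta> powi k) \<subseteq> Q \<and>
        Q \<subseteq> qball (space M) rho (z k Q) (C0 * \<delta> powi k))"

definition cubes :: "(int \<Rightarrow> 'a set set) \<Rightarrow> 'a set set" where
  "cubes D = (\<Union>k. D k)"

text \<open>If \<open>Q \<noteq> X\<close>, the levels \<open>k\<close> with \<open>Q \<in> D k\<close> are bounded below, so the \<open>LEAST\<close> exists.\<close>

definition cube_level :: "(int \<Rightarrow> 'a set set) \<Rightarrow> 'a set \<Rightarrow> int" where
  "cube_level D Q = (LEAST k. Q \<in> D k)"

definition cube_ball ::
  "'a measure \<Rightarrow> ('a \<Rightarrow> 'a \<Rightarrow> real) \<Rightarrow> real \<Rightarrow> (int \<Rightarrow> 'a set set) \<Rightarrow> (int \<Rightarrow> 'a set \<Rightarrow> 'a) \<Rightarrow>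
   real \<Rightarrow> 'a set \<Rightarrow> 'a set" where
  "cube_ball M rho \<delta> D z c Q =
     (if Q = space M then space M
      else qball (space M) rho (z (cube_level D Q) Q) (c * \<delta> powi cube_level D Q))"

section \<open>Mean oscillation\<close>

definition avg :: "'a measure \<Rightarrow> 'a set \<Rightarrow> ('a \<Rightarrow> complex) \<Rightarrow> complex" where
  "avg M B b = (LINT x:B|M. b x) /\<^sub>R measure M B"

definition mean_osc :: "'a measure \<Rightarrow> 'a set \<Rightarrow> ('a \<Rightarrow> complex) \<Rightarrow> real" where
  "mean_osc M B b = (LINT x:B|M. norm (b x - avg M B b)) / measure M B"

section \<open>Lorentz, oscillation and Besov norms\<close>

text \<open>The power \<open>x\<^sup>r\<close> of an extended nonnegative number, for an exponent \<open>r > 0\<close>.\<close>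

definition epowr :: "ennreal \<Rightarrow> real \<Rightarrow> ennreal" where
  "epowr x r = (if x = \<infinity> then \<infinity> else ennreal (enn2real x powr r))"

text \<open>The outer measure agrees with the measure on measurable level sets; it gives a meaning to the
  distribution function when joint measurability of \<open>m\<^sub>b\<close> is not known, as happens for a general
  quasi-metric.\<close>

definition distr_fun :: "'i measure \<Rightarrow> ('i \<Rightarrow> real) \<Rightarrow> real \<Rightarrow> ennreal" where
  "distr_fun N f \<kappa> = outer_measure_of N {x \<in> space N. \<kappa> < \<bar>f x\<bar>}"

text \<open>The Lorentz quasi-norm in terms of the distribution function,
  \<open>p\<^sup>1\<^sup>/\<^sup>q (\<integral>\<^sub>0\<^sup>\<infinity> (\<kappa> N(\<kappa>)\<^sup>1\<^sup>/\<^sup>p)\<^sup>q d\<kappa>/\<kappa>)\<^sup>1\<^sup>/\<^sup>q\<close> for \<open>q < \<infinity>\<close>.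
  It equals \<open>(\<integral>\<^sub>0\<^sup>\<infinity> (t\<^sup>1\<^sup>/\<^sup>p f\<^sup>*(t))\<^sup>q dt/t)\<^sup>1\<^sup>/\<^sup>q\<close> for the decreasing rearrangement \<open>f\<^sup>*\<close>,
  and the \<open>L\<^sup>p\<close> norm when \<open>q = p\<close>.\<close>

definition lorentz_norm :: "'i measure \<Rightarrow> real \<Rightarrow> ennreal \<Rightarrow> ('i \<Rightarrow> real) \<Rightarrow> ennreal" where
  "lorentz_norm N p q f =
     (if q = \<infinity> then (SUP \<kappa>\<in>{0<..}. ennreal \<kappa> * epowr (distr_fun N f \<kappa>) (1 / p))
      else let s = enn2real q in
        ennreal (p powr (1 / s)) *
        epowr (\<integral>\<^sup>+\<kappa>\<in>{0<..}. epowr (ennreal \<kappa> * epowr (distr_fun N f \<kappa>) (1 / p)) s * ennreal (1 / \<kappa>) \<partial>lborel)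
          (1 / s))"

definition osc_norm ::
  "'a measure \<Rightarrow> ('a \<Rightarrow> 'a \<Rightarrow> real) \<Rightarrow> real \<Rightarrow> (int \<Rightarrow> 'a set set) \<Rightarrow> (int \<Rightarrow> 'a set \<Rightarrow> 'a) \<Rightarrow>
   real \<Rightarrow> real \<Rightarrow> ennreal \<Rightarrow> ('a \<Rightarrow> complex) \<Rightarrow> ennreal" where
  "osc_norm M rho \<delta> D z c p q b =
     lorentz_norm (count_space (cubes D)) p q (\<lambda>Q. mean_osc M (cube_ball M rho \<delta> D z c Q) b)"

text \<open>On the diagonal \<open>rho x x = 0\<close>, so numerator and denominator both vanish and the integrand is
  \<open>0 / 0 = 0\<close>.\<close>

definition besov_norm ::
  "'a measure \<Rightarrow> ('a \<Rightarrow> 'a \<Rightarrow> real) \<Rightarrow> real \<Rightarrow> ('a \<Rightarrow> complex) \<Rightarrow> ennreal" where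
  "besov_norm M rho p b =
     epowr (\<integral>\<^sup>+(x, y). ennreal (norm (b x - b y) powr p / (vol M rho x (rho x y))\<^sup>2) \<partial>(M \<Otimes>\<^sub>M M))
       (1 / p)"

definition m_fun :: "'a measure \<Rightarrow> ('a \<Rightarrow> 'a \<Rightarrow> real) \<Rightarrow> ('a \<Rightarrow> complex) \<Rightarrow> 'a \<times> real \<Rightarrow> real" where
  "m_fun M rho b = (\<lambda>(x, t). mean_osc M (qball (space M) rho x t) b)"

definition nu :: "'a measure \<Rightarrow> real \<Rightarrow> ('a \<times> real) measure" where
  "nu M d = density (M \<Otimes>\<^sub>M restrict_space lborel {0<..}) (\<lambda>(x, t). ennreal (1 / t powr (d + 1)))"

text \<open>\<open>A \<approx> B\<close> with a constant that is uniform over \<open>b \<in> S\<close>.\<close>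

definition comparable_on :: "'b set \<Rightarrow> ('b \<Rightarrow> ennreal) \<Rightarrow> ('b \<Rightarrow> ennreal) \<Rightarrow> bool" where
  "comparable_on S A B \<longleftrightarrow>
     (\<exists>C\<ge>1. \<forall>b\<in>S. ennreal (1 / C) * A b \<le> B b \<and> B b \<le> ennreal C * A b)"

end

theory Submission
  imports Defs
begin

text \<open>Write \<open>a\<^sub>Q\<close> for the mean oscillation of \<open>b\<close> over \<open>B\<^sub>Q\<close> and \<open>b\<^sub>Q\<close> for the mean of \<open>b\<close> over \<open>Q\<close>. The \<open>\<ell>\<^sup>p\<^sup>,\<^sup>p\<close> norm is
  the \<open>\<ell>\<^sup>p\<close> norm (\<open>lorentz_norm_diagonal\<close>), so the first comparison is between \<open>\<Sum>\<^sub>Q a\<^sub>Q\<^sup>p\<close> and the double integral.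

  The oscillations are the smaller side: by convexity, \<open>a\<^sub>Q\<^sup>p\<close> is at most \<open>2\<^sup>p\<close> times the mean of
  \<open>\<bar>b x - b y\<bar>\<^sup>p\<close> over \<open>B\<^sub>Q \<times> B\<^sub>Q\<close>, and it remains to see that the sum of \<open>\<mu> B\<^sub>Q\<^sup>-\<^sup>2\<close> over all \<open>Q\<close> with
  \<open>x, y \<in> B\<^sub>Q\<close> is at most a multiple of \<open>V(x, y)\<^sup>-\<^sup>2\<close> (\<open>ex_kernel_bound\<close>). The sum is geometric because every
  set \<open>Q\<close> is counted once: if \<open>k\<close> is the smallest level of \<open>Q \<noteq> X\<close>, then the cube around \<open>Q\<close> of level
  \<open>k - 1\<close> is strictly larger, which yields a point at distance comparable with \<open>\<delta>\<^sup>k\<close> from \<open>x\<close>, and such a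
  point forces the volume of balls around \<open>x\<close> to grow by a fixed factor over boundedly many levels
  (\<open>ex_annulus_point\<close>, \<open>ex_volume_growth\<close>).

  For the converse, compare \<open>b x\<close> and \<open>b y\<close> through the means over the cubes around \<open>x\<close> and \<open>y\<close> whose level
  matches \<open>rho x y\<close>. This reduces the claim to a bound for the sum over \<open>Q\<close> of the mean of \<open>\<bar>b - b\<^sub>Q\<bar>\<^sup>p\<close> over
  \<open>Q\<close>. Telescoping over the cubes between \<open>x\<close> and \<open>Q\<close> bounds \<open>\<bar>b x - b\<^sub>Q\<bar>\<close> almost everywhere by a multiple
  of the sum of \<open>a\<^sub>P\<close> over \<open>x \<in> P \<subseteq> Q\<close> (\<open>ex_AE_bound\<close>). The masses of distinct nested cubes differ by a fixed
  factor, because a cube that splits loses a fixed fraction of its mass (\<open>ex_strict_subcube_ratio\<close>);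
  for \<open>p > 1\<close>, Hoelder's inequality with powers of \<open>\<mu> P / \<mu> Q\<close> as weights therefore gives
  \<open>ex_cube_Lp_bound\<close>, and one more geometric sum, over \<open>Q \<supseteq> P\<close>, completes the estimate.

  For the weak-type comparison, attach to each cube \<open>Q\<close> a Whitney box, \<open>Q\<close> times an interval of heights comparable with \<open>\<ell>(Q)\<close>.
  By Ahlfors regularity all boxes have comparable \<open>\<nu>\<^sub>d\<close> measure, those of distinct cubes are disjoint, and
  on a box \<open>m\<^sub>b\<close> is comparable with oscillations over balls of the size of \<open>B\<^sub>Q\<close>. The level sets of \<open>m\<^sub>b\<close> and
  of \<open>Q \<mapsto> a\<^sub>Q\<close> therefore have comparable measure, after a rescaling of the threshold
  (\<open>ex_osc_le_m_fun\<close>, \<open>ex_m_fun_le_osc\<close>).\<close>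

section \<open>Lorentz norms, sums and integrals\<close>

lemma epowr_ennreal [simp]: "0 \<le> x \<Longrightarrow> epowr (ennreal x) r = ennreal (x powr r)"
  by (simp add: epowr_def)

lemma epowr_mono: "0 < r \<Longrightarrow> x \<le> y \<Longrightarrow> epowr x r \<le> epowr y r"
  by (cases x; cases y) (auto simp: epowr_def top_unique intro!: ennreal_leI powr_mono2)

lemma epowr_mult:
  assumes "0 < c" "0 < r"
  shows "epowr (ennreal c * x) r = ennreal (c powr r) * epowr x r"
  using assms
  by (cases x) (auto simp: epowr_def ennreal_mult_top ennreal_mult_eq_top_iff powr_mult enn2real_mult ennreal_mult)

lemma epowr_inverse_power:
  assumes "0 < p"
  shows "epowr (epowr x (1 / p)) p = x"
  using assms by (cases x) (auto simp: epowr_def powr_powr)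

lemma comparable_onI:
  assumes C: "0 < C1" "0 < C2"
    and 1: "\<And>b. b \<in> S \<Longrightarrow> A b \<le> ennreal C1 * B b" and 2: "\<And>b. b \<in> S \<Longrightarrow> B b \<le> ennreal C2 * A b"
  shows "comparable_on S A B"
proof -
  let ?C = "max 1 (max C1 C2)"
  have "ennreal (1 / ?C) * A b \<le> B b" "B b \<le> ennreal ?C * A b" if b: "b \<in> S" for b
  proof -
    have "ennreal (1 / ?C) * A b \<le> ennreal (1 / ?C) * (ennreal C1 * B b)"
      by (intro mult_left_mono 1 b) simp
    also have "\<dots> = ennreal (1 / ?C * C1) * B b" using C by (subst ennreal_mult) (auto simp: mult.assoc)
    also have "\<dots> \<le> ennreal 1 * B b" using C by (intro mult_right_mono ennreal_leI) (auto simp: divide_le_eq)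
    finally show "ennreal (1 / ?C) * A b \<le> B b" by simp
    have "B b \<le> ennreal C2 * A b" by (rule 2[OF b])
    also have "\<dots> \<le> ennreal ?C * A b" by (intro mult_right_mono ennreal_leI) auto
    finally show "B b \<le> ennreal ?C * A b" .
  qed
  then show ?thesis unfolding comparable_on_def by (intro exI[of _ ?C]) auto
qed

lemma nn_integral_powr_interval:
  assumes "0 < p" "0 \<le> (a::real)"
  shows "(\<integral>\<^sup>+\<kappa>. ennreal (\<kappa> powr (p - 1)) * indicator {0<..<a} \<kappa> \<partial>lborel) = ennreal (a powr p / p)"
proof -
  have "((\<lambda>x. x powr (p - 1)) has_integral (a powr (p - 1 + 1) / (p - 1 + 1))) {0..a}"
    using assms by (intro has_integral_powr_from_0) auto
  then have "((\<lambda>x. x powr (p - 1)) has_integral (a powr p / p)) {0..a}" by simp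
  then have "((\<lambda>x. if x \<in> {0..a} then x powr (p - 1) else 0) has_integral (a powr p / p)) UNIV"
    by (rule iffD2[OF has_integral_restrict_UNIV])
  also have "(\<lambda>x. if x \<in> {0..a} then x powr (p - 1) else 0) = (\<lambda>x. indicator {0..a} x *\<^sub>R x powr (p - 1))"
    by (auto simp: indicator_def)
  finally have "(\<integral>\<^sup>+\<kappa>. ennreal (indicator {0..a} \<kappa> *\<^sub>R \<kappa> powr (p - 1)) \<partial>lborel) = ennreal (a powr p / p)"
    by (intro nn_integral_has_integral_lborel) auto
  moreover have "(\<integral>\<^sup>+\<kappa>. ennreal (indicator {0..a} \<kappa> *\<^sub>R \<kappa> powr (p - 1)) \<partial>lborel) =
     (\<integral>\<^sup>+\<kappa>. ennreal (\<kappa> powr (p - 1)) * indicator {0<..<a} \<kappa> \<partial>lborel)"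
  proof (rule nn_integral_cong_AE)
    have "AE x in lborel. x \<noteq> 0" "AE x in lborel. x \<noteq> a" by (auto intro: AE_lborel_singleton)
    then show "AE \<kappa> in lborel. ennreal (indicator {0..a} \<kappa> *\<^sub>R \<kappa> powr (p - 1)) =
        ennreal (\<kappa> powr (p - 1)) * indicator {0<..<a} \<kappa>"
      by eventually_elim (auto simp: indicator_def)
  qed
  ultimately show ?thesis by simp
qed

lemma distr_fun_count_space:
  "distr_fun (count_space I) f \<kappa> = emeasure (count_space I) {i \<in> I. \<kappa> < \<bar>f i\<bar>}"
  unfolding distr_fun_def by (subst outer_measure_of_eq) auto

text \<open>By Tonelli's theorem both sides are the \<open>p\<close>-th root of the sum over \<open>i\<close> of
  \<open>\<integral> p \<kappa>\<^sup>p\<^sup>-\<^sup>1 d\<kappa>\<close> over \<open>0 < \<kappa> < \<bar>f i\<bar>\<close>.\<close>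

lemma lorentz_norm_diagonal:
  fixes f :: "'i \<Rightarrow> real"
  assumes p: "0 < p" and I: "countable I"
  shows "lorentz_norm (count_space I) p (ennreal p) f =
    epowr (\<integral>\<^sup>+i. ennreal (\<bar>f i\<bar> powr p) \<partial>count_space I) (1 / p)"
proof -
  let ?N = "distr_fun (count_space I) f"
  have N: "?N \<kappa> = (\<integral>\<^sup>+i. indicator {0<..<\<bar>f i\<bar>} \<kappa> \<partial>count_space I)" if "0 < \<kappa>" for \<kappa>
  proof -
    have "?N \<kappa> = (\<integral>\<^sup>+i. indicator {i \<in> I. \<kappa> < \<bar>f i\<bar>} i \<partial>count_space I)"
      by (subst nn_integral_indicator) (auto simp: distr_fun_count_space)
    also have "\<dots> = (\<integral>\<^sup>+i. indicator {0<..<\<bar>f i\<bar>} \<kappa> \<partial>count_space I)"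
      using that by (intro nn_integral_cong) (auto simp: indicator_def)
    finally show ?thesis .
  qed
  have "(\<integral>\<^sup>+\<kappa>\<in>{0<..}. epowr (ennreal \<kappa> * epowr (?N \<kappa>) (1 / p)) p * ennreal (1 / \<kappa>) \<partial>lborel)
    = (\<integral>\<^sup>+\<kappa>. (\<integral>\<^sup>+i. ennreal (\<kappa> powr (p - 1)) * indicator {0<..<\<bar>f i\<bar>} \<kappa> \<partial>count_space I) \<partial>lborel)"
  proof (intro nn_integral_cong)
    fix \<kappa> :: real
    show "epowr (ennreal \<kappa> * epowr (?N \<kappa>) (1 / p)) p * ennreal (1 / \<kappa>) * indicator {0<..} \<kappa> =
      (\<integral>\<^sup>+i. ennreal (\<kappa> powr (p - 1)) * indicator {0<..<\<bar>f i\<bar>} \<kappa> \<partial>count_space I)"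
    proof (cases "0 < \<kappa>")
      case True
      have "epowr (ennreal \<kappa> * epowr (?N \<kappa>) (1 / p)) p * ennreal (1 / \<kappa>) =
          ennreal (\<kappa> powr p) * ?N \<kappa> * ennreal (1 / \<kappa>)"
        using True p by (simp add: epowr_mult epowr_inverse_power)
      also have "\<dots> = (ennreal (\<kappa> powr p) * ennreal (1 / \<kappa>)) * ?N \<kappa>" by (simp add: ac_simps)
      also have "ennreal (\<kappa> powr p) * ennreal (1 / \<kappa>) = ennreal (\<kappa> powr (p - 1))"
        using True by (simp add: ennreal_mult[symmetric] powr_diff)
      finally show ?thesis using True by (simp add: N nn_integral_cmult)
    next
      case False
      then have "indicator {0<..<\<bar>f i\<bar>} \<kappa> = (0::ennreal)" for i by simp
      with False show ?thesis by simp
    qed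
  qed
  also have "\<dots> = (\<integral>\<^sup>+i. (\<integral>\<^sup>+\<kappa>. ennreal (\<kappa> powr (p - 1)) * indicator {0<..<\<bar>f i\<bar>} \<kappa> \<partial>lborel) \<partial>count_space I)"
    using I by (intro nn_integral_count_space_nn_integral) auto
  also have "\<dots> = (\<integral>\<^sup>+i. ennreal (1 / p) * ennreal (\<bar>f i\<bar> powr p) \<partial>count_space I)"
    using p by (intro nn_integral_cong) (simp add: nn_integral_powr_interval ennreal_mult[symmetric])
  also have "\<dots> = ennreal (1 / p) * (\<integral>\<^sup>+i. ennreal (\<bar>f i\<bar> powr p) \<partial>count_space I)"
    by (simp add: nn_integral_cmult)
  finally have "lorentz_norm (count_space I) p (ennreal p) f =
      ennreal (p powr (1 / p)) * epowr (ennreal (1 / p) * (\<integral>\<^sup>+i. ennreal (\<bar>f i\<bar> powr p) \<partial>count_space I)) (1 / p)"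
    using p by (simp add: lorentz_norm_def Let_def)
  also have "\<dots> = (ennreal (p powr (1 / p)) * ennreal ((1 / p) powr (1 / p))) *
      epowr (\<integral>\<^sup>+i. ennreal (\<bar>f i\<bar> powr p) \<partial>count_space I) (1 / p)"
    using p by (simp add: epowr_mult mult.assoc)
  also have "ennreal (p powr (1 / p)) * ennreal ((1 / p) powr (1 / p)) = 1"
    using p by (simp add: ennreal_mult[symmetric] powr_mult[symmetric])
  finally show ?thesis by simp
qed

lemma lorentz_norm_infinity_le:
  assumes d: "0 < d" and \<gamma>: "0 < \<gamma>" and K: "0 < K"
    and le: "\<And>\<kappa>. 0 < \<kappa> \<Longrightarrow> distr_fun N1 f \<kappa> \<le> ennreal \<gamma> * distr_fun N2 g (\<kappa> / K)"
  shows "lorentz_norm N1 d \<infinity> f \<le> ennreal (K * \<gamma> powr (1 / d)) * lorentz_norm N2 d \<infinity> g"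
proof -
  have "ennreal \<kappa> * epowr (distr_fun N1 f \<kappa>) (1 / d) \<le>
      ennreal (K * \<gamma> powr (1 / d)) * (SUP \<kappa>\<in>{0<..}. ennreal \<kappa> * epowr (distr_fun N2 g \<kappa>) (1 / d))" if \<kappa>: "0 < \<kappa>" for \<kappa>
  proof -
    have "epowr (distr_fun N1 f \<kappa>) (1 / d) \<le> epowr (ennreal \<gamma> * distr_fun N2 g (\<kappa> / K)) (1 / d)"
      using d le[OF \<kappa>] by (intro epowr_mono) auto
    also have "\<dots> = ennreal (\<gamma> powr (1 / d)) * epowr (distr_fun N2 g (\<kappa> / K)) (1 / d)"
      using d \<gamma> by (intro epowr_mult) auto
    finally have "ennreal \<kappa> * epowr (distr_fun N1 f \<kappa>) (1 / d) \<le>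
        ennreal \<kappa> * (ennreal (\<gamma> powr (1 / d)) * epowr (distr_fun N2 g (\<kappa> / K)) (1 / d))"
      by (intro mult_left_mono) auto
    also have "\<dots> = ennreal (K * \<gamma> powr (1 / d)) * (ennreal (\<kappa> / K) * epowr (distr_fun N2 g (\<kappa> / K)) (1 / d))"
    proof -
      have "ennreal \<kappa> = ennreal K * ennreal (\<kappa> / K)" using K \<kappa> by (simp add: ennreal_mult[symmetric])
      moreover have "ennreal (K * \<gamma> powr (1 / d)) = ennreal K * ennreal (\<gamma> powr (1 / d))"
        using K by (intro ennreal_mult) auto
      ultimately show ?thesis by (simp only: ac_simps)
    qed
    also have "\<dots> \<le> ennreal (K * \<gamma> powr (1 / d)) * (SUP \<kappa>\<in>{0<..}. ennreal \<kappa> * epowr (distr_fun N2 g \<kappa>) (1 / d))"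
      using K \<kappa> by (intro mult_left_mono SUP_upper) auto
    finally show ?thesis .
  qed
  then show ?thesis by (simp add: lorentz_norm_def SUP_le_iff)
qed

lemma powr_add3_le:
  fixes u v w p :: real
  assumes "0 \<le> u" "0 \<le> v" "0 \<le> w" "0 \<le> p"
  shows "(u + v + w) powr p \<le> 3 powr p * (u powr p + v powr p + w powr p)"
proof -
  let ?m = "max u (max v w)"
  have "(u + v + w) powr p \<le> (3 * ?m) powr p" using assms by (intro powr_mono2) auto
  also have "\<dots> = 3 powr p * ?m powr p" using assms by (intro powr_mult)
  also have "?m powr p \<le> u powr p + v powr p + w powr p" using assms by (auto simp: max_def add_increasing add_increasing2)
  finally show ?thesis by (simp add: mult_left_mono)
qed

text \<open>Where \<open>t\<close> exceeds \<open>A\<close>, the factor \<open>(t / A)\<^sup>p\<^sup>-\<^sup>1\<close> is at least \<open>1\<close>. Integrated against a weight, with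
  \<open>A\<close> still free, this does the work of Hoelder's inequality.\<close>

lemma le_add_powr:
  fixes t A p :: real
  assumes p: "1 \<le> p" and A: "0 < A" and "0 \<le> t"
  shows "t \<le> A + A powr (1 - p) * t powr p"
proof (cases "t \<le> A")
  case True
  then show ?thesis by (intro order_trans[OF True]) simp
next
  case False
  with A have t: "0 < t" "A \<le> t" by auto
  have "t = t powr (1 - p) * t powr p" using t by (simp add: powr_add[symmetric])
  also have "\<dots> \<le> A powr (1 - p) * t powr p"
    using t A p by (intro mult_right_mono powr_mono2') auto
  finally show ?thesis using A by linarith
qed

text \<open>Hoelder's inequality for the measure \<open>w N\<close>, up to the factor \<open>2\<^sup>p\<close>. Integrating \<open>le_add_powr\<close> with
  \<open>A = g / (2 W)\<close> produces a first term \<open>g / 2\<close>, which is absorbed on the left.\<close>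

lemma power_mean_le:
  fixes w f :: "'i \<Rightarrow> real"
  assumes p: "1 \<le> p" and W: "0 < W" and g: "0 \<le> g"
    and [measurable]: "w \<in> borel_measurable N" "f \<in> borel_measurable N"
    and w: "\<And>i. i \<in> space N \<Longrightarrow> 0 \<le> w i" and f: "\<And>i. i \<in> space N \<Longrightarrow> 0 \<le> f i"
    and sw: "(\<integral>\<^sup>+i. ennreal (w i) \<partial>N) \<le> ennreal W"
    and le: "ennreal g \<le> (\<integral>\<^sup>+i. ennreal (w i * f i) \<partial>N)"
  shows "ennreal (g powr p) \<le> ennreal (2 powr p * W powr (p - 1)) * (\<integral>\<^sup>+i. ennreal (w i * f i powr p) \<partial>N)"
proof (cases "g = 0")
  case False
  with g have g: "0 < g" by simp
  define A where "A = g / (2 * W)"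
  have A: "0 < A" using g W by (simp add: A_def)
  let ?I = "\<integral>\<^sup>+i. ennreal (w i * f i powr p) \<partial>N"
  have "ennreal g \<le> (\<integral>\<^sup>+i. ennreal A * ennreal (w i) + ennreal (A powr (1 - p)) * ennreal (w i * f i powr p) \<partial>N)"
  proof (rule order_trans[OF le], intro nn_integral_mono)
    fix i assume i: "i \<in> space N"
    have "w i * f i \<le> w i * (A + A powr (1 - p) * f i powr p)"
      using w[OF i] le_add_powr[OF p A f[OF i]] by (rule mult_left_mono[rotated])
    then show "ennreal (w i * f i) \<le> ennreal A * ennreal (w i) + ennreal (A powr (1 - p)) * ennreal (w i * f i powr p)"
      using w[OF i] A by (simp add: ennreal_mult[symmetric] ennreal_plus[symmetric] algebra_simps del: ennreal_plus)
  qed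
  also have "\<dots> = ennreal A * (\<integral>\<^sup>+i. ennreal (w i) \<partial>N) + ennreal (A powr (1 - p)) * ?I"
    by (simp add: nn_integral_add nn_integral_cmult)
  also have "\<dots> \<le> ennreal A * ennreal W + ennreal (A powr (1 - p)) * ?I"
    using sw by (intro add_mono mult_left_mono) auto
  also have "ennreal A * ennreal W = ennreal (g / 2)"
    using A W by (simp add: ennreal_mult[symmetric] A_def)
  finally have main: "ennreal g \<le> ennreal (g / 2) + ennreal (A powr (1 - p)) * ?I" .
  show ?thesis
  proof (cases ?I)
    case (real I)
    have "ennreal g \<le> ennreal (g / 2 + A powr (1 - p) * I)"
      using main real g by (simp add: ennreal_mult[symmetric])
    then have "g \<le> g / 2 + A powr (1 - p) * I"
      using real g by (subst (asm) ennreal_le_iff) auto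
    then have "g / 2 \<le> A powr (1 - p) * I" by simp
    then have "A powr (p - 1) * (g / 2) \<le> A powr (p - 1) * (A powr (1 - p) * I)"
      by (intro mult_left_mono) auto
    also have "\<dots> = I" using A by (simp add: mult.assoc[symmetric] powr_add[symmetric])
    finally have *: "A powr (p - 1) * (g / 2) \<le> I" .
    have "A powr (p - 1) = g powr (p - 1) / (2 powr (p - 1) * W powr (p - 1))"
      using g W by (simp add: A_def powr_divide powr_mult)
    then have "g powr p = 2 powr p * W powr (p - 1) * (A powr (p - 1) * (g / 2))"
      using g W by (simp add: powr_diff)
    also have "\<dots> \<le> 2 powr p * W powr (p - 1) * I"
      using * by (intro mult_left_mono) auto
    finally show ?thesis using real by (simp add: ennreal_mult[symmetric])
  next
    case top
    then show ?thesis using W by (simp add: ennreal_mult_top)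
  qed
qed simp

text \<open>Sort the indices into the windows \<open>\<theta>\<^sup>n U \<le> u i < \<theta>\<^sup>n\<^sup>+\<^sup>1 U\<close>. Each window holds at most \<open>N\<close> of them, which
  leaves \<open>N\<close> times a geometric series.\<close>

lemma geometric_sum_le:
  fixes u :: "'i \<Rightarrow> real"
  assumes \<theta>: "1 < \<theta>" and s: "0 < s" and U: "0 < U"
    and u: "\<And>i. i \<in> I \<Longrightarrow> U \<le> u i"
    and card: "\<And>v. 0 < v \<Longrightarrow> finite {i \<in> I. v \<le> u i \<and> u i < \<theta> * v} \<and> card {i \<in> I. v \<le> u i \<and> u i < \<theta> * v} \<le> N"
  shows "(\<integral>\<^sup>+i. ennreal (u i powr - s) \<partial>count_space I) \<le> ennreal (real N / (1 - \<theta> powr - s) * U powr - s)"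
proof -
  let ?J = "\<lambda>n. {i \<in> I. \<theta> ^ n * U \<le> u i \<and> u i < \<theta> * (\<theta> ^ n * U)}"
  let ?q = "\<theta> powr - s"
  have "1 < \<theta> powr s" using \<theta> s by (rule gr_one_powr)
  then have q: "0 \<le> ?q" "?q < 1" by (auto simp: powr_minus inverse_less_1_iff)
  have pow: "(\<theta> ^ n * U) powr - s = U powr - s * ?q ^ n" for n
  proof -
    have "(\<theta> ^ n) powr - s = (\<theta> powr real n) powr - s" using \<theta> by (subst powr_realpow) auto
    also have "\<dots> = (\<theta> powr - s) powr real n" by (simp only: powr_powr mult.commute)
    also have "\<dots> = ?q ^ n" using \<theta> by (subst powr_realpow) auto
    finally show ?thesis using \<theta> U by (subst powr_mult) auto
  qed
  have "(\<integral>\<^sup>+i. ennreal (u i powr - s) \<partial>count_space I) \<le>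
      (\<integral>\<^sup>+i. (\<integral>\<^sup>+n. ennreal (U powr - s * ?q ^ n) * indicator (?J n) i \<partial>count_space UNIV) \<partial>count_space I)"
  proof (intro nn_integral_mono)
    fix i assume "i \<in> space (count_space I)"
    then have i: "i \<in> I" by simp
    define n where "n = nat \<lfloor>log \<theta> (u i / U)\<rfloor>"
    have ui: "1 \<le> u i / U" "0 < u i" using u[OF i] U by auto
    have l0: "0 \<le> log \<theta> (u i / U)" using \<theta> ui by simp
    have n1: "real n \<le> log \<theta> (u i / U)" "log \<theta> (u i / U) < real n + 1"
      using l0 by (auto simp: n_def)
    have "\<theta> powr real n \<le> u i / U" using n1(1) \<theta> ui U by (subst (asm) le_log_iff) auto
    moreover have "u i / U < \<theta> powr (real n + 1)" using n1(2) \<theta> ui U by (subst (asm) log_less_iff) auto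
    ultimately have n: "\<theta> ^ n * U \<le> u i" "u i < \<theta> * (\<theta> ^ n * U)"
      using U \<theta> by (auto simp: powr_realpow powr_add field_simps)
    have "ennreal (u i powr - s) \<le> ennreal (U powr - s * ?q ^ n) * indicator (?J n) i"
      using n i U \<theta> s by (auto simp: pow[symmetric] intro!: ennreal_leI powr_mono2')
    also have "\<dots> = (\<integral>\<^sup>+k. ennreal (U powr - s * ?q ^ k) * indicator (?J k) i * indicator {n} k \<partial>count_space UNIV)"
      by (subst nn_integral_indicator_singleton) auto
    also have "\<dots> \<le> (\<integral>\<^sup>+k. ennreal (U powr - s * ?q ^ k) * indicator (?J k) i \<partial>count_space UNIV)"
      by (intro nn_integral_mono) (auto simp: indicator_def)
    finally show "ennreal (u i powr - s) \<le> \<dots>" .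
  qed
  also have "\<dots> = (\<integral>\<^sup>+n. (\<integral>\<^sup>+i. ennreal (U powr - s * ?q ^ n) * indicator (?J n) i \<partial>count_space I) \<partial>count_space UNIV)"
    by (intro nn_integral_count_space_nn_integral) auto
  also have "\<dots> \<le> (\<integral>\<^sup>+n. ennreal (real N * U powr - s * ?q ^ n) \<partial>count_space UNIV)"
  proof (intro nn_integral_mono)
    fix n :: nat
    have fin: "finite (?J n)" and cd: "card (?J n) \<le> N" using card[of "\<theta> ^ n * U"] \<theta> U by auto
    have "(\<integral>\<^sup>+i. ennreal (U powr - s * ?q ^ n) * indicator (?J n) i \<partial>count_space I) =
        ennreal (U powr - s * ?q ^ n) * of_nat (card (?J n))"
      using fin by (subst nn_integral_cmult_indicator) auto
    also have "\<dots> \<le> ennreal (U powr - s * ?q ^ n) * ennreal (real N)"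
      using cd by (intro mult_left_mono) (auto simp: ennreal_of_nat_eq_real_of_nat)
    finally show "(\<integral>\<^sup>+i. ennreal (U powr - s * ?q ^ n) * indicator (?J n) i \<partial>count_space I) \<le>
        ennreal (real N * U powr - s * ?q ^ n)"
      by (simp add: ennreal_mult[symmetric] mult.commute mult.left_commute)
  qed
  also have "\<dots> = (\<Sum>n. ennreal (real N * U powr - s * ?q ^ n))"
    by (rule nn_integral_count_space_nat)
  also have "\<dots> = ennreal (\<Sum>n. real N * U powr - s * ?q ^ n)"
    using q by (intro suminf_ennreal2 summable_mult summable_geometric) auto
  also have "(\<Sum>n. real N * U powr - s * ?q ^ n) = real N * U powr - s * (1 / (1 - ?q))"
    using q by (subst suminf_mult) (auto simp: suminf_geometric summable_geometric)
  finally show ?thesis by (simp add: mult.commute)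
qed

text \<open>The function \<open>G\<close> may be non-measurable, and this is the case of interest: the Besov integrand
  contains \<open>rho\<close>, which is only known to be measurable in each variable separately, so its integral is
  a lower integral. The constant is moved through the measurable \<open>F\<close> for this reason.\<close>

lemma nn_integral_le_cmult:
  assumes [measurable]: "F \<in> borel_measurable N" and K: "0 < K"
    and le: "\<And>x. x \<in> space N \<Longrightarrow> F x \<le> ennreal K * G x"
  shows "(\<integral>\<^sup>+x. F x \<partial>N) \<le> ennreal K * (\<integral>\<^sup>+x. G x \<partial>N)"
proof -
  have inv: "ennreal K * ennreal (1 / K) = 1" using K by (simp add: ennreal_mult[symmetric])
  have "(\<integral>\<^sup>+x. F x \<partial>N) = (\<integral>\<^sup>+x. ennreal K * (ennreal (1 / K) * F x) \<partial>N)"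
    by (simp add: mult.assoc[symmetric] inv)
  also have "\<dots> = ennreal K * (\<integral>\<^sup>+x. ennreal (1 / K) * F x \<partial>N)"
    by (simp add: nn_integral_cmult)
  also have "(\<integral>\<^sup>+x. ennreal (1 / K) * F x \<partial>N) \<le> (\<integral>\<^sup>+x. G x \<partial>N)"
  proof (intro nn_integral_mono)
    fix x assume "x \<in> space N"
    then have "ennreal (1 / K) * F x \<le> ennreal (1 / K) * (ennreal K * G x)"
      by (intro mult_left_mono le) auto
    also have "\<dots> = G x" using inv by (simp add: mult.assoc[symmetric] mult.commute)
    finally show "ennreal (1 / K) * F x \<le> G x" .
  qed
  finally show ?thesis by (simp add: mult_left_mono)
qed

lemma nn_integral_count_space_Int:
  "(\<integral>\<^sup>+i. f i * indicator J i \<partial>count_space A) = (\<integral>\<^sup>+i. f i \<partial>count_space (A \<inter> J))"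
proof -
  have "(\<integral>\<^sup>+i. f i * indicator J i \<partial>count_space A) = (\<integral>\<^sup>+i. f i * indicator J i * indicator A i \<partial>count_space UNIV)"
    by (rule nn_integral_count_space_indicator) simp
  also have "\<dots> = (\<integral>\<^sup>+i. f i * indicator (A \<inter> J) i \<partial>count_space UNIV)"
    by (intro nn_integral_cong) (auto simp: indicator_def)
  also have "\<dots> = (\<integral>\<^sup>+i. f i \<partial>count_space (A \<inter> J))"
    by (rule nn_integral_count_space_indicator[symmetric]) simp
  finally show ?thesis .
qed

lemma nn_integral_count_space_subset:
  "I \<subseteq> A \<Longrightarrow> (\<integral>\<^sup>+i. f i * indicator I i \<partial>count_space A) = (\<integral>\<^sup>+i. f i \<partial>count_space I)"
  by (simp add: nn_integral_count_space_Int Int_absorb1)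

lemma nn_integral_count_space_singleton_le:
  "(\<integral>\<^sup>+i. c * indicator {a} i \<partial>count_space A) \<le> (c::ennreal)"
proof -
  have "(\<integral>\<^sup>+i. c * indicator {a} i \<partial>count_space A) = (\<integral>\<^sup>+i. c * indicator {a} i * indicator A i \<partial>count_space UNIV)"
    by (rule nn_integral_count_space_indicator) simp
  also have "\<dots> \<le> (\<integral>\<^sup>+i. c * indicator {a} i \<partial>count_space UNIV)"
    by (intro nn_integral_mono) (auto simp: indicator_def)
  also have "\<dots> = c" by (subst nn_integral_cmult_indicator) auto
  finally show ?thesis .
qed

lemma borel_measurable_nn_integral_count_space:
  fixes f :: "'i \<Rightarrow> 'b \<Rightarrow> ennreal"
  assumes I: "countable I" and f: "\<And>i. i \<in> I \<Longrightarrow> f i \<in> borel_measurable N"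
  shows "(\<lambda>u. \<integral>\<^sup>+i. f i u \<partial>count_space I) \<in> borel_measurable N"
proof -
  interpret sigma_finite_measure "count_space I" using I by (rule sigma_finite_measure_count_space_countable)
  have "(\<lambda>(i, u). f i u) \<in> borel_measurable (count_space I \<Otimes>\<^sub>M N)"
    using I f by (intro measurable_pair_measure_countable1) auto
  then have "(\<lambda>(u, i). f i u) \<in> borel_measurable (N \<Otimes>\<^sub>M count_space I)"
    by (subst measurable_pair_swap_iff) (simp add: case_prod_unfold)
  then show ?thesis by (rule borel_measurable_nn_integral)
qed

section \<open>Mean oscillation\<close>

lemma mean_osc_nonneg [simp]: "0 \<le> mean_osc M B b"
  unfolding mean_osc_def set_lebesgue_integral_def by (intro divide_nonneg_nonneg integral_nonneg) auto

lemma
  fixes b :: "'a \<Rightarrow> complex"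
  assumes B: "B \<in> sets M" and fin: "emeasure M B < \<infinity>" and int: "set_integrable M B b"
  shows set_integrable_norm_diff: "set_integrable M B (\<lambda>x. norm (b x - c))"
    and set_integrable_diff_const: "set_integrable M B (\<lambda>x. b x - c)"
    and ennreal_set_lint_norm_diff:
      "ennreal (LINT x:B|M. norm (b x - c)) = (\<integral>\<^sup>+x\<in>B. ennreal (norm (b x - c)) \<partial>M)"
proof -
  have c: "set_integrable M B (\<lambda>x. c)" using B fin
    by (auto simp: set_integrable_def intro!: integrable_indicator)
  show d: "set_integrable M B (\<lambda>x. b x - c)" using int c by (rule set_integral_diff)
  then show n: "set_integrable M B (\<lambda>x. norm (b x - c))" by (rule set_integrable_norm)
  show "ennreal (LINT x:B|M. norm (b x - c)) = (\<integral>\<^sup>+x\<in>B. ennreal (norm (b x - c)) \<partial>M)"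
    unfolding set_lebesgue_integral_def
    using n[unfolded set_integrable_def]
    by (subst nn_integral_eq_integral[symmetric])
      (auto intro!: nn_integral_cong simp: indicator_def)
qed

lemma norm_avg_diff_le:
  fixes b :: "'a \<Rightarrow> complex"
  assumes B: "B \<in> sets M" and fin: "emeasure M B < \<infinity>" and pos: "0 < measure M B"
    and int: "set_integrable M B b"
  shows "norm (c - avg M B b) \<le> (LINT x:B|M. norm (b x - c)) / measure M B"
proof -
  have "(LINT x:B|M. b x - c) = (LINT x:B|M. b x) - measure M B *\<^sub>R c"
    using int B fin by (subst set_integral_diff) (auto simp: set_integrable_def set_lebesgue_integral_def intro!: integrable_indicator)
  then have "avg M B b - c = (LINT x:B|M. b x - c) /\<^sub>R measure M B"
    using pos by (simp add: avg_def scaleR_diff_right)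
  then have "norm (c - avg M B b) = norm (LINT x:B|M. b x - c) / measure M B"
    using pos by (subst norm_minus_commute) (simp add: divide_inverse mult.commute)
  also have "norm (LINT x:B|M. b x - c) \<le> (LINT x:B|M. norm (b x - c))"
    using set_integrable_diff_const[OF B fin int] by (rule set_integral_norm_bound)
  finally show ?thesis using pos by (simp add: divide_right_mono)
qed

lemma set_lint_norm_mono_set:
  fixes b :: "'a \<Rightarrow> complex"
  assumes "A \<in> sets M" "B \<in> sets M" "A \<subseteq> B" "emeasure M B < \<infinity>" "set_integrable M B b"
  shows "(LINT x:A|M. norm (b x - c)) \<le> (LINT x:B|M. norm (b x - c))"
  unfolding set_lebesgue_integral_def
proof (rule integral_mono)
  show "integrable M (\<lambda>x. indicator B x *\<^sub>R norm (b x - c))"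
    using set_integrable_norm_diff[OF assms(2,4,5)] by (simp add: set_integrable_def)
  then show "integrable M (\<lambda>x. indicator A x *\<^sub>R norm (b x - c))"
    using set_integrable_subset[OF set_integrable_norm_diff[OF assms(2,4,5)] assms(1,3)] by (simp add: set_integrable_def)
qed (use assms(3) in \<open>auto simp: indicator_def\<close>)

lemma avg_norm_diff_le_mean_osc:
  fixes b :: "'a \<Rightarrow> complex"
  assumes A: "A \<in> sets M" and B: "B \<in> sets M" and AB: "A \<subseteq> B"
    and fin: "emeasure M B < \<infinity>" and pos: "0 < measure M A"
    and K: "measure M B \<le> K * measure M A" and int: "set_integrable M B b"
  shows "(LINT x:A|M. norm (b x - avg M B b)) / measure M A \<le> K * mean_osc M B b"
proof -
  have posB: "0 < measure M B" 
    using pos measure_mono_fmeasurable[OF AB A] B fin by (auto simp: fmeasurable_def)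
  have "(LINT x:A|M. norm (b x - avg M B b)) \<le> (LINT x:B|M. norm (b x - avg M B b))"
    using A B AB fin int by (rule set_lint_norm_mono_set)
  also have "\<dots> = mean_osc M B b * measure M B" using posB by (simp add: mean_osc_def)
  also have "\<dots> \<le> mean_osc M B b * (K * measure M A)" by (intro mult_left_mono K) simp
  finally show ?thesis using pos by (simp add: field_simps)
qed

lemma norm_avg_subset_diff_le:
  fixes b :: "'a \<Rightarrow> complex"
  assumes A: "A \<in> sets M" and B: "B \<in> sets M" and AB: "A \<subseteq> B"
    and fin: "emeasure M B < \<infinity>" and pos: "0 < measure M A"
    and K: "measure M B \<le> K * measure M A" and int: "set_integrable M B b"
  shows "norm (avg M B b - avg M A b) \<le> K * mean_osc M B b"
proof -
  have "emeasure M A < \<infinity>" using emeasure_mono[OF AB B] fin by (rule le_less_trans)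
  then have "norm (avg M B b - avg M A b) \<le> (LINT x:A|M. norm (b x - avg M B b)) / measure M A"
    using A pos set_integrable_subset[OF int A AB] by (intro norm_avg_diff_le) auto
  also have "\<dots> \<le> K * mean_osc M B b" using assms by (rule avg_norm_diff_le_mean_osc)
  finally show ?thesis .
qed

text \<open>Any constant in place of the mean over \<open>A\<close> costs at most a factor \<open>2\<close>; the constant used is the mean
  over \<open>B\<close>, and enlarging the domain of integration from \<open>A\<close> to \<open>B\<close> costs \<open>K\<close>.\<close>

lemma mean_osc_subset_le:
  fixes b :: "'a \<Rightarrow> complex"
  assumes A: "A \<in> sets M" and B: "B \<in> sets M" and AB: "A \<subseteq> B"
    and fin: "emeasure M B < \<infinity>" and pos: "0 < measure M A"
    and K: "measure M B \<le> K * measure M A" and int: "set_integrable M B b"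
  shows "mean_osc M A b \<le> 2 * K * mean_osc M B b"
proof -
  have finA: "emeasure M A < \<infinity>" using emeasure_mono[OF AB B] fin by (rule le_less_trans)
  have intA: "set_integrable M A b" using int A AB by (rule set_integrable_subset)
  let ?c = "avg M B b" let ?d = "avg M A b"
  have "(LINT x:A|M. norm (b x - ?d)) \<le> (LINT x:A|M. norm (b x - ?c) + norm (?c - ?d))"
  proof (rule set_integral_mono)
    show "set_integrable M A (\<lambda>x. norm (b x - ?d))" by (rule set_integrable_norm_diff[OF A finA intA])
    show "set_integrable M A (\<lambda>x. norm (b x - ?c) + norm (?c - ?d))"
      using set_integrable_norm_diff[OF A finA intA] A finA
      by (intro set_integral_add) (auto simp: set_integrable_def intro!: integrable_indicator)
    fix x show "norm (b x - ?d) \<le> norm (b x - ?c) + norm (?c - ?d)"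
      using norm_triangle_ineq[of "b x - ?c" "?c - ?d"] by simp
  qed
  also have "\<dots> = (LINT x:A|M. norm (b x - ?c)) + measure M A * norm (?c - ?d)"
    using set_integrable_norm_diff[OF A finA intA] A finA
    by (subst set_integral_add) (auto simp: set_integrable_def set_lebesgue_integral_def intro!: integrable_indicator)
  finally have "mean_osc M A b \<le> (LINT x:A|M. norm (b x - ?c)) / measure M A + norm (?c - ?d)"
    using pos by (simp add: mean_osc_def field_simps)
  also have "\<dots> \<le> K * mean_osc M B b + K * mean_osc M B b"
    using assms by (intro add_mono avg_norm_diff_le_mean_osc norm_avg_subset_diff_le)
  finally show ?thesis by simp
qed

text \<open>The mean oscillation is at most the mean of \<open>\<bar>b x - b y\<bar>\<close> over \<open>B \<times> B\<close>, since subtracting a mean is the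
  mean of the differences. The power is then moved inside by \<open>power_mean_le\<close>, the weight being the
  normalised indicator of \<open>B \<times> B\<close>.\<close>

lemma (in sigma_finite_measure) mean_osc_power_le:
  fixes b :: "'a \<Rightarrow> complex"
  assumes B: "B \<in> sets M" and fin: "emeasure M B < \<infinity>" and pos: "0 < measure M B"
    and int: "set_integrable M B b" and b [measurable]: "b \<in> borel_measurable M" and p: "1 \<le> p"
  shows "ennreal (mean_osc M B b powr p) \<le> ennreal (2 powr p) *
    (\<integral>\<^sup>+(x, y). ennreal (indicator B x * indicator B y / (measure M B)\<^sup>2 * norm (b x - b y) powr p) \<partial>(M \<Otimes>\<^sub>M M))"
proof -
  note [measurable] = B
  let ?m = "measure M B"
  let ?w = "\<lambda>(x, y). indicator B x * indicator B y / ?m\<^sup>2 :: real"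
  let ?f = "\<lambda>(x, y). norm (b x - b y)"
  have em: "emeasure M B = ennreal ?m" using fin by (intro emeasure_eq_ennreal_measure) auto
  have wm: "?w \<in> borel_measurable (M \<Otimes>\<^sub>M M)" by measurable
  have fm: "?f \<in> borel_measurable (M \<Otimes>\<^sub>M M)" by measurable
  have "(\<integral>\<^sup>+u. ennreal (?w u) \<partial>(M \<Otimes>\<^sub>M M)) = (\<integral>\<^sup>+u. ennreal (1 / ?m\<^sup>2) * indicator (B \<times> B) u \<partial>(M \<Otimes>\<^sub>M M))"
    by (intro nn_integral_cong) (auto simp: indicator_def)
  also have "\<dots> = ennreal (1 / ?m\<^sup>2) * (ennreal ?m * ennreal ?m)"
    by (subst nn_integral_cmult_indicator) (auto simp: emeasure_pair_measure_Times em)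
  also have "\<dots> = 1" using pos by (simp add: ennreal_mult[symmetric] power2_eq_square)
  finally have w1: "(\<integral>\<^sup>+u. ennreal (?w u) \<partial>(M \<Otimes>\<^sub>M M)) \<le> ennreal 1" by simp
  have pt: "ennreal (norm (b x - avg M B b)) \<le> ennreal (1 / ?m) * (\<integral>\<^sup>+y. ennreal (norm (b x - b y)) * indicator B y \<partial>M)" for x
  proof -
    have "ennreal (norm (b x - avg M B b)) \<le> ennreal ((LINT y:B|M. norm (b y - b x)) / ?m)"
      by (intro ennreal_leI norm_avg_diff_le B fin pos int)
    also have "\<dots> = ennreal (1 / ?m) * ennreal (LINT y:B|M. norm (b y - b x))"
      using pos by (subst ennreal_mult[symmetric]) (auto simp: set_lebesgue_integral_def intro!: integral_nonneg)
    also have "ennreal (LINT y:B|M. norm (b y - b x)) = (\<integral>\<^sup>+y. ennreal (norm (b y - b x)) * indicator B y \<partial>M)"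
      by (rule ennreal_set_lint_norm_diff[OF B fin int])
    finally show ?thesis by (simp add: norm_minus_commute)
  qed
  have "ennreal (mean_osc M B b) = ennreal (1 / ?m) * ennreal (LINT x:B|M. norm (b x - avg M B b))"
    unfolding mean_osc_def using pos
    by (subst ennreal_mult[symmetric]) (auto simp: set_lebesgue_integral_def intro!: integral_nonneg)
  also have "ennreal (LINT x:B|M. norm (b x - avg M B b)) = (\<integral>\<^sup>+x. ennreal (norm (b x - avg M B b)) * indicator B x \<partial>M)"
    by (rule ennreal_set_lint_norm_diff[OF B fin int])
  also have "ennreal (1 / ?m) * \<dots> \<le> ennreal (1 / ?m) *
     (\<integral>\<^sup>+x. ennreal (1 / ?m) * (\<integral>\<^sup>+y. ennreal (norm (b x - b y)) * indicator B y \<partial>M) * indicator B x \<partial>M)"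
    by (intro mult_left_mono nn_integral_mono mult_right_mono pt) auto
  also have "\<dots> = (\<integral>\<^sup>+x. ennreal (1 / ?m) * (ennreal (1 / ?m) * (\<integral>\<^sup>+y. ennreal (norm (b x - b y)) * indicator B y \<partial>M) * indicator B x) \<partial>M)"
    by (subst nn_integral_cmult) auto
  also have "\<dots> = (\<integral>\<^sup>+x. (\<integral>\<^sup>+y. ennreal (?w (x, y) * ?f (x, y)) \<partial>M) \<partial>M)"
  proof (intro nn_integral_cong)
    fix x
    have "(\<integral>\<^sup>+y. ennreal (?w (x, y) * ?f (x, y)) \<partial>M) =
        (\<integral>\<^sup>+y. ennreal (indicator B x / ?m\<^sup>2) * (ennreal (norm (b x - b y)) * indicator B y) \<partial>M)"
      by (intro nn_integral_cong) (auto simp: indicator_def ennreal_mult[symmetric])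
    also have "\<dots> = ennreal (indicator B x / ?m\<^sup>2) * (\<integral>\<^sup>+y. ennreal (norm (b x - b y)) * indicator B y \<partial>M)"
      by (subst nn_integral_cmult) auto
    also have "ennreal (indicator B x / ?m\<^sup>2) = ennreal (1 / ?m) * (ennreal (1 / ?m) * indicator B x)"
      using pos by (auto simp: indicator_def ennreal_mult[symmetric] power2_eq_square)
    finally show "ennreal (1 / ?m) * (ennreal (1 / ?m) * (\<integral>\<^sup>+y. ennreal (norm (b x - b y)) * indicator B y \<partial>M) * indicator B x) =
       (\<integral>\<^sup>+y. ennreal (?w (x, y) * ?f (x, y)) \<partial>M)" by (simp add: ac_simps)
  qed
  also have "\<dots> = (\<integral>\<^sup>+u. ennreal (?w u * ?f u) \<partial>(M \<Otimes>\<^sub>M M))"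
    by (rule nn_integral_fst) (use wm fm in measurable)
  finally have le: "ennreal (mean_osc M B b) \<le> (\<integral>\<^sup>+u. ennreal (?w u * ?f u) \<partial>(M \<Otimes>\<^sub>M M))" .
  have "ennreal (mean_osc M B b powr p) \<le> ennreal (2 powr p * 1 powr (p - 1)) *
      (\<integral>\<^sup>+u. ennreal (?w u * ?f u powr p) \<partial>(M \<Otimes>\<^sub>M M))"
    by (rule power_mean_le[OF p _ _ wm fm _ _ w1 le]) auto
  then show ?thesis by (simp add: case_prod_unfold)
qed

section \<open>Volumes of balls\<close>

text \<open>The quasi-metric constant and the doubling constant are made parameters, so that constants such as
  \<open>doubling_factor\<close> can be defined once for the whole space.\<close>

locale homogeneous_space =
  fixes M :: "'a measure" and rho :: "'a \<Rightarrow> 'a \<Rightarrow> real" and A0 Cd :: real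
  assumes A0_ge_1: "1 \<le> A0"
    and rho_nonneg: "\<And>x y. x \<in> space M \<Longrightarrow> y \<in> space M \<Longrightarrow> 0 \<le> rho x y"
    and rho_sym: "\<And>x y. x \<in> space M \<Longrightarrow> y \<in> space M \<Longrightarrow> rho x y = rho y x"
    and rho_eq_0: "\<And>x y. x \<in> space M \<Longrightarrow> y \<in> space M \<Longrightarrow> rho x y = 0 \<longleftrightarrow> x = y"
    and rho_triangle: "\<And>x y z. x \<in> space M \<Longrightarrow> y \<in> space M \<Longrightarrow> z \<in> space M \<Longrightarrow>
      rho x y \<le> A0 * (rho x z + rho z y)"
    and ball_measurable: "\<And>x r. x \<in> space M \<Longrightarrow> 0 < r \<Longrightarrow> qball (space M) rho x r \<in> sets M"
    and ball_emeasure_pos: "\<And>x r. x \<in> space M \<Longrightarrow> 0 < r \<Longrightarrow> 0 < emeasure M (qball (space M) rho x r)"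
    and ball_emeasure_finite: "\<And>x r. x \<in> space M \<Longrightarrow> 0 < r \<Longrightarrow> emeasure M (qball (space M) rho x r) < \<infinity>"
    and Cd_ge_1: "1 \<le> Cd"
    and doubling: "\<And>x r. x \<in> space M \<Longrightarrow> 0 < r \<Longrightarrow>
      emeasure M (qball (space M) rho x (2 * r)) \<le> ennreal Cd * emeasure M (qball (space M) rho x r)"

lemma homogeneous_type_imp_homogeneous_space:
  assumes "homogeneous_type M rho"
  obtains A0 Cd where "homogeneous_space M rho A0 Cd"
proof -
  let ?B = "qball (space M) rho"
  have q: "quasi_metric_on (space M) rho"
    and V: "\<forall>x\<in>space M. \<forall>r>0. ?B x r \<in> sets M \<and> 0 < emeasure M (?B x r) \<and> emeasure M (?B x r) < \<infinity>"
    and D: "\<exists>C::real. \<forall>x\<in>space M. \<forall>r>0. emeasure M (?B x (2 * r)) \<le> ennreal C * emeasure M (?B x r)"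
    using assms unfolding homogeneous_type_def by - (elim conjE, assumption)+
  have rho: "\<forall>x\<in>space M. \<forall>y\<in>space M. 0 \<le> rho x y \<and> rho x y = rho y x \<and> (rho x y = 0 \<longleftrightarrow> x = y)"
    and tri: "\<exists>A0\<ge>1. \<forall>x\<in>space M. \<forall>y\<in>space M. \<forall>z\<in>space M. rho x y \<le> A0 * (rho x z + rho z y)"
    using q unfolding quasi_metric_on_def by - (elim conjE, assumption)+
  obtain A0 where A0: "A0 \<ge> 1"
    "\<forall>x\<in>space M. \<forall>y\<in>space M. \<forall>z\<in>space M. rho x y \<le> A0 * (rho x z + rho z y)"
    using tri by (elim exE conjE)
  obtain C where C: "\<forall>x\<in>space M. \<forall>r>0. emeasure M (?B x (2 * r)) \<le> ennreal C * emeasure M (?B x r)"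
    using D by (elim exE)
  have "homogeneous_space M rho A0 (max 1 C)"
  proof
    fix x y assume xy: "x \<in> space M" "y \<in> space M"
    show "0 \<le> rho x y" "rho x y = rho y x" "rho x y = 0 \<longleftrightarrow> x = y"
      using bspec[OF bspec[OF rho xy(1)] xy(2)] by - (elim conjE, assumption)+
    fix w assume w: "w \<in> space M"
    show "rho x y \<le> A0 * (rho x w + rho w y)"
      by (rule bspec[OF bspec[OF bspec[OF A0(2) xy(1)] xy(2)] w])
  next
    fix x r assume x: "x \<in> space M" and r: "0 < (r::real)"
    show "?B x r \<in> sets M" "0 < emeasure M (?B x r)" "emeasure M (?B x r) < \<infinity>"
      using mp[OF spec[OF bspec[OF V x]] r] by - (elim conjE, assumption)+
    have "emeasure M (?B x (2 * r)) \<le> ennreal C * emeasure M (?B x r)"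
      by (rule mp[OF spec[OF bspec[OF C x]] r])
    also have "\<dots> \<le> ennreal (max 1 C) * emeasure M (?B x r)"
      by (rule mult_right_mono) (rule ennreal_leI, rule max.cobounded2, rule zero_le)
    finally show "emeasure M (?B x (2 * r)) \<le> ennreal (max 1 C) * emeasure M (?B x r)" .
  next
    show "1 \<le> A0" by (rule A0(1))
    show "1 \<le> max 1 C" by (rule max.cobounded1)
  qed
  then show thesis by (rule that)
qed

context homogeneous_space
begin

abbreviation X :: "'a set" where "X \<equiv> space M"
abbreviation ball :: "'a \<Rightarrow> real \<Rightarrow> 'a set" where "ball \<equiv> qball X rho"
abbreviation V :: "'a \<Rightarrow> real \<Rightarrow> real" where "V \<equiv> vol M rho"
abbreviation \<mu> :: "'a set \<Rightarrow> real" where "\<mu> \<equiv> measure M"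

lemma mem_ball [simp]: "y \<in> ball x r \<longleftrightarrow> y \<in> X \<and> rho x y < r"
  by (simp add: qball_def)

lemma rho_self [simp]: "x \<in> X \<Longrightarrow> rho x x = 0"
  using rho_eq_0 by blast

lemma ball_nonpos: "x \<in> X \<Longrightarrow> r \<le> 0 \<Longrightarrow> ball x r = {}"
  using rho_nonneg[of x] by fastforce

lemma ball_sets [measurable, simp]: "x \<in> X \<Longrightarrow> ball x r \<in> sets M"
  by (cases "0 < r") (auto simp: ball_measurable ball_nonpos)

lemma ball_finite: "x \<in> X \<Longrightarrow> emeasure M (ball x r) < \<infinity>"
  by (cases "0 < r") (use ball_emeasure_finite in \<open>auto simp: ball_nonpos\<close>)

lemma emeasure_ball: "x \<in> X \<Longrightarrow> emeasure M (ball x r) = ennreal (V x r)"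
  unfolding vol_def using ball_finite[of x r] by (intro emeasure_eq_ennreal_measure) auto

lemma vol_pos: "x \<in> X \<Longrightarrow> 0 < r \<Longrightarrow> 0 < V x r"
  using ball_emeasure_pos[of x r] by (simp add: emeasure_ball)

lemma vol_nonneg [simp]: "0 \<le> V x r"
  by (simp add: vol_def)

lemma measure_le_vol: "A \<subseteq> ball x r \<Longrightarrow> x \<in> X \<Longrightarrow> A \<in> sets M \<Longrightarrow> \<mu> A \<le> V x r"
  unfolding vol_def by (rule measure_mono_fmeasurable) (use ball_finite in \<open>auto simp: fmeasurable_def\<close>)

lemma ball_mono: "r \<le> s \<Longrightarrow> ball x r \<subseteq> ball x s"
  by auto

lemma ball_subset:
  assumes "x \<in> X" "y \<in> X" "A0 * (rho x y + r) \<le> s"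
  shows "ball y r \<subseteq> ball x s"
proof
  fix w assume w: "w \<in> ball y r"
  then have "rho x w \<le> A0 * (rho x y + rho y w)" using assms by (intro rho_triangle) auto
  also have "\<dots> < A0 * (rho x y + r)" using w A0_ge_1 by (intro mult_strict_left_mono) auto
  finally show "w \<in> ball x s" using w assms by simp
qed

lemma vol_double_power:
  assumes "x \<in> X" "0 < r"
  shows "V x (2 ^ n * r) \<le> Cd ^ n * V x r"
proof (induction n)
  case (Suc n)
  have "ennreal (V x (2 * (2 ^ n * r))) \<le> ennreal Cd * ennreal (V x (2 ^ n * r))"
    using doubling[of x "2 ^ n * r"] assms by (simp add: emeasure_ball)
  then have "V x (2 * (2 ^ n * r)) \<le> Cd * V x (2 ^ n * r)"
    using Cd_ge_1 by (simp add: ennreal_mult[symmetric])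
  also have "\<dots> \<le> Cd * (Cd ^ n * V x r)" using Suc Cd_ge_1 by (intro mult_left_mono) auto
  finally show ?case by (simp add: mult.assoc)
qed simp

text \<open>The exponent is large enough for \<open>2\<^sup>n \<ge> 2 A0 a\<close>, which is what \<open>vol_le\<close> needs.\<close>

definition doubling_factor :: "real \<Rightarrow> real" where "doubling_factor a = Cd ^ nat \<lceil>2 * A0 * a\<rceil>"

lemma doubling_factor_ge_1: "1 \<le> doubling_factor a"
  unfolding doubling_factor_def using Cd_ge_1 by (rule one_le_power)

text \<open>The ball \<open>B(y, s)\<close> lies in \<open>B(x, 2 A0 a r)\<close>, which is compared with \<open>B(x, r)\<close> by repeated doubling. The
  comparisons of cubes with balls below all go through this lemma.\<close>

lemma vol_le:
  assumes x: "x \<in> X" "y \<in> X" and r: "0 < r" and s: "s \<le> a * r" and xy: "rho x y \<le> a * r"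
  shows "V y s \<le> doubling_factor a * V x r"
proof -
  let ?n = "nat \<lceil>2 * A0 * a\<rceil>"
  have "2 * A0 * a \<le> real ?n" by linarith
  also have "\<dots> \<le> 2 ^ ?n" by (rule less_imp_le, rule of_nat_less_two_power)
  finally have n: "2 * A0 * a * r \<le> 2 ^ ?n * r" using r by (intro mult_right_mono) auto
  have "A0 * (rho x y + s) \<le> A0 * (a * r + a * r)"
    using s xy A0_ge_1 by (intro mult_left_mono add_mono) auto
  also have "\<dots> \<le> 2 ^ ?n * r" using n by (simp add: algebra_simps)
  finally have "ball y s \<subseteq> ball x (2 ^ ?n * r)" using x by (intro ball_subset) auto
  then have "V y s \<le> V x (2 ^ ?n * r)" using x unfolding vol_def[of M rho y] by (intro measure_le_vol) auto
  also have "\<dots> \<le> doubling_factor a * V x r" unfolding doubling_factor_def using x r by (intro vol_double_power)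
  finally show ?thesis .
qed

lemma vol_mono: "x \<in> X \<Longrightarrow> r \<le> s \<Longrightarrow> V x r \<le> V x s"
  unfolding vol_def[of M rho x r] by (rule measure_le_vol) auto

lemma ex_ball_index: 
  assumes "x \<in> X" "y \<in> X" shows "\<exists>n::nat. y \<in> ball x (real n)"
  using assms reals_Archimedean2[of "rho x y"] by auto

lemma sigma_finite: "sigma_finite_measure M"
proof (cases "X = {}")
  case True
  then show ?thesis by unfold_locales (auto intro!: exI[of _ "{}"])
next
  case False
  then obtain x0 where x0: "x0 \<in> X" by auto
  show ?thesis
  proof
    let ?A = "range (\<lambda>n::nat. ball x0 (real n))"
    have "?A \<subseteq> sets M" using ball_sets[OF x0] by blast
    moreover have "\<Union>?A = X" using ex_ball_index[OF x0] by auto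
    moreover have "emeasure M a \<noteq> \<infinity>" if "a \<in> ?A" for a
      using that ball_finite[OF x0] by (auto simp: less_top[symmetric])
    ultimately show "\<exists>A. countable A \<and> A \<subseteq> sets M \<and> \<Union> A = X \<and> (\<forall>a\<in>A. emeasure M a \<noteq> \<infinity>)"
      by (intro exI[of _ ?A]) simp
  qed
qed

lemma L1_loc_integrable:
  assumes "b \<in> L1_loc M rho" "x \<in> X"
  shows "set_integrable M (ball x r) b"
  using assms by (cases "0 < r") (auto simp: L1_loc_def ball_nonpos set_integrable_def)

lemma L1_loc_measurable:
  assumes b: "b \<in> L1_loc M rho"
  shows "b \<in> borel_measurable M"
proof (cases "X = {}")
  case False
  then obtain x0 where x0: "x0 \<in> X" by auto
  show ?thesis
  proof (rule borel_measurable_LIMSEQ_metric)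
    fix n :: nat
    show "(\<lambda>x. indicator (ball x0 (real n)) x *\<^sub>R b x) \<in> borel_measurable M"
      using L1_loc_integrable[OF b x0] unfolding set_integrable_def by (rule borel_measurable_integrable)
  next
    fix x assume x: "x \<in> X"
    obtain n :: nat where n: "rho x0 x < real n" using reals_Archimedean2 by blast
    have "\<forall>\<^sub>F m in sequentially. indicator (ball x0 (real m)) x *\<^sub>R b x = b x"
      using eventually_ge_at_top[of n] by eventually_elim (use n x in auto)
    then show "(\<lambda>m. indicator (ball x0 (real m)) x *\<^sub>R b x) \<longlonglongrightarrow> b x"
      by (rule tendsto_eventually)
  qed
qed (auto simp: measurable_def)

end

section \<open>Dyadic cubes\<close>

text \<open>The lower bound on \<open>c\<close> has the following effect: if \<open>x \<in> Q \<in> D k\<close> and \<open>rho x y < \<delta>\<^sup>k\<close>, then \<open>B\<^sub>Q\<close> contains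
  the whole cube of level \<open>k\<close> around \<open>y\<close>.\<close>

locale dyadic_space = homogeneous_space +
  fixes \<delta> c0 C0 :: real and D :: "int \<Rightarrow> 'a set set" and z :: "int \<Rightarrow> 'a set \<Rightarrow> 'a" and c :: real
  assumes dyadic: "dyadic_system M rho \<delta> c0 C0 D z"
    and c_ge: "A0 * (C0 + A0 * (1 + 2 * A0 * C0)) \<le> c"
begin

lemma \<delta>: "0 < \<delta>" "\<delta> < 1" and c0: "0 < c0" and c0_le_C0: "c0 \<le> C0"
  using dyadic by (auto simp: dyadic_system_def)

lemma C0: "0 < C0" using c0 c0_le_C0 by linarith

lemma A0_pos: "0 < A0" using A0_ge_1 by linarith

lemma scale_pos [simp]: "0 < \<delta> powi k" using \<delta> by simp

lemma scale_nonneg [simp]: "0 \<le> \<delta> powi k" using scale_pos[of k] by linarith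

lemma scale_Suc: "\<delta> powi (k + 1) = \<delta> * \<delta> powi k"
  using \<delta> by (simp add: power_int_add)

lemma scale_antimono: "k \<le> l \<Longrightarrow> \<delta> powi l \<le> \<delta> powi k"
  using \<delta> by (intro power_int_decreasing) auto

lemma ex_scale:
  assumes "0 < t"
  shows "\<exists>k. \<delta> powi (k + 1) \<le> t \<and> t < \<delta> powi k"
proof -
  define y where "y = ln t / ln \<delta>"
  have l: "ln \<delta> < 0" using \<delta> by simp
  have t: "\<delta> powr y = t" using \<delta> assms l by (simp add: powr_def y_def)
  define k where "k = \<lceil>y\<rceil> - 1"
  have k: "real_of_int k < y" "y \<le> real_of_int (k + 1)" by (auto simp: k_def) linarith+
  have "\<delta> powr real_of_int (k + 1) \<le> \<delta> powr y" "\<delta> powr y < \<delta> powr real_of_int k"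
    using k \<delta> by (auto intro: powr_mono' powr_less_mono')
  then show ?thesis using \<delta> t by (auto simp: powr_real_of_int' simp del: of_int_add)
qed

lemma ex_scale_less:
  assumes "0 < t"
  shows "\<exists>n::nat. \<delta> ^ n < t"
  using real_arch_pow_inv[OF assms \<delta>(2)] .

lemma partition: "partition_on X (D k)" and cube_sets: "Q \<in> D k \<Longrightarrow> Q \<in> sets M"
  and centre: "Q \<in> D k \<Longrightarrow> z k Q \<in> X"
  and inner_ball: "Q \<in> D k \<Longrightarrow> ball (z k Q) (c0 * \<delta> powi k) \<subseteq> Q"
  and outer_ball: "Q \<in> D k \<Longrightarrow> Q \<subseteq> ball (z k Q) (C0 * \<delta> powi k)"
  using dyadic by (auto simp: dyadic_system_def)

lemma cube_subset: "Q \<in> D k \<Longrightarrow> Q \<subseteq> X"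
  using partition[of k] by (auto simp: partition_on_def)

lemma in_cube_in_X: "Q \<in> D k \<Longrightarrow> x \<in> Q \<Longrightarrow> x \<in> X"
  using cube_subset by blast

lemma cube_nonempty: "Q \<in> D k \<Longrightarrow> Q \<noteq> {}"
  using partition[of k] by (auto simp: partition_on_def)

lemma same_level_eq: "Q \<in> D k \<Longrightarrow> P \<in> D k \<Longrightarrow> x \<in> Q \<Longrightarrow> x \<in> P \<Longrightarrow> Q = P"
  using partition[of k] by (auto simp: partition_on_def disjoint_def)

lemma parent: "P \<in> D (k + 1) \<Longrightarrow> \<exists>Q\<in>D k. P \<subseteq> Q"
  using dyadic by (auto simp: dyadic_system_def refines_def)

lemma ancestor:
  assumes "P \<in> D l" "k \<le> l"
  shows "\<exists>Q\<in>D k. P \<subseteq> Q"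
proof -
  have "\<forall>P\<in>D (k + int n). \<exists>Q\<in>D k. P \<subseteq> Q" for n
  proof (induction n)
    case (Suc n)
    show ?case
    proof
      fix P assume "P \<in> D (k + int (Suc n))"
      then have "P \<in> D (k + int n + 1)" by (simp add: add.commute add.left_commute)
      then obtain P' where "P' \<in> D (k + int n)" "P \<subseteq> P'" using parent by blast
      with Suc show "\<exists>Q\<in>D k. P \<subseteq> Q" by (meson order_trans)
    qed
  qed auto
  from this[of "nat (l - k)"] assms show ?thesis by auto
qed

lemma nested:
  assumes "Q \<in> D k" "P \<in> D l" "k \<le> l" "x \<in> Q" "x \<in> P"
  shows "P \<subseteq> Q"
proof -
  obtain Q' where "Q' \<in> D k" "P \<subseteq> Q'" using ancestor[OF assms(2,3)] by blast
  with assms same_level_eq[of Q k Q' x] show ?thesis by auto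
qed

definition cube_at :: "int \<Rightarrow> 'a \<Rightarrow> 'a set" where
  "cube_at k x = (THE Q. Q \<in> D k \<and> x \<in> Q)"

lemma ex1_cube: "x \<in> X \<Longrightarrow> \<exists>!Q. Q \<in> D k \<and> x \<in> Q"
  using partition[of k] same_level_eq[of _ k _ x] by (auto simp: partition_on_def)

lemma cube_at: assumes "x \<in> X" shows "cube_at k x \<in> D k" "x \<in> cube_at k x"
  using theI'[OF ex1_cube[OF assms]] unfolding cube_at_def by blast+

lemma cube_at_eq: "Q \<in> D k \<Longrightarrow> x \<in> Q \<Longrightarrow> cube_at k x = Q"
  using same_level_eq[of Q k "cube_at k x" x] cube_at[of x k] cube_subset by blast

lemma centre_in: "Q \<in> D k \<Longrightarrow> z k Q \<in> Q"
  by (rule subsetD[OF inner_ball]) (use centre c0 in auto)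

lemma cube_bounded: "Q \<in> D k \<Longrightarrow> x \<in> Q \<Longrightarrow> rho (z k Q) x < C0 * \<delta> powi k"
  using outer_ball by fastforce

lemma cube_emeasure_finite: "Q \<in> D k \<Longrightarrow> emeasure M Q < \<infinity>"
  using le_less_trans[OF emeasure_mono[OF outer_ball ball_sets[OF centre]] ball_finite[OF centre]] .

lemma centre_dist_le:
  assumes "Q \<in> D k" "x \<in> Q" "y \<in> X" "rho x y \<le> a * \<delta> powi k"
  shows "rho (z k Q) y \<le> A0 * (C0 + a) * \<delta> powi k"
proof -
  have "rho (z k Q) y \<le> A0 * (rho (z k Q) x + rho x y)"
    using assms centre by (intro rho_triangle) (auto intro: in_cube_in_X)
  also have "\<dots> \<le> A0 * (C0 * \<delta> powi k + a * \<delta> powi k)"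
    using assms cube_bounded[OF assms(1,2)] A0_pos by (intro mult_left_mono add_mono) auto
  finally show ?thesis by (simp add: algebra_simps)
qed

text \<open>A cube of level \<open>k\<close> lies between two balls of radius comparable with \<open>\<delta>\<^sup>k\<close>. Hence its mass is comparable
  with the volume of such a ball around any point at distance at most a multiple of \<open>\<delta>\<^sup>k\<close> from it; the
  two inequalities are this lemma and the next.\<close>

lemma vol_le_cube:
  assumes Q: "Q \<in> D k" "x \<in> Q" and y: "y \<in> X" "rho x y \<le> a * \<delta> powi k" and a: "0 \<le> a" and s: "s \<le> a * \<delta> powi k"
  shows "V y s \<le> doubling_factor (A0 * (C0 + a) / c0) * \<mu> Q"
proof -
  have "a \<le> A0 * (C0 + a)" using A0_ge_1 C0 a mult_mono[of 1 A0 a "C0 + a"] by auto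
  then have "a * \<delta> powi k \<le> A0 * (C0 + a) * \<delta> powi k" by (intro mult_right_mono) auto
  then have "V y s \<le> doubling_factor (A0 * (C0 + a) / c0) * V (z k Q) (c0 * \<delta> powi k)"
    using centre_dist_le[OF Q y] centre[OF Q(1)] y order_trans[OF s] c0 by (intro vol_le) (auto simp: mult.assoc)
  also have "V (z k Q) (c0 * \<delta> powi k) \<le> \<mu> Q"
    unfolding vol_def using inner_ball[OF Q(1)] cube_sets[OF Q(1)] cube_emeasure_finite[OF Q(1)] centre[OF Q(1)]
    by (intro measure_mono_fmeasurable) (auto simp: fmeasurable_def)
  finally show ?thesis using doubling_factor_ge_1[of "A0 * (C0 + a) / c0"] by simp
qed

lemma cube_le_vol:
  assumes Q: "Q \<in> D k" "x \<in> Q" and y: "y \<in> X" "rho x y \<le> a * \<delta> powi k" and a: "0 \<le> a" and e: "0 < e"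
  shows "\<mu> Q \<le> doubling_factor (A0 * (C0 + a) / e) * V y (e * \<delta> powi k)"
proof -
  have "\<mu> Q \<le> V (z k Q) (C0 * \<delta> powi k)"
    using Q centre outer_ball cube_sets by (intro measure_le_vol) auto
  also have "C0 \<le> A0 * (C0 + a)" using A0_ge_1 C0 a mult_mono[of 1 A0 C0 "C0 + a"] by auto
  then have "V (z k Q) (C0 * \<delta> powi k) \<le> doubling_factor (A0 * (C0 + a) / e) * V y (e * \<delta> powi k)"
    using centre_dist_le[OF Q y] centre[OF Q(1)] y e by (intro vol_le) (auto simp: rho_sym)
  finally show ?thesis .
qed

lemma cube_pos: "Q \<in> D k \<Longrightarrow> 0 < \<mu> Q"
proof -
  assume Q: "Q \<in> D k"
  have "V (z k Q) (1 * \<delta> powi k) \<le> doubling_factor (A0 * (C0 + 1) / c0) * \<mu> Q"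
    using Q centre centre_in by (intro vol_le_cube[OF Q centre_in[OF Q]]) auto
  moreover have "0 < V (z k Q) (1 * \<delta> powi k)" using centre[OF Q] by (intro vol_pos) auto
  ultimately have "0 < doubling_factor (A0 * (C0 + 1) / c0) * \<mu> Q" by linarith
  then show ?thesis using doubling_factor_ge_1[of "A0 * (C0 + 1) / c0"] by (simp add: zero_less_mult_iff)
qed

lemma ex_parent_le: "\<exists>K>1. \<forall>k. \<forall>Q\<in>D k. \<forall>P\<in>D (k + 1). P \<subseteq> Q \<longrightarrow> \<mu> Q \<le> K * \<mu> P"
proof -
  let ?K1 = "doubling_factor (A0 * (C0 + 0) / \<delta>)" and ?K2 = "doubling_factor (A0 * (C0 + 1) / c0)"
  have "\<mu> Q \<le> (?K1 * ?K2 + 1) * \<mu> P" if Q: "Q \<in> D k" "P \<in> D (k + 1)" "P \<subseteq> Q" for k P Q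
  proof -
    obtain x where x: "x \<in> P" using cube_nonempty[OF Q(2)] by auto
    then have xX: "x \<in> X" using Q cube_subset by auto
    have "\<mu> Q \<le> ?K1 * V x (\<delta> * \<delta> powi k)"
      using Q x xX \<delta> by (intro cube_le_vol[of Q k x]) auto
    also have "V x (\<delta> * \<delta> powi k) \<le> ?K2 * \<mu> P"
      unfolding scale_Suc[symmetric] using Q x xX by (intro vol_le_cube[of P "k + 1" x]) auto
    finally have "\<mu> Q \<le> ?K1 * (?K2 * \<mu> P)" using doubling_factor_ge_1[of "A0 * (C0 + 0) / \<delta>"] by simp
    then show ?thesis by (simp add: distrib_right mult.assoc add_increasing2)
  qed
  moreover have "1 < ?K1 * ?K2 + 1" using doubling_factor_ge_1 by (smt (verit) mult_pos_pos)
  ultimately show ?thesis by blast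
qed

lemma cubes_iff: "Q \<in> cubes D \<longleftrightarrow> (\<exists>k. Q \<in> D k)"
  by (auto simp: cubes_def)

lemma cubes_nested:
  assumes "P \<in> cubes D" "Q \<in> cubes D" "x \<in> P" "x \<in> Q"
  shows "P \<subseteq> Q \<or> Q \<subseteq> P"
  using assms nested by (meson cubes_iff linorder_linear)

text \<open>The set \<open>Q\<close> may be a cube of several consecutive levels. Descend from level \<open>k\<close> through the cubes around
  a point of \<open>P\<close>: the level \<open>j\<close> is the last one before the cube changes.\<close>

lemma strict_subcube_level:
  assumes P: "P \<in> cubes D" and Q: "Q \<in> D k" and PQ: "P \<subset> Q"
  shows "\<exists>j Q'. Q \<in> D j \<and> Q' \<in> D (j + 1) \<and> P \<subseteq> Q' \<and> Q' \<subset> Q"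
proof -
  obtain l where l: "P \<in> D l" using P cubes_iff by auto
  obtain x where x: "x \<in> P" using cube_nonempty[OF l] by auto
  have xQ: "x \<in> Q" and xX: "x \<in> X" using x PQ l cube_subset by auto
  have kl: "k < l"
  proof (rule ccontr)
    assume "\<not> k < l"
    then have "Q \<subseteq> P" using nested[OF l Q _ x xQ] by simp
    with PQ show False by simp
  qed
  have "\<exists>n. cube_at (k + int n) x \<noteq> Q"
    using kl l x PQ cube_at_eq[OF l x] by (intro exI[of _ "nat (l - k)"]) auto
  define n where "n = (LEAST n. cube_at (k + int n) x \<noteq> Q)"
  have n: "cube_at (k + int n) x \<noteq> Q" unfolding n_def by (rule LeastI_ex) fact
  have min: "cube_at (k + int m) x = Q" if "m < n" for m
    using not_less_Least[of m "\<lambda>n. cube_at (k + int n) x \<noteq> Q"] that unfolding n_def by auto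
  have "n \<noteq> 0" using n cube_at_eq[OF Q xQ] by (metis add_0_right of_nat_0)
  then obtain m where m: "n = Suc m" by (cases n) auto
  let ?j = "k + int m"
  let ?Q' = "cube_at (?j + 1) x"
  have j: "Q \<in> D ?j" using min[of m] cube_at(1)[OF xX, of ?j] m by simp
  have neq: "?Q' \<noteq> Q" using n m by (simp add: add.commute add.left_commute)
  have Q': "?Q' \<in> D (?j + 1)" "x \<in> ?Q'" using cube_at[OF xX] by auto
  have sub: "?Q' \<subseteq> Q" using nested[OF j Q'(1) _ xQ Q'(2)] by simp
  have "n \<le> nat (l - k)" unfolding n_def
    using kl l x PQ cube_at_eq[OF l x] by (intro Least_le) auto
  then have "?j + 1 \<le> l" using m kl by simp
  then have "P \<subseteq> ?Q'" using nested[OF Q'(1) l _ Q'(2) x] by simp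
  with j Q' neq sub show ?thesis by blast
qed

text \<open>At the level where \<open>Q\<close> splits, some child of \<open>Q\<close> is disjoint from \<open>P\<close>, and every child carries a fixed
  fraction of the mass of \<open>Q\<close>. Volumes of balls may stay constant over long ranges of radii, but for
  distinct nested cubes the masses thus grow geometrically.\<close>

lemma ex_strict_subcube_ratio:
  "\<exists>\<theta>>1. \<forall>P\<in>cubes D. \<forall>Q\<in>cubes D. P \<subset> Q \<longrightarrow> \<theta> * \<mu> P \<le> \<mu> Q"
proof -
  obtain K where K: "K > 1" "\<forall>k. \<forall>Q\<in>D k. \<forall>P\<in>D (k + 1). P \<subseteq> Q \<longrightarrow> \<mu> Q \<le> K * \<mu> P"
    using ex_parent_le by (elim exE conjE)
  have "(1 + 1 / K) * \<mu> P \<le> \<mu> Q" if PQ: "P \<in> cubes D" "Q \<in> cubes D" "P \<subset> Q" for P Q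
  proof -
    obtain j Q' where j: "Q \<in> D j" "Q' \<in> D (j + 1)" "P \<subseteq> Q'" "Q' \<subset> Q"
      using strict_subcube_level[OF PQ(1) _ PQ(3)] PQ(2) unfolding cubes_iff[of Q] by blast
    then obtain w where w: "w \<in> Q" "w \<notin> Q'" by auto
    then have wX: "w \<in> X" using j cube_subset by auto
    let ?W = "cube_at (j + 1) w"
    have W: "?W \<in> D (j + 1)" "w \<in> ?W" using cube_at[OF wX] by auto
    have WQ: "?W \<subseteq> Q" using nested[OF j(1) W(1) _ w(1) W(2)] by simp
    have disj: "Q' \<inter> ?W = {}" using same_level_eq[OF j(2) W(1)] w W by auto
    have fm: "Q \<in> fmeasurable M" "Q' \<in> fmeasurable M" "?W \<in> fmeasurable M"
      using j W cube_sets cube_emeasure_finite by (auto simp: fmeasurable_def)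
    obtain l where l: "P \<in> D l" using PQ cubes_iff by auto
    have "\<mu> Q' + \<mu> ?W = \<mu> (Q' \<union> ?W)" using fm disj by (subst measure_Union) (auto simp: fmeasurable_def less_top[symmetric])
    also have "\<dots> \<le> \<mu> Q" using fm j WQ by (intro measure_mono_fmeasurable) auto
    finally have 1: "\<mu> Q' + \<mu> ?W \<le> \<mu> Q" .
    have "\<mu> P \<le> \<mu> Q'" using fm j cube_sets[OF l] by (intro measure_mono_fmeasurable) auto
    moreover have "\<mu> Q \<le> K * \<mu> ?W" by (rule K(2)[rule_format, OF j(1) W(1) WQ])
    then have "\<mu> Q / K \<le> \<mu> ?W" using K(1) by (simp add: field_simps)
    moreover have "\<mu> P \<le> \<mu> Q" using fm PQ cube_sets[OF l] by (intro measure_mono_fmeasurable) auto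
    then have "\<mu> P / K \<le> \<mu> Q / K" using K(1) by (intro divide_right_mono) auto
    ultimately show ?thesis using 1 by (simp add: algebra_simps)
  qed
  then show ?thesis using K(1) by (intro exI[of _ "1 + 1 / K"]) auto
qed

definition packing_number :: "real \<Rightarrow> nat" where
  "packing_number a = nat \<lceil>doubling_factor (A0 * (C0 + A0 * (a + 2 * A0 * C0)) / c0)\<rceil>"

lemma cube_subset_ball:
  assumes Q: "Q \<in> D k" "y \<in> Q" and x: "x \<in> X" "rho x y \<le> a * \<delta> powi k"
  shows "Q \<subseteq> ball x (A0 * (a + 2 * A0 * C0) * \<delta> powi k)"
proof
  fix w assume w: "w \<in> Q"
  have yX: "y \<in> X" "w \<in> X" using Q w cube_subset by auto
  have "rho y w \<le> A0 * (rho y (z k Q) + rho (z k Q) w)" using yX centre[OF Q(1)] by (intro rho_triangle) auto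
  also have "\<dots> < A0 * (C0 * \<delta> powi k + C0 * \<delta> powi k)"
    using cube_bounded[OF Q] cube_bounded[OF Q(1) w] A0_pos yX centre[OF Q(1)]
    by (intro mult_strict_left_mono add_strict_mono) (auto simp: rho_sym)
  finally have *: "rho y w < 2 * A0 * C0 * \<delta> powi k" by (simp add: algebra_simps)
  have "rho x w \<le> A0 * (rho x y + rho y w)" using x yX by (intro rho_triangle) auto
  also have "\<dots> < A0 * (a * \<delta> powi k + 2 * A0 * C0 * \<delta> powi k)"
    using * x A0_pos by (intro mult_strict_left_mono add_le_less_mono) auto
  finally show "w \<in> ball x (A0 * (a + 2 * A0 * C0) * \<delta> powi k)" using yX by (simp add: algebra_simps)
qed

text \<open>The cubes are disjoint, they lie in one ball of radius comparable with \<open>\<delta>\<^sup>k\<close> around \<open>x\<close>, and each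
  carries a fixed fraction of the volume of that ball.\<close>

lemma packing:
  assumes x: "x \<in> X" and a: "0 \<le> a"
  shows "finite {Q \<in> D k. \<exists>y\<in>Q. rho x y \<le> a * \<delta> powi k}" (is "finite ?S")
    and "card {Q \<in> D k. \<exists>y\<in>Q. rho x y \<le> a * \<delta> powi k} \<le> packing_number a"
proof -
  let ?a = "A0 * (a + 2 * A0 * C0)"
  let ?K = "doubling_factor (A0 * (C0 + ?a) / c0)"
  have aa: "a \<le> ?a" "0 < ?a" using A0_ge_1 A0_pos a C0 mult_mono[of 1 A0 a "a + 2 * A0 * C0"]
    by (auto intro!: mult_pos_pos add_nonneg_pos)
  let ?v = "V x (?a * \<delta> powi k)"
  have v: "0 < ?v" using x aa by (intro vol_pos) auto
  have "card F \<le> packing_number a" if F: "F \<subseteq> ?S" "finite F" for F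
  proof -
    have FD: "Q \<in> D k" if "Q \<in> F" for Q using F that by auto
    have one: "?v / ?K \<le> \<mu> Q" if QF: "Q \<in> F" for Q
    proof -
      obtain y where y: "Q \<in> D k" "y \<in> Q" "rho x y \<le> a * \<delta> powi k" using subsetD[OF F(1) QF] by blast
      have "rho y x \<le> ?a * \<delta> powi k"
        using order_trans[OF y(3) mult_right_mono[OF aa(1)]] rho_sym[OF x in_cube_in_X[OF y(1,2)]] by simp
      then have "?v \<le> ?K * \<mu> Q" using y x aa by (intro vol_le_cube[of Q k y]) auto
      then show ?thesis using doubling_factor_ge_1[of "A0 * (C0 + ?a) / c0"] by (simp add: field_simps)
    qed
    have "real (card F) * (?v / ?K) = (\<Sum>Q\<in>F. ?v / ?K)" by simp
    also have "\<dots> \<le> (\<Sum>Q\<in>F. \<mu> Q)" using one by (rule sum_mono)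
    also have "\<dots> = \<mu> (\<Union>Q\<in>F. Q)"
    proof (rule measure_finite_Union[symmetric])
      show "disjoint_family_on (\<lambda>Q. Q) F"
        using same_level_eq FD by (fastforce simp: disjoint_family_on_def)
      show "(\<lambda>Q. Q) ` F \<subseteq> sets M" using FD cube_sets by auto
      show "\<And>Q. Q \<in> F \<Longrightarrow> emeasure M Q \<noteq> \<infinity>" using FD cube_emeasure_finite by fastforce
    qed (rule F(2))
    also have "\<dots> \<le> ?v"
    proof (rule measure_le_vol)
      show "(\<Union>Q\<in>F. Q) \<subseteq> ball x (?a * \<delta> powi k)"
        using F(1) cube_subset_ball[OF _ _ x] by blast
      show "(\<Union>Q\<in>F. Q) \<in> sets M" using FD cube_sets F(2) by (intro sets.finite_UN) auto
    qed (rule x)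
    finally have "real (card F) \<le> ?K" using v doubling_factor_ge_1[of "A0 * (C0 + ?a) / c0"] by (simp add: field_simps)
    then show ?thesis unfolding packing_number_def by linarith
  qed
  then have "finite ?S \<and> card ?S \<le> packing_number a"
    by (intro finite_if_finite_subsets_card_bdd)
  then show "finite ?S" "card ?S \<le> packing_number a" by (rule conjunct1, rule conjunct2)
qed

lemma countable_level: "countable (D k)"
proof (cases "X = {}")
  case True
  then show ?thesis using cube_subset cube_nonempty by (metis all_not_in_conv countable_empty subset_empty)
next
  case False
  then obtain x0 where x0: "x0 \<in> X" by auto
  have "D k \<subseteq> (\<Union>n::nat. {Q \<in> D k. \<exists>y\<in>Q. rho x0 y \<le> real n * \<delta> powi k})"
  proof
    fix Q assume Q: "Q \<in> D k"
    obtain n :: nat where "rho x0 (z k Q) / \<delta> powi k < real n" using reals_Archimedean2 by blast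
    then have "rho x0 (z k Q) \<le> real n * \<delta> powi k" by (simp add: pos_divide_less_eq)
    then show "Q \<in> (\<Union>n::nat. {Q \<in> D k. \<exists>y\<in>Q. rho x0 y \<le> real n * \<delta> powi k})"
      using Q centre_in by blast
  qed
  then show ?thesis
    by (rule countable_subset) (rule countable_UN; use packing(1)[OF x0] in \<open>auto intro!: countable_finite\<close>)
qed

lemma countable_cubes [simp]: "countable (cubes D)"
  unfolding cubes_def using countable_level by auto

text \<open>A cube \<open>Q \<noteq> X\<close> misses a point \<open>w\<close>, whereas \<open>Q \<in> D j\<close> puts a ball of radius \<open>c0 \<delta>\<^sup>j\<close> inside \<open>Q\<close> around one of
  its points; for \<open>j\<close> very negative this ball would reach \<open>w\<close>.\<close>

lemma level_bounded_below:
  assumes Q: "Q \<in> D k" and ne: "Q \<noteq> X"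
  shows "\<exists>m. \<forall>j. Q \<in> D j \<longrightarrow> m \<le> j"
proof -
  obtain w where w: "w \<in> X" "w \<notin> Q" using cube_subset[OF Q] ne by auto
  define R where "R = A0 * (C0 * \<delta> powi k + rho (z k Q) w)"
  have R: "0 < R" unfolding R_def using A0_pos C0 rho_nonneg[OF centre[OF Q] w(1)]
    by (intro mult_pos_pos add_pos_nonneg) auto
  obtain n :: nat where n: "\<delta> ^ n < c0 / R" using ex_scale_less[of "c0 / R"] R c0 by auto
  have "- int n \<le> j" if j: "Q \<in> D j" for j
  proof (rule ccontr)
    assume "\<not> - int n \<le> j"
    then have "\<delta> powi (- int n) \<le> \<delta> powi j" by (intro scale_antimono) simp
    then have 1: "1 / \<delta> ^ n \<le> \<delta> powi j" using \<delta> by (simp add: power_int_minus divide_inverse)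
    have "c0 * \<delta> powi j \<le> rho (z j Q) w"
      using inner_ball[OF j] w by (meson linorder_not_less mem_ball subsetD)
    also have "\<dots> \<le> A0 * (rho (z j Q) (z k Q) + rho (z k Q) w)"
      using centre j Q w by (intro rho_triangle) auto
    also have "\<dots> \<le> R" unfolding R_def
      using cube_bounded[OF Q centre_in[OF j]] A0_pos rho_sym[OF centre[OF Q] centre[OF j]]
      by (intro mult_left_mono add_mono) auto
    finally have "c0 * (1 / \<delta> ^ n) \<le> R" using mult_left_mono[OF 1, of c0] c0 by linarith
    then show False using n R \<delta> c0 by (simp add: field_simps)
  qed
  then show ?thesis by blast
qed

lemma cube_level:
  assumes Q: "Q \<in> cubes D" and ne: "Q \<noteq> X"
  shows "Q \<in> D (cube_level D Q)" and "\<And>j. Q \<in> D j \<Longrightarrow> cube_level D Q \<le> j"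
proof -
  obtain k where k: "Q \<in> D k" using Q cubes_iff by auto
  obtain m where m: "\<And>j. Q \<in> D j \<Longrightarrow> m \<le> j" using level_bounded_below[OF k ne] by blast
  define n where "n = (LEAST n. Q \<in> D (m + int n))"
  have ex: "\<exists>n. Q \<in> D (m + int n)" using k m[OF k] by (intro exI[of _ "nat (k - m)"]) simp
  have n: "Q \<in> D (m + int n)" unfolding n_def by (rule LeastI_ex) (rule ex)
  have le: "m + int n \<le> j" if "Q \<in> D j" for j
  proof -
    have "n \<le> nat (j - m)" unfolding n_def using that m[OF that] by (intro Least_le) simp
    then show ?thesis using m[OF that] by simp
  qed
  have eq: "cube_level D Q = m + int n" unfolding cube_level_def using n le by (rule Least_equality)
  show "Q \<in> D (cube_level D Q)" using n eq by simp
  show "\<And>j. Q \<in> D j \<Longrightarrow> cube_level D Q \<le> j" using le eq by simp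
qed

abbreviation BQ :: "'a set \<Rightarrow> 'a set" where "BQ \<equiv> cube_ball M rho \<delta> D z c"

lemma c_pos: "0 < c"
  using c_ge A0_pos C0 by (smt (verit) mult_pos_pos)

lemma BQ_X [simp]: "BQ X = X" by (simp add: cube_ball_def)

lemma BQ_ball: "Q \<noteq> X \<Longrightarrow> BQ Q = ball (z (cube_level D Q) Q) (c * \<delta> powi cube_level D Q)"
  by (simp add: cube_ball_def)

text \<open>The ball \<open>B\<^sub>Q\<close> is formed at the smallest level of \<open>Q\<close>, that is, at its largest scale, so a bound in
  terms of any other level \<open>k\<close> of \<open>Q\<close> is the weaker one.\<close>

lemma mem_BQ:
  assumes Q: "Q \<in> D k" "x \<in> Q" and y: "y \<in> X" "rho x y < a * \<delta> powi k" and a: "A0 * (C0 + a) \<le> c" "0 \<le> a"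
  shows "y \<in> BQ Q"
proof (cases "Q = X")
  case False
  let ?k = "cube_level D Q"
  have Qc: "Q \<in> cubes D" using Q cubes_iff by auto
  note k = cube_level[OF Qc False]
  have "\<delta> powi k \<le> \<delta> powi ?k" using k Q by (intro scale_antimono) auto
  then have "rho x y < a * \<delta> powi ?k" using y(2) mult_left_mono[of "\<delta> powi k" "\<delta> powi ?k" a] a by linarith
  then have *: "rho (z ?k Q) x + rho x y < C0 * \<delta> powi ?k + a * \<delta> powi ?k"
    using cube_bounded[OF k(1) Q(2)] by linarith
  have "rho (z ?k Q) y \<le> A0 * (rho (z ?k Q) x + rho x y)"
    using centre[OF k(1)] Q y cube_subset by (intro rho_triangle) auto
  also have "\<dots> < A0 * (C0 * \<delta> powi ?k + a * \<delta> powi ?k)"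
    using * A0_pos by (intro mult_strict_left_mono) auto
  also have "\<dots> = A0 * (C0 + a) * \<delta> powi ?k" by (simp add: algebra_simps)
  also have "\<dots> \<le> c * \<delta> powi ?k" using a by (intro mult_right_mono) auto
  finally show ?thesis using y by (simp add: BQ_ball False)
qed (use y in simp)

lemma BQ_subset: "Q \<in> cubes D \<Longrightarrow> BQ Q \<subseteq> X"
  by (auto simp: cube_ball_def)

lemma BQ_sets [measurable]: "Q \<in> cubes D \<Longrightarrow> BQ Q \<in> sets M"
  by (cases "Q = X") (auto simp: BQ_ball cube_level centre)

lemma A0C0_le_c: "A0 * (C0 + A0 * (1 + 2 * A0 * C0)) \<le> c" "A0 * (C0 + 1) \<le> c" "C0 < c"
proof -
  have "1 \<le> 1 + 2 * A0 * C0" using A0_pos C0 by simp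
  then have "1 \<le> A0 * (1 + 2 * A0 * C0)" using A0_ge_1 by (metis mult_mono' mult_1 zero_le_one)
  then have "A0 * (C0 + 1) \<le> A0 * (C0 + A0 * (1 + 2 * A0 * C0))" using A0_pos by simp
  with c_ge show c: "A0 * (C0 + 1) \<le> c" by linarith
  have "1 * (C0 + 1) \<le> A0 * (C0 + 1)" using A0_ge_1 C0 by (intro mult_right_mono) auto
  with c show "C0 < c" by simp
qed (rule c_ge)

lemma cube_subset_BQ: "Q \<in> cubes D \<Longrightarrow> Q \<subseteq> BQ Q"
proof
  fix x assume "Q \<in> cubes D" "x \<in> Q"
  then obtain k where "Q \<in> D k" "x \<in> Q" "x \<in> X" using cubes_iff cube_subset by blast
  then show "x \<in> BQ Q" using A0C0_le_c by (intro mem_BQ[of Q k x x 1]) auto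
qed

lemma BQ_in_ball:
  assumes Q: "Q \<in> cubes D"
  shows "\<exists>x\<in>X. \<exists>r>0. BQ Q \<subseteq> ball x r"
proof (cases "Q = X")
  case True
  obtain k where "Q \<in> D k" using Q cubes_iff by auto
  then show ?thesis using outer_ball[of Q k] centre[of Q k] C0 True
    by (intro bexI[of _ "z k Q"] exI[of _ "C0 * \<delta> powi k"]) auto
next
  case False
  then show ?thesis using cube_level(1)[OF Q False] centre c_pos
    by (intro bexI[of _ "z (cube_level D Q) Q"] exI[of _ "c * \<delta> powi cube_level D Q"]) (auto simp: BQ_ball)
qed

lemma
  assumes Q: "Q \<in> cubes D"
  shows BQ_finite: "emeasure M (BQ Q) < \<infinity>"
    and BQ_integrable: "b \<in> L1_loc M rho \<Longrightarrow> set_integrable M (BQ Q) b"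
proof -
  obtain x r where x: "x \<in> X" and sub: "BQ Q \<subseteq> ball x r" using BQ_in_ball[OF Q] by blast
  show "emeasure M (BQ Q) < \<infinity>"
    using emeasure_mono[OF sub ball_sets[OF x]] ball_finite[OF x] by (rule le_less_trans)
  show "set_integrable M (BQ Q) b" if "b \<in> L1_loc M rho"
    using L1_loc_integrable[OF that x] BQ_sets[OF Q] sub by (rule set_integrable_subset)
qed

definition ball_factor :: real where "ball_factor = doubling_factor (A0 * (C0 + c) / c0)"

lemma BQ_le: 
  assumes Q: "Q \<in> cubes D"
  shows "\<mu> (BQ Q) \<le> ball_factor * \<mu> Q"
proof (cases "Q = X")
  case True
  have "1 * \<mu> X \<le> ball_factor * \<mu> X" unfolding ball_factor_def by (intro mult_right_mono doubling_factor_ge_1) auto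
  with True show ?thesis by simp
next
  case False
  let ?k = "cube_level D Q"
  note k = cube_level(1)[OF Q False]
  have "V (z ?k Q) (c * \<delta> powi ?k) \<le> ball_factor * \<mu> Q"
    unfolding ball_factor_def
  proof (rule vol_le_cube[OF k centre_in[OF k] centre[OF k]])
    show "rho (z ?k Q) (z ?k Q) \<le> c * \<delta> powi ?k" using c_pos centre[OF k] by simp
    show "0 \<le> c" using c_pos by simp
  qed simp
  moreover have "\<mu> (BQ Q) = V (z ?k Q) (c * \<delta> powi ?k)"
    by (simp only: BQ_ball[OF False] vol_def)
  ultimately show ?thesis by (simp only:)
qed

lemma ball_factor_ge_1: "1 \<le> ball_factor" unfolding ball_factor_def by (rule doubling_factor_ge_1)

lemma cubes_pos: "Q \<in> cubes D \<Longrightarrow> 0 < \<mu> Q"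
  using cube_pos cubes_iff by blast

lemma cubes_sets [measurable]: "Q \<in> cubes D \<Longrightarrow> Q \<in> sets M"
  using cube_sets cubes_iff by blast

lemma cubes_finite: "Q \<in> cubes D \<Longrightarrow> emeasure M Q < \<infinity>"
  using cube_emeasure_finite cubes_iff by blast

lemma cube_le_BQ: "Q \<in> cubes D \<Longrightarrow> \<mu> Q \<le> \<mu> (BQ Q)"
  using BQ_finite[of Q] by (intro measure_mono_fmeasurable) (auto simp: cube_subset_BQ BQ_sets cubes_sets fmeasurable_def)

lemma BQ_pos: "Q \<in> cubes D \<Longrightarrow> 0 < \<mu> (BQ Q)"
  using cube_le_BQ[of Q] cubes_pos[of Q] by linarith

section \<open>Oscillations are controlled by the Besov norm\<close>

abbreviation osc :: "('a \<Rightarrow> complex) \<Rightarrow> 'a set \<Rightarrow> real" where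
  "osc b Q \<equiv> mean_osc M (BQ Q) b"

abbreviation cube_energy :: "real \<Rightarrow> ('a \<Rightarrow> complex) \<Rightarrow> 'a set \<Rightarrow> ennreal" where
  "cube_energy p b Q \<equiv> \<integral>\<^sup>+x. ennreal (norm (b x - avg M Q b) powr p) * indicator Q x \<partial>M"

abbreviation cube_sum :: "('a set \<Rightarrow> ennreal) \<Rightarrow> ennreal" (binder "\<Sum>\<^sub>D" 10) where
  "cube_sum f \<equiv> \<integral>\<^sup>+Q. f Q \<partial>count_space (cubes D)"

text \<open>With \<open>2 A0 \<sigma> = c0 / (2 A0)\<close>, balls of radius \<open>\<sigma> \<delta>\<^sup>k\<close> around two points at distance at least
  \<open>c0 \<delta>\<^sup>k / (2 A0)\<close> are disjoint.\<close>

definition \<sigma> :: real where "\<sigma> = c0 / (4 * A0\<^sup>2)"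

text \<open>In units of \<open>\<delta>\<^sup>k\<close>, the outer radius of the annulus of \<open>ex_annulus_point\<close>; the inner one is \<open>2 A0 \<sigma>\<close>.\<close>

definition annulus_radius :: real where "annulus_radius = A0 * (c + 2 * A0 * C0 / \<delta>)"

lemma \<sigma>: "0 < \<sigma>" "\<sigma> \<le> c" "\<sigma> \<le> annulus_radius" "2 * A0 * \<sigma> = c0 / (2 * A0)"
proof -
  show s: "0 < \<sigma>" using c0 A0_pos by (simp add: \<sigma>_def)
  have "\<sigma> \<le> c0" unfolding \<sigma>_def using c0 A0_ge_1
    by (simp add: divide_le_eq mult_ge1_I one_le_power)
  then show sc: "\<sigma> \<le> c" using c0_le_C0 A0C0_le_c by linarith
  have "1 * c \<le> A0 * (c + 2 * A0 * C0 / \<delta>)"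
    using A0_ge_1 c_pos C0 \<delta> by (intro mult_mono) auto
  then show "\<sigma> \<le> annulus_radius" using sc by (simp add: annulus_radius_def)
  show "2 * A0 * \<sigma> = c0 / (2 * A0)" using A0_pos by (simp add: \<sigma>_def power2_eq_square)
qed

text \<open>Since \<open>k\<close> is the smallest level of \<open>Q\<close>, the cube of level \<open>k - 1\<close> around \<open>Q\<close> contains a point \<open>w\<close> outside
  \<open>Q\<close>. The points \<open>w\<close> and \<open>z k Q\<close> have distance at least \<open>c0 \<delta>\<^sup>k\<close>, so that \<open>x\<close> cannot be close to both.\<close>

lemma ex_annulus_point:
  assumes Q: "Q \<in> cubes D" "Q \<noteq> X" and x: "x \<in> BQ Q"
  defines "k \<equiv> cube_level D Q"
  shows "\<exists>w\<in>X. 2 * A0 * \<sigma> * \<delta> powi k \<le> rho x w \<and> rho x w < annulus_radius * \<delta> powi k"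
proof -
  let ?z = "z k Q"
  have k: "Q \<in> D k" "\<And>j. Q \<in> D j \<Longrightarrow> k \<le> j" using cube_level[OF Q] by (auto simp: k_def)
  have x': "x \<in> X" "rho ?z x < c * \<delta> powi k" using x by (auto simp: BQ_ball[OF Q(2)] k_def)
  have zX: "?z \<in> X" using centre[OF k(1)] .
  have "Q \<in> D ((k - 1) + 1)" using k by simp
  then obtain P where P: "P \<in> D (k - 1)" "Q \<subseteq> P" using parent by blast
  have "P \<noteq> Q" using k(2)[of "k - 1"] P by auto
  then obtain w where w: "w \<in> P" "w \<notin> Q" using P by auto
  have wX: "w \<in> X" using in_cube_in_X[OF P(1) w(1)] .
  have lo: "c0 * \<delta> powi k \<le> rho ?z w"
    using inner_ball[OF k(1)] w wX by (meson linorder_not_less mem_ball subsetD)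
  have zP: "?z \<in> P" using centre_in[OF k(1)] P by auto
  have pz: "z (k - 1) P \<in> X" using centre[OF P(1)] .
  have "\<delta> powi k = \<delta> * \<delta> powi (k - 1)" using scale_Suc[of "k - 1"] by simp
  then have dk: "\<delta> powi (k - 1) = \<delta> powi k / \<delta>" using \<delta> by simp
  have "rho ?z w \<le> A0 * (rho ?z (z (k - 1) P) + rho (z (k - 1) P) w)"
    using zX wX pz by (intro rho_triangle) auto
  also have "\<dots> < A0 * (C0 * \<delta> powi (k - 1) + C0 * \<delta> powi (k - 1))"
    using cube_bounded[OF P(1) zP] cube_bounded[OF P(1) w(1)] A0_pos rho_sym[OF zX pz]
    by (intro mult_strict_left_mono add_strict_mono) auto
  also have "\<dots> = 2 * A0 * C0 / \<delta> * \<delta> powi k" by (simp add: dk)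
  finally have hi: "rho ?z w < 2 * A0 * C0 / \<delta> * \<delta> powi k" .
  have "c0 * \<delta> powi k \<le> A0 * (rho ?z x + rho x w)"
    using lo rho_triangle[of ?z w x] zX wX x' by linarith
  then have "2 * (c0 / (2 * A0) * \<delta> powi k) \<le> rho ?z x + rho x w"
    using A0_pos by (simp add: field_simps)
  then consider "c0 / (2 * A0) * \<delta> powi k \<le> rho ?z x" | "c0 / (2 * A0) * \<delta> powi k \<le> rho x w" by linarith
  then show ?thesis
  proof cases
    case 1
    have "1 * (c * \<delta> powi k) \<le> A0 * (c + 2 * A0 * C0 / \<delta>) * \<delta> powi k"
      unfolding mult.assoc[symmetric] using A0_ge_1 c_pos C0 \<delta> by (intro mult_right_mono mult_mono) auto
    then have "rho x ?z < annulus_radius * \<delta> powi k"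
      unfolding annulus_radius_def using x'(2) rho_sym[OF x'(1) zX] by linarith
    then show ?thesis using 1 zX rho_sym[OF x'(1) zX] by (intro bexI[of _ ?z]) (auto simp: \<sigma>(4))
  next
    case 2
    have "rho x w \<le> A0 * (rho x ?z + rho ?z w)" using x' zX wX by (intro rho_triangle) auto
    also have "\<dots> < A0 * (c * \<delta> powi k + 2 * A0 * C0 / \<delta> * \<delta> powi k)"
      using x' hi A0_pos rho_sym[OF x'(1) zX] by (intro mult_strict_left_mono add_strict_mono) auto
    also have "\<dots> = annulus_radius * \<delta> powi k" by (simp add: annulus_radius_def algebra_simps)
    finally show ?thesis using 2 wX by (intro bexI[of _ w]) (auto simp: \<sigma>(4))
  qed
qed

text \<open>The annulus point carries a ball of radius \<open>\<sigma> \<delta>\<^sup>k\<close> that is disjoint from the one around \<open>x\<close> and of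
  comparable volume, and \<open>m\<close> is so large that both lie in the ball of radius \<open>\<sigma> \<delta>\<^sup>k\<^sup>-\<^sup>m\<close> around \<open>x\<close>.\<close>

lemma ex_volume_growth:
  "\<exists>\<theta>>1. \<exists>m::nat. \<forall>Q\<in>cubes D. \<forall>x. Q \<noteq> X \<longrightarrow> x \<in> BQ Q \<longrightarrow>
     \<theta> * V x (\<sigma> * \<delta> powi cube_level D Q) \<le> V x (\<sigma> * \<delta> powi (cube_level D Q - int m))"
proof -
  have Cp: "0 < A0 * (annulus_radius + \<sigma>)" using \<sigma> A0_pos by (intro mult_pos_pos) auto
  obtain m where m: "\<delta> ^ m < \<sigma> / (A0 * (annulus_radius + \<sigma>))"
    using ex_scale_less[of "\<sigma> / (A0 * (annulus_radius + \<sigma>))"] \<sigma> Cp by auto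
  let ?K = "doubling_factor (annulus_radius / \<sigma>)"
  have "(1 + 1 / ?K) * V x (\<sigma> * \<delta> powi cube_level D Q) \<le> V x (\<sigma> * \<delta> powi (cube_level D Q - int m))"
    if Q: "Q \<in> cubes D" "Q \<noteq> X" "x \<in> BQ Q" for Q x
  proof -
    let ?k = "cube_level D Q"
    let ?r = "\<sigma> * \<delta> powi ?k"
    have xX: "x \<in> X" using Q BQ_subset by auto
    obtain w where w: "w \<in> X" "2 * A0 * \<sigma> * \<delta> powi ?k \<le> rho x w" "rho x w < annulus_radius * \<delta> powi ?k"
      using ex_annulus_point[OF Q] by blast
    have r: "0 < ?r" using \<sigma> by simp
    have "A0 * (annulus_radius + \<sigma>) * \<delta> ^ m \<le> \<sigma>" using m Cp by (simp add: field_simps)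
    then have "A0 * (annulus_radius + \<sigma>) * \<delta> ^ m * \<delta> powi (?k - int m) \<le> \<sigma> * \<delta> powi (?k - int m)"
      by (intro mult_right_mono) auto
    moreover have "\<delta> ^ m * \<delta> powi (?k - int m) = \<delta> powi ?k"
      using \<delta> power_int_add[of \<delta> "int m" "?k - int m"] by simp
    ultimately have R: "A0 * (annulus_radius + \<sigma>) * \<delta> powi ?k \<le> \<sigma> * \<delta> powi (?k - int m)"
      by (simp add: mult.assoc)
    have sub1: "ball x ?r \<subseteq> ball x (\<sigma> * \<delta> powi (?k - int m))"
      using \<sigma>(1) by (intro ball_mono mult_left_mono scale_antimono) auto
    have "A0 * (rho x w + ?r) \<le> A0 * (annulus_radius * \<delta> powi ?k + ?r)"
      using w A0_pos by (intro mult_left_mono) auto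
    also have "\<dots> = A0 * (annulus_radius + \<sigma>) * \<delta> powi ?k" by (simp add: algebra_simps)
    finally have sub2: "ball w ?r \<subseteq> ball x (\<sigma> * \<delta> powi (?k - int m))"
      using R xX w by (intro ball_subset) auto
    have disj: "ball x ?r \<inter> ball w ?r = {}"
    proof (rule ccontr)
      assume "ball x ?r \<inter> ball w ?r \<noteq> {}"
      then obtain u where u: "u \<in> X" "rho x u < ?r" "rho w u < ?r" by auto
      have "rho x w \<le> A0 * (rho x u + rho u w)" using xX u w by (intro rho_triangle) auto
      also have "\<dots> < A0 * (?r + ?r)"
        using u A0_pos rho_sym[OF u(1) w(1)] by (intro mult_strict_left_mono add_strict_mono) auto
      finally show False using w(2) by (simp add: algebra_simps)
    qed
    have "V x ?r \<le> ?K * V w ?r"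
      using w xX \<sigma> rho_sym[OF xX w(1)] r by (intro vol_le) auto
    then have "V x ?r / ?K \<le> V w ?r" using doubling_factor_ge_1[of "annulus_radius / \<sigma>"] by (simp add: field_simps)
    then have "V x ?r + V x ?r / ?K \<le> V x ?r + V w ?r" by simp
    also have "\<dots> = \<mu> (ball x ?r \<union> ball w ?r)"
      unfolding vol_def using disj xX w ball_finite[OF xX, of ?r] ball_finite[OF w(1), of ?r]
      by (subst measure_Union) (auto simp: less_top[symmetric])
    also have "\<dots> \<le> V x (\<sigma> * \<delta> powi (?k - int m))"
      using sub1 sub2 xX w by (intro measure_le_vol) auto
    finally show ?thesis by (simp add: algebra_simps)
  qed
  moreover have "1 < 1 + 1 / ?K" using doubling_factor_ge_1[of "annulus_radius / \<sigma>"] by simp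
  ultimately show ?thesis by blast
qed

text \<open>Two cubes with levels at least \<open>m\<close> apart have volumes around \<open>x\<close> that differ by the factor \<open>\<theta>\<close>,
  and cannot lie in the same window. So at most \<open>2 m + 1\<close> levels occur, with boundedly many cubes at each by packing.\<close>

lemma ex_card_levels:
  "\<exists>\<theta>>1. \<exists>N. \<forall>x\<in>X. \<forall>v>0.
     let S = {Q \<in> cubes D. Q \<noteq> X \<and> x \<in> BQ Q \<and> v \<le> V x (\<sigma> * \<delta> powi cube_level D Q) \<and> V x (\<sigma> * \<delta> powi cube_level D Q) < \<theta> * v}
     in finite S \<and> card S \<le> N"
proof -
  obtain \<theta> m where \<theta>: "\<theta> > 1" and gr: "\<forall>Q\<in>cubes D. \<forall>x. Q \<noteq> X \<longrightarrow> x \<in> BQ Q \<longrightarrow>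
     \<theta> * V x (\<sigma> * \<delta> powi cube_level D Q) \<le> V x (\<sigma> * \<delta> powi (cube_level D Q - int m))"
    using ex_volume_growth by (elim exE conjE)
  have "finite {Q \<in> cubes D. Q \<noteq> X \<and> x \<in> BQ Q \<and> v \<le> V x (\<sigma> * \<delta> powi cube_level D Q) \<and> V x (\<sigma> * \<delta> powi cube_level D Q) < \<theta> * v}
     \<and> card {Q \<in> cubes D. Q \<noteq> X \<and> x \<in> BQ Q \<and> v \<le> V x (\<sigma> * \<delta> powi cube_level D Q) \<and> V x (\<sigma> * \<delta> powi cube_level D Q) < \<theta> * v}
      \<le> (2 * m + 1) * packing_number c" (is "finite ?S \<and> card ?S \<le> _")
    if x: "x \<in> X" and v: "0 < v" for x v
  proof (cases "?S = {}")
    case True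
    then show ?thesis by (simp only: True finite.emptyI card.empty simp_thms zero_le)
  next
    case False
    then obtain Q0 where Q0: "Q0 \<in> ?S" by blast
    let ?k = "cube_level D"
    have lev: "?k Q' - int m < ?k Q" if "Q \<in> ?S" "Q' \<in> ?S" for Q Q'
    proof (rule ccontr)
      assume "\<not> ?k Q' - int m < ?k Q"
      then have "?k Q \<le> ?k Q' - int m" by simp
      then have "\<sigma> * \<delta> powi (?k Q' - int m) \<le> \<sigma> * \<delta> powi ?k Q"
        using \<sigma> by (intro mult_left_mono scale_antimono) auto
      then have "V x (\<sigma> * \<delta> powi (?k Q' - int m)) \<le> V x (\<sigma> * \<delta> powi ?k Q)"
        by (rule vol_mono[OF x])
      moreover have "\<theta> * V x (\<sigma> * \<delta> powi ?k Q') \<le> V x (\<sigma> * \<delta> powi (?k Q' - int m))"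
        using gr that(2) by simp
      moreover have "\<theta> * v \<le> \<theta> * V x (\<sigma> * \<delta> powi ?k Q')" using that(2) \<theta> by (intro mult_left_mono) auto
      moreover have "V x (\<sigma> * \<delta> powi ?k Q) < \<theta> * v" using that(1) by simp
      ultimately show False by linarith
    qed
    let ?J = "{?k Q0 - int m .. ?k Q0 + int m}"
    let ?T = "\<lambda>k. {Q \<in> D k. \<exists>y\<in>Q. rho x y \<le> c * \<delta> powi k}"
    have sub: "?S \<subseteq> (\<Union>k\<in>?J. ?T k)"
    proof
      fix Q assume Q: "Q \<in> ?S"
      then have Q': "Q \<in> cubes D" "Q \<noteq> X" "x \<in> BQ Q" by auto
      have k: "Q \<in> D (?k Q)" using cube_level(1)[OF Q'(1,2)] .
      have "rho x (z (?k Q) Q) \<le> c * \<delta> powi ?k Q"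
        using Q'(3) rho_sym[OF x centre[OF k]] by (auto simp: BQ_ball[OF Q'(2)])
      then have "Q \<in> ?T (?k Q)" using k centre_in[OF k] by blast
      moreover have "?k Q \<in> ?J" using lev[OF Q0 Q] lev[OF Q Q0] by simp
      ultimately show "Q \<in> (\<Union>k\<in>?J. ?T k)" by (rule UN_I[rotated])
    qed
    have fin: "finite (?T k)" and cd: "card (?T k) \<le> packing_number c" for k
      using packing[OF x, of c k] c_pos by simp_all
    have finU: "finite (\<Union>k\<in>?J. ?T k)" using fin by (intro finite_UN_I) auto
    have "card ?S \<le> card (\<Union>k\<in>?J. ?T k)" by (rule card_mono[OF finU sub])
    also have "\<dots> \<le> (\<Sum>k\<in>?J. card (?T k))" by (rule card_UN_le) simp
    also have "\<dots> \<le> (\<Sum>k\<in>?J. packing_number c)" using cd by (intro sum_mono)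
    also have "\<dots> = (2 * m + 1) * packing_number c" by (simp add: nat_add_distrib nat_mult_distrib)
    finally show ?thesis using finite_subset[OF sub finU] by blast
  qed
  then show ?thesis using \<theta> unfolding Let_def by blast
qed

text \<open>This is the kernel that arises when \<open>mean_osc_power_le\<close> is summed over all cubes. For \<open>Q \<noteq> X\<close> the mass of
  \<open>B\<^sub>Q\<close> is replaced by the volume of the ball of radius \<open>\<sigma> \<delta>\<^sup>k\<close> around \<open>x\<close>, for which the windows of
  \<open>geometric_sum_le\<close> have been counted; if \<open>X\<close> is a cube, it adds a single term.\<close>

lemma ex_kernel_bound:
  "\<exists>K>0. \<forall>x\<in>X. \<forall>y\<in>X. x \<noteq> y \<longrightarrow>
    (\<Sum>\<^sub>D Q. ennreal (indicator (BQ Q) x * indicator (BQ Q) y / (\<mu> (BQ Q))\<^sup>2))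
      \<le> ennreal (K / (V x (rho x y))\<^sup>2)"
proof -
  obtain \<theta> N where \<theta>: "\<theta> > 1" and card: "\<forall>x\<in>X. \<forall>v>0.
     let S = {Q \<in> cubes D. Q \<noteq> X \<and> x \<in> BQ Q \<and> v \<le> V x (\<sigma> * \<delta> powi cube_level D Q) \<and> V x (\<sigma> * \<delta> powi cube_level D Q) < \<theta> * v}
     in finite S \<and> card S \<le> N"
    using ex_card_levels by (elim exE conjE)
  let ?A = "doubling_factor 1" and ?U = "doubling_factor (2 * A0 * c / \<sigma>)"
  define G where "G = real N / (1 - \<theta> powr - 2)"
  have G: "0 \<le> G" unfolding G_def using \<theta> by (auto simp: powr_minus field_simps ge_one_powr_ge_zero intro!: divide_nonneg_nonneg)
  have main: "(\<Sum>\<^sub>D Q. ennreal (indicator (BQ Q) x * indicator (BQ Q) y / (\<mu> (BQ Q))\<^sup>2))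
      \<le> ennreal ((1 + ?A\<^sup>2 * G * ?U\<^sup>2) / (V x (rho x y))\<^sup>2)"
    if x: "x \<in> X" and y: "y \<in> X" and xy: "x \<noteq> y" for x y
  proof -
    let ?k = "cube_level D"
    let ?v = "\<lambda>Q. V x (\<sigma> * \<delta> powi ?k Q)"
    let ?r = "rho x y"
    have "?r \<noteq> 0" using rho_eq_0[OF x y] xy by blast
    then have r: "0 < ?r" using rho_nonneg[OF x y] by simp
    have Vr: "0 < V x ?r" by (rule vol_pos[OF x r])
    define I where "I = {Q \<in> cubes D. Q \<noteq> X \<and> x \<in> BQ Q \<and> y \<in> BQ Q}"
    have IA: "?v Q \<le> ?A * \<mu> (BQ Q)" and IU: "V x ?r / ?U \<le> ?v Q" if Q: "Q \<in> I" for Q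
    proof -
      let ?z = "z (?k Q) Q"
      have Q': "Q \<in> cubes D" "Q \<noteq> X" using Q by (auto simp: I_def)
      have k: "Q \<in> D (?k Q)" by (rule cube_level(1)[OF Q'])
      have zX: "?z \<in> X" using centre[OF k] .
      have xz: "rho ?z x < c * \<delta> powi ?k Q" and yz: "rho ?z y < c * \<delta> powi ?k Q"
        using Q unfolding I_def by (auto simp: BQ_ball[OF Q'(2)])
      have "?v Q \<le> ?A * V ?z (c * \<delta> powi ?k Q)"
        using xz x zX c_pos \<sigma> by (intro vol_le) (auto intro: mult_right_mono)
      then show "?v Q \<le> ?A * \<mu> (BQ Q)" by (simp only: BQ_ball[OF Q'(2)] vol_def[of M rho ?z])
      have "?r \<le> A0 * (rho x ?z + rho ?z y)" using x y zX by (intro rho_triangle) auto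
      also have "\<dots> \<le> A0 * (c * \<delta> powi ?k Q + c * \<delta> powi ?k Q)"
        using xz yz rho_sym[OF x zX] A0_pos by (intro mult_left_mono add_mono) auto
      also have "\<dots> = 2 * A0 * c / \<sigma> * (\<sigma> * \<delta> powi ?k Q)" using \<sigma>(1) by simp
      finally have rr: "?r \<le> 2 * A0 * c / \<sigma> * (\<sigma> * \<delta> powi ?k Q)" .
      have "V x ?r \<le> ?U * ?v Q"
        using rr x \<sigma>(1) order_trans[OF less_imp_le[OF r] rr] by (intro vol_le) auto
      then show "V x ?r / ?U \<le> ?v Q" using doubling_factor_ge_1[of "2 * A0 * c / \<sigma>"] by (simp add: field_simps)
    qed
    have Up: "0 < V x ?r / ?U" using Vr doubling_factor_ge_1[of "2 * A0 * c / \<sigma>"] by simp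
    have pt: "ennreal (indicator (BQ Q) x * indicator (BQ Q) y / (\<mu> (BQ Q))\<^sup>2) \<le>
        ennreal (1 / (V x ?r)\<^sup>2) * indicator {X} Q + ennreal (?A\<^sup>2) * (ennreal (?v Q powr - 2) * indicator I Q)"
      if Q: "Q \<in> cubes D" for Q
    proof (cases "Q = X")
      case True
      have "V x ?r \<le> \<mu> X"
        unfolding vol_def using x BQ_finite[OF Q] True
        by (intro measure_mono_fmeasurable) (auto simp: fmeasurable_def)
      then have "1 / (\<mu> X)\<^sup>2 \<le> 1 / (V x ?r)\<^sup>2" using Vr by (intro divide_left_mono power_mono mult_pos_pos) auto
      then show ?thesis using True x y by (auto intro!: add_increasing2 ennreal_leI)
    next
      case False
      show ?thesis
      proof (cases "Q \<in> I")
        case True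
        have v: "0 < ?v Q" using Up IU[OF True] by linarith
        have "(?v Q)\<^sup>2 \<le> (?A * \<mu> (BQ Q))\<^sup>2" using v by (intro power_mono IA[OF True]) auto
        then have "1 / (\<mu> (BQ Q))\<^sup>2 \<le> ?A\<^sup>2 * (1 / (?v Q)\<^sup>2)"
          using v BQ_pos[OF Q] by (simp add: field_simps power_mult_distrib)
        also have "1 / (?v Q)\<^sup>2 = ?v Q powr - 2" using v by (simp add: powr_minus divide_inverse)
        finally have "ennreal (1 / (\<mu> (BQ Q))\<^sup>2) \<le> ennreal (?A\<^sup>2) * ennreal (?v Q powr - 2)"
          by (simp add: ennreal_mult[symmetric])
        then show ?thesis using True False by (auto simp: I_def)
      next
        case nI: False
        then have "x \<notin> BQ Q \<or> y \<notin> BQ Q" using Q False by (auto simp: I_def)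
        then show ?thesis by auto
      qed
    qed
    have "(\<Sum>\<^sub>D Q. ennreal (indicator (BQ Q) x * indicator (BQ Q) y / (\<mu> (BQ Q))\<^sup>2)) \<le>
      (\<Sum>\<^sub>D Q. ennreal (1 / (V x ?r)\<^sup>2) * indicator {X} Q + ennreal (?A\<^sup>2) * (ennreal (?v Q powr - 2) * indicator I Q))"
      using pt by (intro nn_integral_mono) auto
    also have "\<dots> = (\<Sum>\<^sub>D Q. ennreal (1 / (V x ?r)\<^sup>2) * indicator {X} Q) +
        ennreal (?A\<^sup>2) * (\<Sum>\<^sub>D Q. ennreal (?v Q powr - 2) * indicator I Q)"
      by (simp add: nn_integral_add nn_integral_cmult)
    also have "\<dots> \<le> ennreal (1 / (V x ?r)\<^sup>2) + ennreal (?A\<^sup>2) * ennreal (G * (V x ?r / ?U) powr - 2)"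
    proof (intro add_mono nn_integral_count_space_singleton_le mult_left_mono)
      have "(\<Sum>\<^sub>D Q. ennreal (?v Q powr - 2) * indicator I Q) =
          (\<integral>\<^sup>+Q. ennreal (?v Q powr - 2) \<partial>count_space I)"
        by (rule nn_integral_count_space_subset) (auto simp: I_def)
      also have "\<dots> \<le> ennreal (G * (V x ?r / ?U) powr - 2)"
      unfolding G_def
      proof (rule geometric_sum_le[OF \<theta> _ Up])
        fix v :: real assume v: "0 < v"
        let ?S = "{Q \<in> cubes D. Q \<noteq> X \<and> x \<in> BQ Q \<and> v \<le> ?v Q \<and> ?v Q < \<theta> * v}"
        have fS: "finite ?S" "card ?S \<le> N" using card[rule_format, OF x v] unfolding Let_def by blast+
        have sub: "{Q \<in> I. v \<le> ?v Q \<and> ?v Q < \<theta> * v} \<subseteq> ?S" by (auto simp: I_def)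
        show "finite {Q \<in> I. v \<le> ?v Q \<and> ?v Q < \<theta> * v} \<and> card {Q \<in> I. v \<le> ?v Q \<and> ?v Q < \<theta> * v} \<le> N"
          using finite_subset[OF sub fS(1)] order_trans[OF card_mono[OF fS(1) sub] fS(2)] by blast
      qed (use IU in auto)
      finally show "(\<Sum>\<^sub>D Q. ennreal (?v Q powr - 2) * indicator I Q) \<le>
        ennreal (G * (V x ?r / ?U) powr - 2)" .
    qed simp
    also have "(V x ?r / ?U) powr - 2 = ?U\<^sup>2 / (V x ?r)\<^sup>2"
      using Up by (simp add: powr_minus power_divide)
    also have "ennreal (1 / (V x ?r)\<^sup>2) + ennreal (?A\<^sup>2) * ennreal (G * (?U\<^sup>2 / (V x ?r)\<^sup>2)) =
        ennreal (1 / (V x ?r)\<^sup>2 + ?A\<^sup>2 * (G * (?U\<^sup>2 / (V x ?r)\<^sup>2)))"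
      using G by (simp add: ennreal_mult[symmetric] ennreal_plus[symmetric] del: ennreal_plus)
    also have "1 / (V x ?r)\<^sup>2 + ?A\<^sup>2 * (G * (?U\<^sup>2 / (V x ?r)\<^sup>2)) = (1 + ?A\<^sup>2 * G * ?U\<^sup>2) / (V x ?r)\<^sup>2"
      by (simp add: add_divide_distrib)
    finally show ?thesis .
  qed
  have "0 < 1 + ?A\<^sup>2 * G * ?U\<^sup>2" using G by (intro add_pos_nonneg mult_nonneg_nonneg) auto
  then show ?thesis using main by blast
qed

abbreviation besov_energy :: "real \<Rightarrow> ('a \<Rightarrow> complex) \<Rightarrow> ennreal" where
  "besov_energy p b \<equiv> \<integral>\<^sup>+(x, y). ennreal (norm (b x - b y) powr p / (V x (rho x y))\<^sup>2) \<partial>(M \<Otimes>\<^sub>M M)"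

abbreviation osc_energy :: "real \<Rightarrow> ('a \<Rightarrow> complex) \<Rightarrow> ennreal" where
  "osc_energy p b \<equiv> \<Sum>\<^sub>D Q. ennreal (osc b Q powr p)"

lemma osc_energy_le_besov_energy:
  assumes p: "1 < p"
  shows "\<exists>K>0. \<forall>b\<in>L1_loc M rho. osc_energy p b \<le> ennreal K * besov_energy p b"
proof -
  obtain K where K: "K > 0" and ker: "\<forall>x\<in>X. \<forall>y\<in>X. x \<noteq> y \<longrightarrow>
    (\<Sum>\<^sub>D Q. ennreal (indicator (BQ Q) x * indicator (BQ Q) y / (\<mu> (BQ Q))\<^sup>2))
      \<le> ennreal (K / (V x (rho x y))\<^sup>2)"
    using ex_kernel_bound by (elim exE conjE)
  interpret sigma_finite_measure M by (rule sigma_finite)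
  have "osc_energy p b \<le> ennreal (2 powr p * K) * besov_energy p b" if b: "b \<in> L1_loc M rho" for b
  proof -
    note [measurable] = L1_loc_measurable[OF b]
    let ?ker = "\<lambda>Q x y. indicator (BQ Q) x * indicator (BQ Q) y / (\<mu> (BQ Q))\<^sup>2 :: real"
    let ?f = "\<lambda>Q (x, y). ennreal (?ker Q x y * norm (b x - b y) powr p)"
    have fm: "?f Q \<in> borel_measurable (M \<Otimes>\<^sub>M M)" if "Q \<in> cubes D" for Q
      using BQ_sets[OF that] by measurable
    have "osc_energy p b \<le> (\<Sum>\<^sub>D Q. ennreal (2 powr p) * (\<integral>\<^sup>+u. ?f Q u \<partial>(M \<Otimes>\<^sub>M M)))"
      using b p L1_loc_measurable[OF b]
      by (intro nn_integral_mono mean_osc_power_le) (auto intro: BQ_sets BQ_finite BQ_pos BQ_integrable simp: BQ_finite[simplified])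
    also have "\<dots> = ennreal (2 powr p) * (\<Sum>\<^sub>D Q. (\<integral>\<^sup>+u. ?f Q u \<partial>(M \<Otimes>\<^sub>M M)))"
      by (simp add: nn_integral_cmult)
    also have "(\<Sum>\<^sub>D Q. (\<integral>\<^sup>+u. ?f Q u \<partial>(M \<Otimes>\<^sub>M M))) =
        (\<integral>\<^sup>+u. (\<Sum>\<^sub>D Q. ?f Q u) \<partial>(M \<Otimes>\<^sub>M M))"
      using fm by (intro nn_integral_count_space_nn_integral[symmetric]) auto
    also have "\<dots> \<le> ennreal K * besov_energy p b"
    proof (rule nn_integral_le_cmult[OF _ K])
      show "(\<lambda>u. \<Sum>\<^sub>D Q. ?f Q u) \<in> borel_measurable (M \<Otimes>\<^sub>M M)"
        using fm by (intro borel_measurable_nn_integral_count_space) auto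
      fix u assume u: "u \<in> space (M \<Otimes>\<^sub>M M)"
      obtain x y where xy: "u = (x, y)" "x \<in> X" "y \<in> X" using u by (auto simp: space_pair_measure)
      have "(\<Sum>\<^sub>D Q. ?f Q u) \<le>
         ennreal K * ennreal (norm (b x - b y) powr p / (V x (rho x y))\<^sup>2)"
      \<comment> \<open>On the diagonal the kernel may sum to infinity, but the difference of values vanishes.\<close>
      proof (cases "x = y")
        case False
        have "(\<Sum>\<^sub>D Q. ?f Q u) =
            (\<Sum>\<^sub>D Q. ennreal (?ker Q x y) * ennreal (norm (b x - b y) powr p))"
          by (intro nn_integral_cong) (simp add: xy ennreal_mult[symmetric])
        also have "\<dots> = (\<Sum>\<^sub>D Q. ennreal (?ker Q x y)) * ennreal (norm (b x - b y) powr p)"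
          by (simp add: nn_integral_multc)
        also have "\<dots> \<le> ennreal (K / (V x (rho x y))\<^sup>2) * ennreal (norm (b x - b y) powr p)"
          using ker xy False by (intro mult_right_mono) auto
        also have "\<dots> = ennreal K * ennreal (norm (b x - b y) powr p / (V x (rho x y))\<^sup>2)"
          using K by (simp add: ennreal_mult[symmetric])
        finally show ?thesis .
      qed (simp add: xy)
      then show "(\<Sum>\<^sub>D Q. ?f Q u) \<le>
          ennreal K * (case u of (x, y) \<Rightarrow> ennreal (norm (b x - b y) powr p / (V x (rho x y))\<^sup>2))"
        by (simp add: xy)
    qed
    finally show ?thesis using K by (simp add: ennreal_mult mult.assoc mult_left_mono)
  qed
  then show ?thesis using K by (intro exI[of _ "2 powr p * K"]) simp
qed

section \<open>Sums along chains of cubes\<close>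

text \<open>Along a chain the masses of distinct cubes differ by a fixed factor, so both sums are geometric.\<close>

lemma ex_chain_sum_bound:
  assumes s: "0 < s"
  shows "\<exists>C>0. \<forall>I. \<forall>m>0. I \<subseteq> cubes D \<longrightarrow> (\<forall>P\<in>I. \<forall>Q\<in>I. P \<subseteq> Q \<or> Q \<subseteq> P) \<longrightarrow>
     ((\<forall>P\<in>I. \<mu> P \<le> m) \<longrightarrow> (\<integral>\<^sup>+P. ennreal ((\<mu> P / m) powr s) \<partial>count_space I) \<le> ennreal C) \<and>
     ((\<forall>P\<in>I. m \<le> \<mu> P) \<longrightarrow> (\<integral>\<^sup>+P. ennreal ((m / \<mu> P) powr s) \<partial>count_space I) \<le> ennreal C)"
proof -
  obtain \<theta> where \<theta>: "\<theta> > 1" "\<forall>P\<in>cubes D. \<forall>Q\<in>cubes D. P \<subset> Q \<longrightarrow> \<theta> * \<mu> P \<le> \<mu> Q"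
    using ex_strict_subcube_ratio by (elim exE conjE)
  let ?C = "1 / (1 - \<theta> powr - s)"
  have bound: "(\<integral>\<^sup>+P. ennreal (u P powr - s) \<partial>count_space I) \<le> ennreal ?C"
    if u: "\<forall>P\<in>I. 1 \<le> u P" and sep: "\<forall>P\<in>I. \<forall>Q\<in>I. P \<noteq> Q \<longrightarrow> \<theta> * u P \<le> u Q \<or> \<theta> * u Q \<le> u P"
    for I :: "'a set set" and u
  proof -
    have "(\<integral>\<^sup>+P. ennreal (u P powr - s) \<partial>count_space I) \<le> ennreal (real 1 / (1 - \<theta> powr - s) * 1 powr - s)"
    proof (rule geometric_sum_le[OF \<theta>(1) s])
      show "1 \<le> u P" if "P \<in> I" for P using u that by blast
      fix v :: real assume v: "0 < v"
      \<comment> \<open>The separation leaves at most one index per window.\<close>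
      let ?S = "{P \<in> I. v \<le> u P \<and> u P < \<theta> * v}"
      have eq: "P = Q" if PQ: "P \<in> ?S" "Q \<in> ?S" for P Q
      proof (rule ccontr)
        assume "P \<noteq> Q"
        then consider "\<theta> * u P \<le> u Q" | "\<theta> * u Q \<le> u P" using sep PQ by blast
        moreover have "\<theta> * v \<le> \<theta> * u P" "\<theta> * v \<le> \<theta> * u Q"
          using PQ \<theta>(1) by (auto intro: mult_left_mono)
        ultimately show False using PQ by cases auto
      qed
      show "finite ?S \<and> card ?S \<le> 1"
      proof (cases "?S = {}")
        case True
        show ?thesis unfolding True by simp
      next
        case False
        then obtain P where "P \<in> ?S" by blast
        then have "?S \<subseteq> {P}" using eq by blast
        then show ?thesis using finite_subset[of ?S "{P}"] card_mono[of "{P}" ?S] by simp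
      qed
    qed simp
    then show ?thesis by simp
  qed
  have main: "((\<forall>P\<in>I. \<mu> P \<le> m) \<longrightarrow> (\<integral>\<^sup>+P. ennreal ((\<mu> P / m) powr s) \<partial>count_space I) \<le> ennreal ?C) \<and>
     ((\<forall>P\<in>I. m \<le> \<mu> P) \<longrightarrow> (\<integral>\<^sup>+P. ennreal ((m / \<mu> P) powr s) \<partial>count_space I) \<le> ennreal ?C)"
    if I: "I \<subseteq> cubes D" and chain: "\<forall>P\<in>I. \<forall>Q\<in>I. P \<subseteq> Q \<or> Q \<subseteq> P" and m: "0 < m" for I and m :: real
  proof (intro conjI impI)
    have pos: "0 < \<mu> P" if "P \<in> I" for P using that I cubes_pos by blast
    have ratio: "\<theta> * \<mu> P \<le> \<mu> Q \<or> \<theta> * \<mu> Q \<le> \<mu> P" if "P \<in> I" "Q \<in> I" "P \<noteq> Q" for P Q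
    proof -
      have "P \<in> cubes D" "Q \<in> cubes D" using that I by auto
      moreover have "P \<subset> Q \<or> Q \<subset> P" using chain that by blast
      ultimately show ?thesis using \<theta>(2)[rule_format, of P Q] \<theta>(2)[rule_format, of Q P] by blast
    qed
    have eq: "(\<integral>\<^sup>+P. ennreal (f P powr s) \<partial>count_space I) = (\<integral>\<^sup>+P. ennreal ((1 / f P) powr - s) \<partial>count_space I)"
      if "\<And>P. P \<in> I \<Longrightarrow> 0 < f P" for f :: "'a set \<Rightarrow> real"
      by (intro nn_integral_cong) (auto simp: powr_minus powr_divide dest: that)
    {
      assume le: "\<forall>P\<in>I. \<mu> P \<le> m"
      have inv: "\<theta> * (1 / (B / m)) \<le> 1 / (A / m)" if "\<theta> * A \<le> B" "0 < A" "0 < B" for A B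
      proof -
        have "\<theta> * A * (m / (A * B)) \<le> B * (m / (A * B))"
          using that m by (intro mult_right_mono) auto
        then show ?thesis using that by simp
      qed
      show "(\<integral>\<^sup>+P. ennreal ((\<mu> P / m) powr s) \<partial>count_space I) \<le> ennreal ?C"
      proof (subst eq)
        show "0 < \<mu> P / m" if "P \<in> I" for P using pos[OF that] m by simp
        show "(\<integral>\<^sup>+P. ennreal ((1 / (\<mu> P / m)) powr - s) \<partial>count_space I) \<le> ennreal ?C"
        proof (intro bound ballI impI)
          show "1 \<le> 1 / (\<mu> P / m)" if "P \<in> I" for P using le pos[OF that] that by simp
          show "\<theta> * (1 / (\<mu> P / m)) \<le> 1 / (\<mu> Q / m) \<or> \<theta> * (1 / (\<mu> Q / m)) \<le> 1 / (\<mu> P / m)"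
            if PQ: "P \<in> I" "Q \<in> I" "P \<noteq> Q" for P Q
            using ratio[OF PQ] inv[of "\<mu> P" "\<mu> Q"] inv[of "\<mu> Q" "\<mu> P"] pos[OF PQ(1)] pos[OF PQ(2)] by argo
        qed
      qed
    next
      assume le: "\<forall>P\<in>I. m \<le> \<mu> P"
      have inv: "\<theta> * (1 / (m / A)) \<le> 1 / (m / B)" if "\<theta> * A \<le> B" for A B
        using divide_right_mono[OF that, of m] m by simp
      show "(\<integral>\<^sup>+P. ennreal ((m / \<mu> P) powr s) \<partial>count_space I) \<le> ennreal ?C"
      proof (subst eq)
        show "0 < m / \<mu> P" if "P \<in> I" for P using pos[OF that] m by simp
        show "(\<integral>\<^sup>+P. ennreal ((1 / (m / \<mu> P)) powr - s) \<partial>count_space I) \<le> ennreal ?C"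
        proof (intro bound ballI impI)
          show "1 \<le> 1 / (m / \<mu> P)" if "P \<in> I" for P using le m that by simp
          show "\<theta> * (1 / (m / \<mu> P)) \<le> 1 / (m / \<mu> Q) \<or> \<theta> * (1 / (m / \<mu> Q)) \<le> 1 / (m / \<mu> P)"
            if PQ: "P \<in> I" "Q \<in> I" "P \<noteq> Q" for P Q
            using ratio[OF PQ] inv[of "\<mu> P" "\<mu> Q"] inv[of "\<mu> Q" "\<mu> P"] by argo
        qed
      qed
    }
  qed
  have pos: "0 < ?C" using gr_one_powr[OF \<theta>(1) s] by (simp add: powr_minus inverse_less_1_iff)
  show ?thesis
    by (intro exI[of _ ?C] conjI[OF pos] allI impI) (rule main; assumption)
qed

text \<open>The cubes containing a given point, and those containing a given cube, form chains.\<close>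

lemma ex_nested_sum_bound:
  assumes s: "0 < s"
  shows "\<exists>C>0. (\<forall>Q\<in>cubes D. \<forall>x\<in>Q.
       (\<Sum>\<^sub>D P. ennreal ((\<mu> P / \<mu> Q) powr s) * indicator {P. x \<in> P \<and> P \<subseteq> Q} P) \<le> ennreal C) \<and>
     (\<forall>P\<in>cubes D.
       (\<Sum>\<^sub>D Q. ennreal ((\<mu> P / \<mu> Q) powr s) * indicator {Q. P \<subseteq> Q} Q) \<le> ennreal C)"
proof -
  obtain C where C: "C > 0" "\<forall>I. \<forall>m>0. I \<subseteq> cubes D \<longrightarrow> (\<forall>P\<in>I. \<forall>Q\<in>I. P \<subseteq> Q \<or> Q \<subseteq> P) \<longrightarrow>
     ((\<forall>P\<in>I. \<mu> P \<le> m) \<longrightarrow> (\<integral>\<^sup>+P. ennreal ((\<mu> P / m) powr s) \<partial>count_space I) \<le> ennreal C) \<and>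
     ((\<forall>P\<in>I. m \<le> \<mu> P) \<longrightarrow> (\<integral>\<^sup>+P. ennreal ((m / \<mu> P) powr s) \<partial>count_space I) \<le> ennreal C)"
    using ex_chain_sum_bound[OF s] by (elim exE conjE)
  have mass_mono: "\<mu> P \<le> \<mu> Q" if "P \<in> cubes D" "Q \<in> cubes D" "P \<subseteq> Q" for P Q
    using that cubes_finite[of Q] by (intro measure_mono_fmeasurable) (auto simp: fmeasurable_def cubes_sets)
  show ?thesis
  proof (intro exI[of _ C] conjI ballI C(1))
    fix Q x assume Q: "Q \<in> cubes D" "x \<in> Q"
    let ?I = "cubes D \<inter> {P. x \<in> P \<and> P \<subseteq> Q}"
    have "\<forall>P\<in>?I. \<forall>P'\<in>?I. P \<subseteq> P' \<or> P' \<subseteq> P" using cubes_nested[of _ _ x] by auto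
    moreover have "\<forall>P\<in>?I. \<mu> P \<le> \<mu> Q" using mass_mono Q by auto
    ultimately show "(\<Sum>\<^sub>D P. ennreal ((\<mu> P / \<mu> Q) powr s) * indicator {P. x \<in> P \<and> P \<subseteq> Q} P) \<le> ennreal C"
      unfolding nn_integral_count_space_Int
      by (rule mp[OF conjunct1[OF mp[OF mp[OF mp[OF spec[OF spec[OF C(2)]] cubes_pos[OF Q(1)]] Int_lower1]]]])
  next
    fix P assume P: "P \<in> cubes D"
    let ?I = "cubes D \<inter> {Q. P \<subseteq> Q}"
    obtain k where k: "P \<in> D k" using P cubes_iff by blast
    obtain x where x: "x \<in> P" using cube_nonempty[OF k] by blast
    have "\<forall>Q\<in>?I. \<forall>Q'\<in>?I. Q \<subseteq> Q' \<or> Q' \<subseteq> Q" using cubes_nested[of _ _ x] x by auto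
    moreover have "\<forall>Q\<in>?I. \<mu> P \<le> \<mu> Q" using mass_mono P by auto
    ultimately show "(\<Sum>\<^sub>D Q. ennreal ((\<mu> P / \<mu> Q) powr s) * indicator {Q. P \<subseteq> Q} Q) \<le> ennreal C"
      unfolding nn_integral_count_space_Int
      by (rule mp[OF conjunct2[OF mp[OF mp[OF mp[OF spec[OF spec[OF C(2)]] cubes_pos[OF P]] Int_lower1]]]])
  qed
qed

section \<open>The Besov norm is controlled by oscillations\<close>

lemma avg_cube_BQ:
  assumes b: "b \<in> L1_loc M rho" and Q: "Q \<in> cubes D"
  shows "norm (avg M (BQ Q) b - avg M Q b) \<le> ball_factor * osc b Q"
    and "mean_osc M Q b \<le> 2 * ball_factor * osc b Q"
  using cubes_sets[OF Q] BQ_sets[OF Q] cube_subset_BQ[OF Q] BQ_finite[OF Q] cubes_pos[OF Q] BQ_le[OF Q] BQ_integrable[OF Q b]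
  by (rule norm_avg_subset_diff_le mean_osc_subset_le)+

lemma cube_set_integrable: "b \<in> L1_loc M rho \<Longrightarrow> Q \<in> cubes D \<Longrightarrow> set_integrable M Q b"
  using set_integrable_subset[OF BQ_integrable cubes_sets cube_subset_BQ] .

lemma ex_child_avg_diff:
  "\<exists>K>0. \<forall>b\<in>L1_loc M rho. \<forall>k. \<forall>Q\<in>D k. \<forall>P\<in>D (k + 1). P \<subseteq> Q \<longrightarrow>
     norm (avg M P b - avg M Q b) \<le> K * osc b Q"
proof -
  obtain K where K: "K > 1" "\<forall>k. \<forall>Q\<in>D k. \<forall>P\<in>D (k + 1). P \<subseteq> Q \<longrightarrow> \<mu> Q \<le> K * \<mu> P"
    using ex_parent_le by (elim exE conjE)
  have "norm (avg M P b - avg M Q b) \<le> (ball_factor * K + ball_factor) * osc b Q"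
    if b: "b \<in> L1_loc M rho" and Q: "Q \<in> D k" "P \<in> D (k + 1)" "P \<subseteq> Q" for b k Q P
  proof -
    have Q': "Q \<in> cubes D" "P \<in> cubes D" using Q cubes_iff by auto
    have "\<mu> (BQ Q) \<le> ball_factor * \<mu> Q" by (rule BQ_le[OF Q'(1)])
    also have "\<dots> \<le> ball_factor * (K * \<mu> P)" using K(2) Q ball_factor_ge_1 by (intro mult_left_mono) auto
    finally have "\<mu> (BQ Q) \<le> ball_factor * K * \<mu> P" by (simp add: mult.assoc)
    then have "norm (avg M (BQ Q) b - avg M P b) \<le> ball_factor * K * osc b Q"
      using Q(3) cube_subset_BQ[OF Q'(1)]
      by (intro norm_avg_subset_diff_le cubes_sets BQ_sets BQ_finite cubes_pos BQ_integrable Q' b) auto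
    moreover have "norm (avg M P b - avg M Q b) \<le> norm (avg M (BQ Q) b - avg M P b) + norm (avg M (BQ Q) b - avg M Q b)"
      using norm_triangle_ineq4[of "avg M (BQ Q) b - avg M Q b" "avg M (BQ Q) b - avg M P b"] by (simp add: norm_minus_commute)
    ultimately show ?thesis using avg_cube_BQ(1)[OF b Q'(1)] by (simp add: distrib_right)
  qed
  moreover have "0 < ball_factor * K + ball_factor" using ball_factor_ge_1 K by (intro add_pos_pos mult_pos_pos) auto
  ultimately show ?thesis by blast
qed

abbreviation osc_sum :: "('a \<Rightarrow> complex) \<Rightarrow> 'a set \<Rightarrow> 'a \<Rightarrow> ennreal" where
  "osc_sum b Q x \<equiv> \<Sum>\<^sub>D P. ennreal (osc b P) * indicator {P. x \<in> P \<and> P \<subseteq> Q} P"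

text \<open>From one level to the next the mean changes only if the cube changes, and then by at most a multiple of
  the oscillation of the larger cube. Hence each set \<open>P\<close> is charged once, at however many levels it
  occurs, and the charge fits the sum over distinct cubes.\<close>

lemma ex_telescoping:
  "\<exists>K>0. \<forall>b\<in>L1_loc M rho. \<forall>k. \<forall>Q\<in>D k. \<forall>x\<in>Q. \<forall>n.
     ennreal (norm (avg M (cube_at (k + int n) x) b - avg M Q b)) \<le> ennreal K * osc_sum b Q x"
proof -
  obtain K where K: "K > 0" "\<forall>b\<in>L1_loc M rho. \<forall>k. \<forall>Q\<in>D k. \<forall>P\<in>D (k + 1). P \<subseteq> Q \<longrightarrow>
     norm (avg M P b - avg M Q b) \<le> K * osc b Q"
    using ex_child_avg_diff by (elim exE conjE)
  have "ennreal (norm (avg M (cube_at (k + int n) x) b - avg M Q b)) \<le> ennreal K * osc_sum b Q x"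
    if b: "b \<in> L1_loc M rho" and Q: "Q \<in> D k" "x \<in> Q" for b k Q x n
  proof -
    have xX: "x \<in> X" using in_cube_in_X[OF Q] .
    let ?q = "\<lambda>n. cube_at (k + int n) x"
    have q: "?q n \<in> D (k + int n)" "x \<in> ?q n" for n using cube_at[OF xX] by auto
    have mono: "?q n \<subseteq> ?q m" if "m \<le> n" for m n
      using nested[OF q(1)[of m] q(1)[of n] _ q(2) q(2)] that by simp
    have q0: "?q 0 = Q" using cube_at_eq[OF Q] by simp
    let ?F = "\<lambda>n. ?q ` {..<n}"
    have real_bound: "norm (avg M (?q n) b - avg M Q b) \<le> K * (\<Sum>P\<in>?F n - {?q n}. osc b P)" for n
    proof (induction n)
      case 0
      show ?case using q0 by simp
    next
      case (Suc n)
      have F: "?F (Suc n) = insert (?q n) (?F n)" by (simp only: lessThan_Suc image_insert)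
      show ?case
      proof (cases "?q (Suc n) = ?q n")
        case True
        then have "?F (Suc n) - {?q (Suc n)} = ?F n - {?q n}" unfolding F True by simp
        with Suc True show ?thesis by metis
      next
        case False
        have nin: "?q (Suc n) \<notin> ?F n"
        proof
          assume "?q (Suc n) \<in> ?F n"
          then obtain m where m: "m < n" "?q (Suc n) = ?q m" by blast
          then have "?q n \<subseteq> ?q (Suc n)" using mono[of m n] by simp
          then show False using mono[of n "Suc n"] False by simp
        qed
        then have eq: "?F (Suc n) - {?q (Suc n)} = insert (?q n) (?F n - {?q n})"
          unfolding F using False by blast
        have "?q (Suc n) \<in> D ((k + int n) + 1)" using q(1)[of "Suc n"] by (simp add: ac_simps)
        then have "norm (avg M (?q (Suc n)) b - avg M (?q n) b) \<le> K * mean_osc M (BQ (?q n)) b"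
          using K(2)[rule_format, OF b q(1)[of n]] mono[of n "Suc n"] by simp
        moreover have "norm (avg M (?q (Suc n)) b - avg M Q b) \<le>
            norm (avg M (?q (Suc n)) b - avg M (?q n) b) + norm (avg M (?q n) b - avg M Q b)"
          using norm_triangle_ineq[of "avg M (?q (Suc n)) b - avg M (?q n) b" "avg M (?q n) b - avg M Q b"] by simp
        moreover have "(\<Sum>P\<in>?F (Suc n) - {?q (Suc n)}. osc b P) =
            mean_osc M (BQ (?q n)) b + (\<Sum>P\<in>?F n - {?q n}. osc b P)"
          unfolding eq by (subst sum.insert) auto
        ultimately show ?thesis using Suc by (simp add: distrib_left)
      qed
    qed
    let ?G = "?F n - {?q n}"
    have fG: "finite ?G" by simp
    have "?q m \<in> cubes D \<and> x \<in> ?q m \<and> ?q m \<subseteq> Q" for m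
      using q[of m] mono[of 0 m] q0 unfolding cubes_iff by blast
    then have G: "?G \<subseteq> cubes D" "\<forall>P\<in>?G. x \<in> P \<and> P \<subseteq> Q" by blast+
    have "ennreal (norm (avg M (?q n) b - avg M Q b)) \<le> ennreal (K * (\<Sum>P\<in>?G. osc b P))"
      by (intro ennreal_leI real_bound)
    also have "\<dots> = ennreal K * (\<Sum>P\<in>?G. ennreal (osc b P))"
      using K(1) by (subst sum_ennreal) (auto simp: ennreal_mult sum_nonneg)
    also have "(\<Sum>P\<in>?G. ennreal (osc b P)) = (\<integral>\<^sup>+P. ennreal (osc b P) \<partial>count_space ?G)"
      using fG by (rule nn_integral_count_space_finite[symmetric])
    also have "\<dots> = (\<Sum>\<^sub>D P. ennreal (osc b P) * indicator ?G P)"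
      by (rule nn_integral_count_space_subset[OF G(1), symmetric])
    also have "\<dots> \<le> osc_sum b Q x"
      using G(2) by (intro nn_integral_mono mult_left_mono) (auto simp: indicator_def)
    finally show ?thesis by (simp add: mult_left_mono)
  qed
  then show ?thesis using K(1) by blast
qed

lemma cube_oscillation_integral_le:
  assumes b: "b \<in> L1_loc M rho" and P: "P \<in> cubes D"
  shows "(\<integral>\<^sup>+x. ennreal (norm (b x - avg M P b)) * indicator P x \<partial>M) \<le> ennreal (2 * ball_factor * (\<mu> P * osc b P))"
proof -
  have "(\<integral>\<^sup>+x. ennreal (norm (b x - avg M P b)) * indicator P x \<partial>M) = ennreal (LINT x:P|M. norm (b x - avg M P b))"
    by (rule ennreal_set_lint_norm_diff[OF cubes_sets[OF P] cubes_finite[OF P] cube_set_integrable[OF b P], symmetric])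
  also have "(LINT x:P|M. norm (b x - avg M P b)) = mean_osc M P b * \<mu> P"
    using cubes_pos[OF P] by (simp add: mean_osc_def)
  also have "\<dots> \<le> 2 * ball_factor * osc b P * \<mu> P" by (intro mult_right_mono avg_cube_BQ(2) b P) simp
  finally show ?thesis by (simp add: ac_simps ennreal_leI)
qed

lemma singleton_oscillation_integral:
  assumes P: "{a} \<in> cubes D"
  shows "(\<integral>\<^sup>+x. ennreal (norm (b x - avg M {a} b)) * indicator {a} x \<partial>M) = 0"
proof -
  have "(LINT x:{a}|M. b x) = (LINT x|M. indicator {a} x *\<^sub>R b a)"
    unfolding set_lebesgue_integral_def by (intro Bochner_Integration.integral_cong) (auto simp: indicator_def)
  also have "\<dots> = \<mu> {a} *\<^sub>R b a" using cubes_sets[OF P] cubes_finite[OF P] by (simp add: integral_indicator)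
  finally have "avg M {a} b = b a" using cubes_pos[OF P] by (simp add: avg_def)
  then have "ennreal (norm (b x - avg M {a} b)) * indicator {a} x = 0" for x by (auto simp: indicator_def)
  then show ?thesis by (simp only: nn_integral_const mult_zero_left)
qed

text \<open>Cubes of high level have small diameter.\<close>

lemma eventually_not_in_level:
  assumes "\<nexists>a. P = {a}"
  shows "\<forall>\<^sub>F n in sequentially. P \<notin> D (k + int n)"
proof (cases "\<exists>j. P \<in> D j")
  case True
  then obtain j where j: "P \<in> D j" by blast
  obtain x where x: "x \<in> P" using cube_nonempty[OF j] by blast
  then obtain y where y: "y \<in> P" "y \<noteq> x" using assms by blast
  have X: "x \<in> X" "y \<in> X" using in_cube_in_X[OF j] x y by auto
  have "rho x y \<noteq> 0" using rho_eq_0[OF X] y by blast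
  then have r: "0 < rho x y" using rho_nonneg[OF X] by simp
  have pos: "0 < A0 * (2 * A0 * C0) * \<delta> powi k" using A0_pos C0 by (intro mult_pos_pos) auto
  obtain N where N: "\<delta> ^ N < rho x y / (A0 * (2 * A0 * C0) * \<delta> powi k)"
    using ex_scale_less[of "rho x y / (A0 * (2 * A0 * C0) * \<delta> powi k)"] r pos by auto
  have "P \<notin> D (k + int n)" if n: "N \<le> n" for n
  proof
    assume P: "P \<in> D (k + int n)"
    have "P \<subseteq> ball x (A0 * (0 + 2 * A0 * C0) * \<delta> powi (k + int n))"
      using X by (intro cube_subset_ball[OF P x]) auto
    then have "rho x y < A0 * (2 * A0 * C0) * \<delta> powi (k + int n)" using y by auto
    also have "\<delta> powi (k + int n) = \<delta> powi k * \<delta> ^ n" using \<delta> by (simp add: power_int_add)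
    also have "A0 * (2 * A0 * C0) * (\<delta> powi k * \<delta> ^ n) \<le> A0 * (2 * A0 * C0) * (\<delta> powi k * \<delta> ^ N)"
      using \<delta> n A0_pos C0 by (intro mult_left_mono power_decreasing) auto
    also have "\<dots> < rho x y" using N pos by (simp add: field_simps)
    finally show False .
  qed
  then show ?thesis by (auto simp: eventually_sequentially)
next
  case False
  then show ?thesis by auto
qed

text \<open>Apply \<open>le_add_powr\<close> with \<open>A = (\<mu> P / \<mu> Q)\<^sup>s\<close>. The terms \<open>\<mu> P A\<close> are summed by integrating the chain sums over
  \<open>Q\<close>. In the others the exponent \<open>s (1 - p) = - 1/2\<close> leaves a factor
  \<open>\<mu> P (\<mu> P / \<mu> Q)\<^sup>-\<^sup>1\<^sup>/\<^sup>2 \<le> \<mu> Q\<close>, and the powers of the oscillations are summable.\<close>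

lemma finite_weighted_osc_sum:
  assumes p: "1 < p" and b: "b \<in> L1_loc M rho" and fin: "osc_energy p b < \<infinity>" and Q: "Q \<in> cubes D"
  shows "(\<Sum>\<^sub>D P. ennreal (\<mu> P * osc b P) * indicator {P. P \<subseteq> Q} P) < \<infinity>"
proof -
  interpret sigma_finite_measure M by (rule sigma_finite)
  define s where "s = 1 / (2 * (p - 1))"
  have s: "0 < s" "s * (1 - p) = - (1 / 2)" using p by (auto simp: s_def field_simps)
  obtain C where C: "C > 0" "\<forall>Q\<in>cubes D. \<forall>x\<in>Q.
     (\<Sum>\<^sub>D P. ennreal ((\<mu> P / \<mu> Q) powr s) * indicator {P. x \<in> P \<and> P \<subseteq> Q} P) \<le> ennreal C"
    using ex_nested_sum_bound[OF s(1)] by blast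
  let ?a = "\<lambda>P. osc b P" and ?r = "\<lambda>P. \<mu> P / \<mu> Q"
  note Qp = cubes_pos[OF Q]
  have pt: "ennreal (\<mu> P * ?a P) * indicator {P. P \<subseteq> Q} P \<le>
      ennreal (\<mu> P * ?r P powr s) * indicator {P. P \<subseteq> Q} P + ennreal (\<mu> Q) * ennreal (?a P powr p)" if P: "P \<in> cubes D" for P
  proof (cases "P \<subseteq> Q")
    case True
    note Pp = cubes_pos[OF P]
    have rp: "0 < ?r P" using Pp Qp by simp
    have "\<mu> P \<le> \<mu> Q" using True P Q cubes_finite[OF Q]
      by (intro measure_mono_fmeasurable) (auto simp: fmeasurable_def cubes_sets)
    then have r1: "?r P \<le> 1" using Qp by simp
    have "?a P \<le> ?r P powr s + (?r P powr s) powr (1 - p) * ?a P powr p"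
      using p rp by (intro le_add_powr) auto
    also have "(?r P powr s) powr (1 - p) = ?r P powr - (1 / 2)" by (simp add: powr_powr s(2))
    finally have "\<mu> P * ?a P \<le> \<mu> P * (?r P powr s + ?r P powr - (1 / 2) * ?a P powr p)"
      by (intro mult_left_mono) auto
    also have "\<dots> = \<mu> P * ?r P powr s + \<mu> Q * (?r P powr 1 * ?r P powr - (1 / 2)) * ?a P powr p"
      using Qp rp by (simp add: algebra_simps)
    also have "?r P powr 1 * ?r P powr - (1 / 2) = ?r P powr (1 / 2)"
      unfolding powr_add[symmetric] by simp
    also have "\<mu> Q * ?r P powr (1 / 2) * ?a P powr p \<le> \<mu> Q * 1 * ?a P powr p"
      using rp r1 powr_mono2[of "1 / 2" "?r P" 1] by (intro mult_right_mono mult_left_mono) auto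
    finally have "\<mu> P * ?a P \<le> \<mu> P * ?r P powr s + \<mu> Q * ?a P powr p" by simp
    then show ?thesis using True
      by (simp add: ennreal_mult[symmetric] ennreal_plus[symmetric] ennreal_leI del: ennreal_plus)
  qed simp
  have "(\<Sum>\<^sub>D P. ennreal (\<mu> P * ?r P powr s) * indicator {P. P \<subseteq> Q} P) =
      (\<Sum>\<^sub>D P. (\<integral>\<^sup>+x. ennreal (?r P powr s) * indicator {P. P \<subseteq> Q} P * indicator P x \<partial>M))"
  proof (intro nn_integral_cong)
    fix P assume "P \<in> space (count_space (cubes D))"
    then have P: "P \<in> cubes D" by simp
    have "emeasure M P = ennreal (\<mu> P)" using cubes_finite[OF P] by (intro emeasure_eq_ennreal_measure) auto
    then show "ennreal (\<mu> P * ?r P powr s) * indicator {P. P \<subseteq> Q} P =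
       (\<integral>\<^sup>+x. ennreal (?r P powr s) * indicator {P. P \<subseteq> Q} P * indicator P x \<partial>M)"
      using cubes_sets[OF P] by (subst nn_integral_cmult_indicator) (simp_all add: ennreal_mult ac_simps)
  qed
  also have "\<dots> = (\<integral>\<^sup>+x. (\<Sum>\<^sub>D P. ennreal (?r P powr s) * indicator {P. P \<subseteq> Q} P * indicator P x) \<partial>M)"
    by (rule nn_integral_count_space_nn_integral[symmetric]) (auto simp: cubes_sets)
  also have "\<dots> \<le> (\<integral>\<^sup>+x. ennreal C * indicator Q x \<partial>M)"
  proof (intro nn_integral_mono)
    fix x
    have "(\<Sum>\<^sub>D P. ennreal (?r P powr s) * indicator {P. P \<subseteq> Q} P * indicator P x) =
        (\<Sum>\<^sub>D P. ennreal (?r P powr s) * indicator {P. x \<in> P \<and> P \<subseteq> Q} P)"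
      by (intro nn_integral_cong) (auto simp: indicator_def)
    also have "\<dots> \<le> ennreal C * indicator Q x"
    proof (cases "x \<in> Q")
      case True
      then show ?thesis using C(2) Q by simp
    next
      case False
      then have "ennreal (?r P powr s) * indicator {P. x \<in> P \<and> P \<subseteq> Q} P = 0" for P by (auto simp: indicator_def)
      then show ?thesis by (simp only: nn_integral_const mult_zero_left zero_le)
    qed
    finally show "(\<Sum>\<^sub>D P. ennreal (?r P powr s) * indicator {P. P \<subseteq> Q} P * indicator P x) \<le> ennreal C * indicator Q x" .
  qed
  also have "\<dots> = ennreal C * emeasure M Q" using cubes_sets[OF Q] by (simp add: nn_integral_cmult_indicator)
  finally have weights: "(\<Sum>\<^sub>D P. ennreal (\<mu> P * ?r P powr s) * indicator {P. P \<subseteq> Q} P) \<le>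
    ennreal C * emeasure M Q" .
  have "(\<Sum>\<^sub>D P. ennreal (\<mu> P * ?a P) * indicator {P. P \<subseteq> Q} P) \<le>
     (\<Sum>\<^sub>D P. ennreal (\<mu> P * ?r P powr s) * indicator {P. P \<subseteq> Q} P + ennreal (\<mu> Q) * ennreal (?a P powr p))"
    using pt by (intro nn_integral_mono) auto
  also have "\<dots> = (\<Sum>\<^sub>D P. ennreal (\<mu> P * ?r P powr s) * indicator {P. P \<subseteq> Q} P) + ennreal (\<mu> Q) * osc_energy p b"
    by (simp add: nn_integral_add nn_integral_cmult)
  also have "\<dots> \<le> ennreal C * emeasure M Q + ennreal (\<mu> Q) * osc_energy p b"
    by (rule add_right_mono[OF weights])
  also have "\<dots> < \<infinity>"
    using cubes_finite[OF Q] fin by (simp add: ennreal_mult_less_top)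
  finally show ?thesis .
qed

text \<open>Let \<open>b\<^sub>n\<close> be the mean of \<open>b\<close> over the cube of level \<open>k + n\<close> around \<open>x\<close>. By telescoping, the part of
  \<open>\<bar>b - b\<^sub>Q\<bar>\<close> in excess of the asserted bound is at most \<open>\<bar>b - b\<^sub>n\<bar>\<close>, so it is enough that \<open>\<integral> \<bar>b - b\<^sub>n\<bar>\<close> over \<open>Q\<close>
  tends to \<open>0\<close>. That integral is at most a multiple of the sum of \<open>\<mu> P\<close> times the oscillation of \<open>P\<close>
  over the cubes \<open>P \<subseteq> Q\<close> of level \<open>k + n\<close>, singletons contributing nothing. Since the sum over all
  \<open>P \<subseteq> Q\<close> converges and a cube with two points leaves the levels eventually, dominated convergence
  applies.\<close>

lemma ex_AE_bound:
  assumes p: "1 < p"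
  shows "\<exists>K>0. \<forall>b\<in>L1_loc M rho. osc_energy p b < \<infinity> \<longrightarrow> (\<forall>Q\<in>cubes D.
     AE x in M. x \<in> Q \<longrightarrow> ennreal (norm (b x - avg M Q b)) \<le> ennreal K * osc_sum b Q x)"
proof -
  interpret sigma_finite_measure M by (rule sigma_finite)
  obtain K where K: "K > 0" "\<forall>b\<in>L1_loc M rho. \<forall>k. \<forall>Q\<in>D k. \<forall>x\<in>Q. \<forall>n.
     ennreal (norm (avg M (cube_at (k + int n) x) b - avg M Q b)) \<le> ennreal K * osc_sum b Q x"
    using ex_telescoping by (elim exE conjE)
  have main: "AE x in M. x \<in> Q \<longrightarrow> ennreal (norm (b x - avg M Q b)) \<le> ennreal K * osc_sum b Q x"
    if b: "b \<in> L1_loc M rho" and fin: "osc_energy p b < \<infinity>" and Q: "Q \<in> cubes D" for b Q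
  proof -
    note [measurable] = L1_loc_measurable[OF b] cubes_sets[OF Q]
    obtain k where k: "Q \<in> D k" using Q cubes_iff by blast
    let ?d = "\<lambda>P x. ennreal (norm (b x - avg M P b)) * indicator P x"
    let ?L = "\<lambda>n. {P. P \<in> D (k + int n) \<and> P \<subseteq> Q}"
    let ?g = "\<lambda>x. ennreal (norm (b x - avg M Q b)) * indicator Q x"
    let ?h = "\<lambda>n x. \<Sum>\<^sub>D P. ?d P x * indicator (?L n) P"
    let ?s = "\<lambda>x. ennreal K * osc_sum b Q x"
    have dm: "?d P \<in> borel_measurable M" if "P \<in> cubes D" for P
      using cubes_sets[OF that] by measurable
    have sm: "?s \<in> borel_measurable M"
    proof -
      have "(\<lambda>x. osc_sum b Q x) \<in> borel_measurable M"
      proof (rule borel_measurable_nn_integral_count_space)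
        fix P assume P: "P \<in> cubes D"
        have "(\<lambda>x. ennreal (osc b P) * indicator {P. x \<in> P \<and> P \<subseteq> Q} P) =
            (\<lambda>x. ennreal (osc b P) * (if P \<subseteq> Q then 1 else 0) * indicator P x)"
          by (auto simp: fun_eq_iff indicator_def)
        then show "(\<lambda>x. ennreal (osc b P) * indicator {P. x \<in> P \<and> P \<subseteq> Q} P) \<in> borel_measurable M"
          using cubes_sets[OF P] by simp
      qed simp
      then show ?thesis by measurable
    qed
    have gh: "?g x - ?s x \<le> ?h n x" for x n
    proof (cases "x \<in> Q")
      case True
      have xX: "x \<in> X" using in_cube_in_X[OF k True] .
      let ?P = "cube_at (k + int n) x"
      have P: "?P \<in> D (k + int n)" "x \<in> ?P" using cube_at[OF xX] by auto
      have PQ: "?P \<subseteq> Q" using nested[OF k P(1) _ True P(2)] by simp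
      have Pc: "?P \<in> cubes D" using P cubes_iff by blast
      have "?g x \<le> ennreal (norm (avg M ?P b - avg M Q b)) + ennreal (norm (b x - avg M ?P b))"
        using True norm_triangle_ineq[of "avg M ?P b - avg M Q b" "b x - avg M ?P b"]
        by (simp add: ennreal_plus[symmetric] ennreal_leI del: ennreal_plus)
      also have "\<dots> \<le> ?s x + ?d ?P x"
        using K(2)[rule_format, OF b k True, of n] P by (intro add_mono) auto
      also have "?d ?P x = (\<Sum>\<^sub>D P. ?d P x * indicator {?P} P)"
        using Pc by (subst nn_integral_indicator_singleton) auto
      also have "\<dots> \<le> ?h n x"
        using P PQ by (intro nn_integral_mono mult_left_mono) (auto simp: indicator_def)
      finally have "?g x \<le> ?s x + ?h n x" by (simp add: add_left_mono)
      then show ?thesis using True by (simp add: ennreal_minus_le_iff)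
    qed simp
    define \<epsilon> where "\<epsilon> n = (\<Sum>\<^sub>D P. ennreal (2 * ball_factor) * (ennreal (\<mu> P * osc b P) * indicator {P. P \<subseteq> Q} P) *
        indicator {P. P \<in> D (k + int n) \<and> (\<nexists>a. P = {a})} P)" for n
    have int_h: "(\<integral>\<^sup>+x. ?h n x \<partial>M) \<le> \<epsilon> n" for n
    proof -
      have "(\<integral>\<^sup>+x. ?h n x \<partial>M) = (\<Sum>\<^sub>D P. (\<integral>\<^sup>+x. ?d P x * indicator (?L n) P \<partial>M))"
        using dm by (intro nn_integral_count_space_nn_integral) auto
      also have "\<dots> \<le> \<epsilon> n"
        unfolding \<epsilon>_def
      proof (intro nn_integral_mono)
        fix P assume "P \<in> space (count_space (cubes D))"
        then have P: "P \<in> cubes D" by simp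
        have eq: "(\<integral>\<^sup>+x. ?d P x * indicator (?L n) P \<partial>M) = (\<integral>\<^sup>+x. ?d P x \<partial>M) * indicator (?L n) P"
          using dm[OF P] by (rule nn_integral_multc)
        show "(\<integral>\<^sup>+x. ?d P x * indicator (?L n) P \<partial>M) \<le>
          ennreal (2 * ball_factor) * (ennreal (\<mu> P * osc b P) * indicator {P. P \<subseteq> Q} P) *
          indicator {P. P \<in> D (k + int n) \<and> (\<nexists>a. P = {a})} P"
        proof (cases "\<exists>a. P = {a}")
          case True
          then have "(\<integral>\<^sup>+x. ?d P x \<partial>M) = 0" using singleton_oscillation_integral P by blast
          then show ?thesis unfolding eq by simp
        next
          case False
          have "(\<integral>\<^sup>+x. ?d P x \<partial>M) \<le> ennreal (2 * ball_factor) * ennreal (\<mu> P * osc b P)"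
            using cube_oscillation_integral_le[OF b P] ball_factor_ge_1 by (simp add: ennreal_mult)
          then show ?thesis unfolding eq using False by (auto simp: indicator_def)
        qed
      qed
      finally show ?thesis .
    qed
    have "\<epsilon> \<longlonglongrightarrow> (\<Sum>\<^sub>D P. 0)"
      unfolding \<epsilon>_def
    proof (rule nn_integral_dominated_convergence)
      let ?w = "\<lambda>P. ennreal (2 * ball_factor) * (ennreal (\<mu> P * osc b P) * indicator {P. P \<subseteq> Q} P)"
      show "(\<Sum>\<^sub>D P. ?w P) < \<infinity>"
        using finite_weighted_osc_sum[OF p b fin Q] by (subst nn_integral_cmult) (auto simp: ennreal_mult_less_top)
      show "AE P in count_space (cubes D). ?w P * indicator {P. P \<in> D (k + int j) \<and> (\<nexists>a. P = {a})} P \<le> ?w P" for j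
        by (intro AE_I2) (auto simp: indicator_def)
      show "AE P in count_space (cubes D). (\<lambda>i. ?w P * indicator {P. P \<in> D (k + int i) \<and> (\<nexists>a. P = {a})} P) \<longlonglongrightarrow> 0"
      proof (intro AE_I2)
        fix P
        have "\<forall>\<^sub>F i in sequentially. ?w P * indicator {P. P \<in> D (k + int i) \<and> (\<nexists>a. P = {a})} P = 0"
        proof (cases "\<exists>a. P = {a}")
          case True
          then show ?thesis by simp
        next
          case False
          from eventually_not_in_level[OF False, of k] show ?thesis
            by eventually_elim simp
        qed
        then show "(\<lambda>i. ?w P * indicator {P. P \<in> D (k + int i) \<and> (\<nexists>a. P = {a})} P) \<longlonglongrightarrow> 0"
          by (rule tendsto_eventually)
      qed
    qed auto
    then have lim: "\<epsilon> \<longlonglongrightarrow> 0" by simp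
    have "(\<integral>\<^sup>+x. ?g x - ?s x \<partial>M) \<le> \<epsilon> n" for n
      using gh[of _ n] by (intro order_trans[OF nn_integral_mono int_h])
    then have "(\<integral>\<^sup>+x. ?g x - ?s x \<partial>M) \<le> 0"
      by (intro LIMSEQ_le_const[OF lim]) auto
    then have "(\<integral>\<^sup>+x. ?g x - ?s x \<partial>M) = 0" by simp
    moreover have "(\<lambda>x. ?g x - ?s x) \<in> borel_measurable M" using sm by measurable
    ultimately have "AE x in M. ?g x - ?s x = 0" by (simp only: nn_integral_0_iff_AE)
    then show ?thesis
      by eventually_elim (auto simp: diff_eq_0_iff_ennreal)
  qed
  show ?thesis
    by (intro exI[of _ K] conjI ballI impI) (rule K(1), (rule main; assumption))
qed

text \<open>Hoelder's inequality with the weights \<open>(\<mu> P / \<mu> Q)\<^sup>s\<close>, \<open>s = 1 / (2 (p - 1))\<close>, on the chain \<open>x \<in> P \<subseteq> Q\<close>. The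
  weights have bounded sum and cost a factor \<open>(\<mu> P / \<mu> Q)\<^sup>-\<^sup>1\<^sup>/\<^sup>2\<close>; integration over \<open>x \<in> P\<close> gains \<open>\<mu> P / \<mu> Q\<close>,
  and a positive power of this ratio remains. The choice of \<open>s\<close> is where \<open>p > 1\<close> enters.\<close>

lemma ex_cube_Lp_bound:
  assumes p: "1 < p"
  shows "\<exists>K>0. \<forall>b\<in>L1_loc M rho. osc_energy p b < \<infinity> \<longrightarrow> (\<forall>Q\<in>cubes D.
     cube_energy p b Q \<le>
     ennreal K * (\<Sum>\<^sub>D P. ennreal (\<mu> Q * osc b P powr p) *
        (ennreal ((\<mu> P / \<mu> Q) powr (1 / 2)) * indicator {Q. P \<subseteq> Q} Q)))"
proof -
  define s where "s = 1 / (2 * (p - 1))"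
  have s: "0 < s" "s * (1 - p) = - (1 / 2)" using p by (auto simp: s_def field_simps)
  obtain C where C: "C > 0" "\<forall>Q\<in>cubes D. \<forall>x\<in>Q.
     (\<Sum>\<^sub>D P. ennreal ((\<mu> P / \<mu> Q) powr s) * indicator {P. x \<in> P \<and> P \<subseteq> Q} P) \<le> ennreal C"
    using ex_nested_sum_bound[OF s(1)] by blast
  obtain K where K: "K > 0" "\<forall>b\<in>L1_loc M rho. osc_energy p b < \<infinity> \<longrightarrow> (\<forall>Q\<in>cubes D.
     AE x in M. x \<in> Q \<longrightarrow> ennreal (norm (b x - avg M Q b)) \<le> ennreal K * osc_sum b Q x)"
    using ex_AE_bound[OF p] by (elim exE conjE)
  let ?C = "2 powr p * C powr (p - 1) * K powr p"
  have Cp: "0 < ?C" using C(1) K(1) by simp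
  have main: "cube_energy p b Q \<le>
     ennreal ?C * (\<Sum>\<^sub>D P. ennreal (\<mu> Q * osc b P powr p) *
        (ennreal ((\<mu> P / \<mu> Q) powr (1 / 2)) * indicator {Q. P \<subseteq> Q} Q))"
    if b: "b \<in> L1_loc M rho" and fin: "osc_energy p b < \<infinity>" and Q: "Q \<in> cubes D" for b Q
  proof -
    let ?a = "\<lambda>P. osc b P" and ?r = "\<lambda>P. \<mu> P / \<mu> Q"
    let ?t = "\<lambda>P. ?a P powr p * ?r P powr - (1 / 2)"
    have rp: "0 < ?r P" if "P \<in> cubes D" for P using cubes_pos[OF that] cubes_pos[OF Q] by simp
    have pt: "ennreal (norm (b x - avg M Q b) powr p) \<le>
        ennreal ?C * (\<Sum>\<^sub>D P. ennreal (?t P) * indicator {P. P \<subseteq> Q} P * indicator P x)"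
      if x: "x \<in> Q" and le: "ennreal (norm (b x - avg M Q b)) \<le> ennreal K * osc_sum b Q x" for x
    proof -
      let ?J = "{P. x \<in> P \<and> P \<subseteq> Q}"
      let ?w = "\<lambda>P. ?r P powr s * indicator ?J P" and ?f = "\<lambda>P. K * ?a P * ?r P powr - s"
      have "(\<Sum>\<^sub>D P. ennreal (?w P)) =
          (\<Sum>\<^sub>D P. ennreal (?r P powr s) * indicator ?J P)"
        by (intro nn_integral_cong) (auto simp: indicator_def)
      then have w: "(\<Sum>\<^sub>D P. ennreal (?w P)) \<le> ennreal C"
        using C(2)[rule_format, OF Q x] by simp
      have "ennreal K * osc_sum b Q x = (\<Sum>\<^sub>D P. ennreal K * (ennreal (?a P) * indicator ?J P))"
        by (simp add: nn_integral_cmult)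
      also have "\<dots> = (\<Sum>\<^sub>D P. ennreal (?w P * ?f P))"
      proof (intro nn_integral_cong)
        fix P assume "P \<in> space (count_space (cubes D))"
        then have "?r P powr s * ?r P powr - s = 1" using rp[of P] cubes_pos[of P] cubes_pos[OF Q] unfolding powr_add[symmetric] by simp
        then have "?w P * ?f P = K * ?a P * indicator ?J P" by (simp add: ac_simps)
        moreover have "ennreal K * (ennreal (?a P) * indicator ?J P) = ennreal (K * ?a P * indicator ?J P)"
          using K(1) by (simp add: ennreal_mult indicator_def)
        ultimately show "ennreal K * (ennreal (?a P) * indicator ?J P) = ennreal (?w P * ?f P)"
          by (simp only:)
      qed
      finally have g: "ennreal (norm (b x - avg M Q b)) \<le> (\<Sum>\<^sub>D P. ennreal (?w P * ?f P))"
        using le by simp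
      have "ennreal (norm (b x - avg M Q b) powr p) \<le>
          ennreal (2 powr p * C powr (p - 1)) * (\<Sum>\<^sub>D P. ennreal (?w P * ?f P powr p))"
        using p C(1) K(1) by (intro power_mean_le[OF _ _ _ _ _ _ _ w g]) auto
      also have "(\<Sum>\<^sub>D P. ennreal (?w P * ?f P powr p)) =
          (\<Sum>\<^sub>D P. ennreal (K powr p) * (ennreal (?t P) * indicator {P. P \<subseteq> Q} P * indicator P x))"
      proof (intro nn_integral_cong)
        fix P assume "P \<in> space (count_space (cubes D))"
        have "?f P powr p = K powr p * ?a P powr p * ?r P powr (- s * p)"
          using K(1) by (simp add: powr_mult powr_powr)
        then have "?w P * ?f P powr p = K powr p * (?a P powr p * (?r P powr s * ?r P powr (- s * p))) * indicator ?J P"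
          by (simp add: ac_simps)
        also have "?r P powr s * ?r P powr (- s * p) = ?r P powr - (1 / 2)"
        proof -
          have "s + - s * p = - (1 / 2)" using s(2) by (simp add: algebra_simps)
          then show ?thesis by (simp only: powr_add[symmetric])
        qed
        finally show "ennreal (?w P * ?f P powr p) =
            ennreal (K powr p) * (ennreal (?t P) * indicator {P. P \<subseteq> Q} P * indicator P x)"
          by (simp add: ennreal_mult[symmetric] indicator_def)
      qed
      also have "\<dots> = ennreal (K powr p) * (\<Sum>\<^sub>D P. ennreal (?t P) * indicator {P. P \<subseteq> Q} P * indicator P x)"
        by (simp add: nn_integral_cmult)
      finally show ?thesis by (simp add: ennreal_mult mult.assoc)
    qed
    have "cube_energy p b Q \<le>
       (\<integral>\<^sup>+x. ennreal ?C * (\<Sum>\<^sub>D P. ennreal (?t P) * indicator {P. P \<subseteq> Q} P * indicator P x) \<partial>M)"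
    proof (rule nn_integral_mono_AE)
      show "AE x in M. ennreal (norm (b x - avg M Q b) powr p) * indicator Q x \<le>
        ennreal ?C * (\<Sum>\<^sub>D P. ennreal (?t P) * indicator {P. P \<subseteq> Q} P * indicator P x)"
        using K(2)[rule_format, OF b fin Q]
      proof eventually_elim
        case (elim x)
        then show ?case using pt[of x] by (cases "x \<in> Q") auto
      qed
    qed
    also have "\<dots> = ennreal ?C * (\<integral>\<^sup>+x. (\<Sum>\<^sub>D P. ennreal (?t P) * indicator {P. P \<subseteq> Q} P * indicator P x) \<partial>M)"
      by (intro nn_integral_cmult borel_measurable_nn_integral_count_space) (auto simp: cubes_sets)
    also have "(\<integral>\<^sup>+x. (\<Sum>\<^sub>D P. ennreal (?t P) * indicator {P. P \<subseteq> Q} P * indicator P x) \<partial>M) =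
        (\<Sum>\<^sub>D P. (\<integral>\<^sup>+x. ennreal (?t P) * indicator {P. P \<subseteq> Q} P * indicator P x \<partial>M))"
      by (intro nn_integral_count_space_nn_integral) (auto simp: cubes_sets)
    also have "\<dots> = (\<Sum>\<^sub>D P. ennreal (\<mu> Q * ?a P powr p) * (ennreal (?r P powr (1 / 2)) * indicator {Q. P \<subseteq> Q} Q))"
    proof (intro nn_integral_cong)
      fix P assume "P \<in> space (count_space (cubes D))"
      then have P: "P \<in> cubes D" by simp
      have em: "emeasure M P = ennreal (\<mu> P)" using cubes_finite[OF P] by (intro emeasure_eq_ennreal_measure) auto
      have "(\<integral>\<^sup>+x. ennreal (?t P) * indicator {P. P \<subseteq> Q} P * indicator P x \<partial>M) = ennreal (?t P) * indicator {P. P \<subseteq> Q} P * ennreal (\<mu> P)"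
        using cubes_sets[OF P] by (subst nn_integral_cmult_indicator) (simp_all add: em)
      also have "\<dots> = ennreal (?t P * \<mu> P) * indicator {Q. P \<subseteq> Q} Q" by (simp add: ennreal_mult indicator_def)
      also have "?t P * \<mu> P = \<mu> Q * ?a P powr p * (?r P powr 1 * ?r P powr - (1 / 2))"
        using cubes_pos[OF Q] rp[OF P] by (simp add: ac_simps)
      also have "?r P powr 1 * ?r P powr - (1 / 2) = ?r P powr (1 / 2)"
        unfolding powr_add[symmetric] by simp
      finally show "(\<integral>\<^sup>+x. ennreal (?t P) * indicator {P. P \<subseteq> Q} P * indicator P x \<partial>M) =
          ennreal (\<mu> Q * ?a P powr p) * (ennreal (?r P powr (1 / 2)) * indicator {Q. P \<subseteq> Q} Q)"
        by (simp add: ennreal_mult mult.assoc)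
    qed
    finally show ?thesis .
  qed
  show ?thesis
    by (intro exI[of _ ?C] conjI ballI impI) (rule Cp, (rule main; assumption))
qed

text \<open>After interchanging the sums, a fixed \<open>P\<close> meets the sum of \<open>(\<mu> P / \<mu> Q)\<^sup>1\<^sup>/\<^sup>2\<close> over the chain of all \<open>Q \<supseteq> P\<close>.\<close>

lemma ex_sum_cube_Lp_bound:
  assumes p: "1 < p"
  shows "\<exists>K>0. \<forall>b\<in>L1_loc M rho.
     (\<Sum>\<^sub>D Q. ennreal (1 / \<mu> Q) * cube_energy p b Q) \<le>
     ennreal K * osc_energy p b"
proof -
  obtain C where C: "C > 0" "\<forall>P\<in>cubes D.
     (\<Sum>\<^sub>D Q. ennreal ((\<mu> P / \<mu> Q) powr (1 / 2)) * indicator {Q. P \<subseteq> Q} Q) \<le> ennreal C"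
    using ex_nested_sum_bound[of "1 / 2"] half_gt_zero[OF zero_less_one] by blast
  obtain K where K: "K > 0" "\<forall>b\<in>L1_loc M rho. osc_energy p b < \<infinity> \<longrightarrow> (\<forall>Q\<in>cubes D.
     cube_energy p b Q \<le>
     ennreal K * (\<Sum>\<^sub>D P. ennreal (\<mu> Q * osc b P powr p) *
        (ennreal ((\<mu> P / \<mu> Q) powr (1 / 2)) * indicator {Q. P \<subseteq> Q} Q)))"
    using ex_cube_Lp_bound[OF p] by (elim exE conjE)
  have "(\<Sum>\<^sub>D Q. ennreal (1 / \<mu> Q) * cube_energy p b Q) \<le>
     ennreal (K * C) * osc_energy p b" if b: "b \<in> L1_loc M rho" for b
  proof (cases "osc_energy p b < \<infinity>")
    case False
    then have "osc_energy p b = \<infinity>" by (simp add: less_top[symmetric])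
    then show ?thesis using K(1) C(1) by (simp add: ennreal_mult_top)
  next
    case True
    let ?a = "\<lambda>P. osc b P"
    let ?k = "\<lambda>P Q. ennreal ((\<mu> P / \<mu> Q) powr (1 / 2)) * indicator {Q. P \<subseteq> Q} Q"
    have "(\<Sum>\<^sub>D Q. ennreal (1 / \<mu> Q) * cube_energy p b Q) \<le>
      (\<Sum>\<^sub>D Q. ennreal K * (\<Sum>\<^sub>D P. ennreal (?a P powr p) * ?k P Q))"
    proof (intro nn_integral_mono)
      fix Q assume "Q \<in> space (count_space (cubes D))"
      then have Q: "Q \<in> cubes D" by simp
      have eq: "(\<Sum>\<^sub>D P. ennreal (\<mu> Q * ?a P powr p) * ?k P Q) =
          ennreal (\<mu> Q) * (\<Sum>\<^sub>D P. ennreal (?a P powr p) * ?k P Q)"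
        by (simp add: nn_integral_cmult[symmetric] ennreal_mult mult.assoc)
      have "ennreal (1 / \<mu> Q) * cube_energy p b Q \<le>
        ennreal (1 / \<mu> Q) * (ennreal K * (ennreal (\<mu> Q) * (\<Sum>\<^sub>D P. ennreal (?a P powr p) * ?k P Q)))"
        unfolding eq[symmetric] by (intro mult_left_mono K(2)[rule_format] b True Q) simp
      also have "\<dots> = (ennreal (1 / \<mu> Q) * ennreal (\<mu> Q)) * (ennreal K * (\<Sum>\<^sub>D P. ennreal (?a P powr p) * ?k P Q))"
        by (simp only: ac_simps)
      also have "ennreal (1 / \<mu> Q) * ennreal (\<mu> Q) = 1" using cubes_pos[OF Q] by (simp add: ennreal_mult[symmetric])
      finally show "ennreal (1 / \<mu> Q) * cube_energy p b Q \<le>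
          ennreal K * (\<Sum>\<^sub>D P. ennreal (?a P powr p) * ?k P Q)" by simp
    qed
    also have "\<dots> = ennreal K * (\<Sum>\<^sub>D Q. (\<Sum>\<^sub>D P. ennreal (?a P powr p) * ?k P Q))"
      by (simp add: nn_integral_cmult)
    also have "(\<Sum>\<^sub>D Q. (\<Sum>\<^sub>D P. ennreal (?a P powr p) * ?k P Q)) =
        (\<Sum>\<^sub>D P. (\<Sum>\<^sub>D Q. ennreal (?a P powr p) * ?k P Q))"
      by (rule nn_integral_count_space_nn_integral) auto
    also have "\<dots> \<le> (\<Sum>\<^sub>D P. ennreal (?a P powr p) * ennreal C)"
    proof (intro nn_integral_mono)
      fix P assume "P \<in> space (count_space (cubes D))"
      then have P: "P \<in> cubes D" by simp
      have "(\<Sum>\<^sub>D Q. ennreal (?a P powr p) * ?k P Q) =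
          ennreal (?a P powr p) * (\<Sum>\<^sub>D Q. ?k P Q)" by (rule nn_integral_cmult) simp
      also have "\<dots> \<le> ennreal (?a P powr p) * ennreal C" by (intro mult_left_mono C(2)[rule_format] P) simp
      finally show "(\<Sum>\<^sub>D Q. ennreal (?a P powr p) * ?k P Q) \<le> ennreal (?a P powr p) * ennreal C" .
    qed
    also have "\<dots> = osc_energy p b * ennreal C" by (rule nn_integral_multc) simp
    finally show ?thesis using K(1) C(1) by (simp add: ennreal_mult ac_simps mult_right_mono)
  qed
  note main = this
  have KC: "0 < K * C" using K(1) C(1) by simp
  show ?thesis by (intro exI[of _ "K * C"] conjI ballI) (rule KC, (rule main; assumption))
qed

text \<open>The two cubes are those of level \<open>k\<close> around \<open>x\<close> and \<open>y\<close>, where \<open>\<delta>\<^sup>k\<^sup>+\<^sup>1 \<le> rho x y < \<delta>\<^sup>k\<close>: their distance and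
  their own size are then of the same order.\<close>

lemma ex_neighbour_cubes:
  "\<exists>K\<ge>1. \<forall>x\<in>X. \<forall>y\<in>X. x \<noteq> y \<longrightarrow> (\<exists>Q\<in>cubes D. \<exists>Q'\<in>cubes D. x \<in> Q \<and> y \<in> Q' \<and> y \<in> BQ Q \<and> x \<in> BQ Q' \<and>
     Q' \<subseteq> BQ Q \<and> \<mu> Q \<le> K * V x (rho x y) \<and> \<mu> Q' \<le> K * V x (rho x y) \<and> \<mu> (BQ Q) \<le> K * \<mu> Q')"
proof -
  let ?K1 = "doubling_factor (A0 * (C0 + 0) / \<delta>)" and ?K2 = "doubling_factor (A0 * (C0 + 1) / \<delta>)" and ?K3 = "doubling_factor (A0 * (C0 + 1) / c0)"
  let ?K = "max (max ?K1 ?K2) (ball_factor * ?K1 * ?K3)"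
  have main: "\<exists>Q\<in>cubes D. \<exists>Q'\<in>cubes D. x \<in> Q \<and> y \<in> Q' \<and> y \<in> BQ Q \<and> x \<in> BQ Q' \<and>
     Q' \<subseteq> BQ Q \<and> \<mu> Q \<le> ?K * V x (rho x y) \<and> \<mu> Q' \<le> ?K * V x (rho x y) \<and> \<mu> (BQ Q) \<le> ?K * \<mu> Q'"
    if x: "x \<in> X" and y: "y \<in> X" and xy: "x \<noteq> y" for x y
  proof -
    have "rho x y \<noteq> 0" using rho_eq_0[OF x y] xy by blast
    then have r: "0 < rho x y" using rho_nonneg[OF x y] by simp
    obtain k where k: "\<delta> powi (k + 1) \<le> rho x y" "rho x y < \<delta> powi k" using ex_scale[OF r] by blast
    let ?Q = "cube_at k x" and ?Q' = "cube_at k y"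
    have Q: "?Q \<in> D k" "x \<in> ?Q" "?Q' \<in> D k" "y \<in> ?Q'" using cube_at x y by auto
    have Qc: "?Q \<in> cubes D" "?Q' \<in> cubes D" using Q cubes_iff by blast+
    have yx: "rho y x < \<delta> powi k" using k rho_sym[OF x y] by simp
    have 1: "y \<in> BQ ?Q" using k A0C0_le_c by (intro mem_BQ[OF Q(1,2) y, of 1]) auto
    have 2: "x \<in> BQ ?Q'" using yx A0C0_le_c by (intro mem_BQ[OF Q(3,4) x, of 1]) auto
    have 3: "?Q' \<subseteq> BQ ?Q"
    proof
      fix w assume w: "w \<in> ?Q'"
      have "?Q' \<subseteq> ball x (A0 * (1 + 2 * A0 * C0) * \<delta> powi k)"
        using k by (intro cube_subset_ball[OF Q(3,4) x]) auto
      then have "w \<in> X" "rho x w < A0 * (1 + 2 * A0 * C0) * \<delta> powi k" using w by auto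
      then show "w \<in> BQ ?Q" using A0C0_le_c(1) A0_pos C0 by (intro mem_BQ[OF Q(1,2)]) auto
    qed
    have k': "\<delta> * \<delta> powi k \<le> rho x y" using k(1) scale_Suc by simp
    have "\<mu> ?Q \<le> ?K1 * V x (\<delta> * \<delta> powi k)" using x \<delta> by (intro cube_le_vol[OF Q(1,2)]) auto
    also have "\<dots> \<le> ?K1 * V x (rho x y)"
      using vol_mono[OF x k'] doubling_factor_ge_1[of "A0 * (C0 + 0) / \<delta>"] by (intro mult_left_mono) auto
    finally have 4: "\<mu> ?Q \<le> ?K1 * V x (rho x y)" .
    have "\<mu> ?Q' \<le> ?K2 * V x (\<delta> * \<delta> powi k)" using x yx \<delta> by (intro cube_le_vol[OF Q(3,4)]) auto
    also have "\<dots> \<le> ?K2 * V x (rho x y)"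
      using vol_mono[OF x k'] doubling_factor_ge_1[of "A0 * (C0 + 1) / \<delta>"] by (intro mult_left_mono) auto
    finally have 5: "\<mu> ?Q' \<le> ?K2 * V x (rho x y)" .
    have "V x (rho x y) \<le> ?K3 * \<mu> ?Q'" using x yx k by (intro vol_le_cube[OF Q(3,4)]) auto
    then have "?K1 * V x (rho x y) \<le> ?K1 * (?K3 * \<mu> ?Q')"
      using doubling_factor_ge_1[of "A0 * (C0 + 0) / \<delta>"] by (intro mult_left_mono) auto
    with 4 have "\<mu> ?Q \<le> ?K1 * (?K3 * \<mu> ?Q')" by linarith
    then have "ball_factor * \<mu> ?Q \<le> ball_factor * (?K1 * (?K3 * \<mu> ?Q'))" using ball_factor_ge_1 by (intro mult_left_mono) auto
    then have 6: "\<mu> (BQ ?Q) \<le> ball_factor * ?K1 * ?K3 * \<mu> ?Q'" using BQ_le[OF Qc(1)] by (simp add: mult.assoc)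
    have up: "a * t \<le> ?K * t" if "a \<le> ?K" "0 \<le> t" for a t using that by (rule mult_right_mono)
    have "\<mu> ?Q \<le> ?K * V x (rho x y)" by (rule order_trans[OF 4 up]) auto
    moreover have "\<mu> ?Q' \<le> ?K * V x (rho x y)" by (rule order_trans[OF 5 up]) auto
    moreover have "\<mu> (BQ ?Q) \<le> ?K * \<mu> ?Q'" by (rule order_trans[OF 6 up]) auto
    ultimately show ?thesis using Q Qc 1 2 3 by blast
  qed
  have K1: "1 \<le> ?K" using doubling_factor_ge_1[of "A0 * (C0 + 0) / \<delta>"] by simp
  show ?thesis by (intro exI[of _ ?K] conjI ballI impI) (rule K1, (rule main; assumption))
qed

text \<open>With the cubes of \<open>ex_neighbour_cubes\<close>, \<open>\<bar>b x - b y\<bar>\<close> is at most \<open>\<bar>b x - b\<^sub>Q\<bar> + \<bar>b y - b\<^sub>Q\<^sub>'\<bar> + \<bar>b\<^sub>Q - b\<^sub>Q\<^sub>'\<bar>\<close>, the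
  last term being controlled by the oscillation of \<open>Q\<close>. The terms with \<open>Q\<close> are collected in a measurable
  kernel \<open>H x y\<close>, those with \<open>Q'\<close> in \<open>H y x\<close>; both have the same integral, a sum over the cubes.\<close>

lemma besov_energy_le_osc_energy:
  assumes p: "1 < p"
  shows "\<exists>K>0. \<forall>b\<in>L1_loc M rho. besov_energy p b \<le> ennreal K * osc_energy p b"
proof -
  interpret sigma_finite_measure M by (rule sigma_finite)
  interpret P: pair_sigma_finite M M ..
  obtain K where K: "K \<ge> 1" "\<forall>x\<in>X. \<forall>y\<in>X. x \<noteq> y \<longrightarrow> (\<exists>Q\<in>cubes D. \<exists>Q'\<in>cubes D. x \<in> Q \<and> y \<in> Q' \<and> y \<in> BQ Q \<and> x \<in> BQ Q' \<and>
     Q' \<subseteq> BQ Q \<and> \<mu> Q \<le> K * V x (rho x y) \<and> \<mu> Q' \<le> K * V x (rho x y) \<and> \<mu> (BQ Q) \<le> K * \<mu> Q')"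
    using ex_neighbour_cubes by (elim exE conjE)
  obtain L where L: "L > 0" "\<forall>b\<in>L1_loc M rho.
     (\<Sum>\<^sub>D Q. ennreal (1 / \<mu> Q) * cube_energy p b Q) \<le>
     ennreal L * osc_energy p b"
    using ex_sum_cube_Lp_bound[OF p] by (elim exE conjE)
  define K2 where "K2 = ball_factor + K"
  have K2: "0 < K2" using ball_factor_ge_1 K(1) by (simp add: K2_def)
  let ?C = "3 powr p * K\<^sup>2"
  have C: "0 < ?C" using K(1) by simp
  have main: "besov_energy p b \<le> ennreal (2 * ?C * ball_factor * (L + K2 powr p)) * osc_energy p b" if b: "b \<in> L1_loc M rho" for b
  proof -
    note bm [measurable] = L1_loc_measurable[OF b]
    let ?a = "\<lambda>Q. osc b Q"
    define \<phi> where "\<phi> Q x = norm (b x - avg M Q b) powr p + (K2 * ?a Q) powr p" for Q x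
    have \<phi>0: "0 \<le> \<phi> Q x" for Q x by (simp add: \<phi>_def)
    let ?h = "\<lambda>Q x y. ennreal (indicator Q x * indicator (BQ Q) y / (\<mu> Q)\<^sup>2 * \<phi> Q x)"
    define H where "H x y = (\<Sum>\<^sub>D Q. ?h Q x y)" for x y
    have h_le_H: "?h Q x y \<le> H x y" if Q: "Q \<in> cubes D" for Q x y
    proof -
      have "?h Q x y = (\<Sum>\<^sub>D P. ?h P x y * indicator {Q} P)"
        using Q by (subst nn_integral_indicator_singleton) auto
      also have "\<dots> \<le> H x y" unfolding H_def by (intro nn_integral_mono) (auto simp: indicator_def)
      finally show ?thesis .
    qed
    have hm: "(\<lambda>(x, y). ?h Q x y) \<in> borel_measurable (M \<Otimes>\<^sub>M M)" if "Q \<in> cubes D" for Q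
      using BQ_sets[OF that] cubes_sets[OF that] unfolding \<phi>_def by measurable
    have "(\<lambda>u. \<Sum>\<^sub>D Q. (case u of (x, y) \<Rightarrow> ?h Q x y)) \<in> borel_measurable (M \<Otimes>\<^sub>M M)"
      using hm by (intro borel_measurable_nn_integral_count_space) auto
    then have Hm [measurable]: "(\<lambda>(x, y). H x y) \<in> borel_measurable (M \<Otimes>\<^sub>M M)"
      by (simp add: H_def case_prod_unfold)
    have Hm': "(\<lambda>(x, y). H y x) \<in> borel_measurable (M \<Otimes>\<^sub>M M)"
      using Hm by (subst measurable_pair_swap_iff) simp
    have pt: "ennreal (norm (b x - b y) powr p / (V x (rho x y))\<^sup>2) \<le> ennreal ?C * (H x y + H y x)"
      if x: "x \<in> X" and y: "y \<in> X" for x y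
    proof (cases "x = y")
      case False
      have "rho x y \<noteq> 0" using rho_eq_0[OF x y] False by blast
      then have Vp: "0 < V x (rho x y)" using rho_nonneg[OF x y] by (intro vol_pos x) simp
      obtain Q Q' where Q: "Q \<in> cubes D" "Q' \<in> cubes D" "x \<in> Q" "y \<in> Q'" "y \<in> BQ Q" "x \<in> BQ Q'" "Q' \<subseteq> BQ Q"
        "\<mu> Q \<le> K * V x (rho x y)" "\<mu> Q' \<le> K * V x (rho x y)" "\<mu> (BQ Q) \<le> K * \<mu> Q'"
        using K(2)[rule_format, OF x y False] by (elim bexE conjE)
      have vq: "1 / (V x (rho x y))\<^sup>2 \<le> K\<^sup>2 * (1 / m\<^sup>2)" if "m \<le> K * V x (rho x y)" "0 < m" for m
      proof -
        have "m\<^sup>2 \<le> (K * V x (rho x y))\<^sup>2" using that by (intro power_mono) auto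
        then show ?thesis using that Vp by (simp add: field_simps power_mult_distrib)
      qed
      let ?u = "norm (b x - avg M Q b)" and ?v = "norm (b y - avg M Q' b)" and ?w = "norm (avg M Q b - avg M Q' b)"
      have "norm (avg M (BQ Q) b - avg M Q' b) \<le> K * ?a Q"
        using Q by (intro norm_avg_subset_diff_le cubes_sets BQ_sets BQ_finite cubes_pos BQ_integrable b) auto
      moreover have "?w \<le> norm (avg M (BQ Q) b - avg M Q b) + norm (avg M (BQ Q) b - avg M Q' b)"
        using norm_triangle_ineq4[of "avg M (BQ Q) b - avg M Q' b" "avg M (BQ Q) b - avg M Q b"] by simp
      ultimately have w: "?w \<le> K2 * ?a Q" using avg_cube_BQ(1)[OF b Q(1)] by (simp add: K2_def distrib_right)
      have "norm (b x - b y) \<le> ?u + ?v + ?w"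
      proof -
        have "b x - b y = (b x - avg M Q b) + (avg M Q b - avg M Q' b) - (b y - avg M Q' b)" by simp
        then have "norm (b x - b y) \<le> norm ((b x - avg M Q b) + (avg M Q b - avg M Q' b)) + ?v"
          by (metis norm_triangle_ineq4)
        then show ?thesis using norm_triangle_ineq[of "b x - avg M Q b" "avg M Q b - avg M Q' b"] by linarith
      qed
      then have "norm (b x - b y) powr p \<le> (?u + ?v + ?w) powr p" using p by (intro powr_mono2) auto
      also have "\<dots> \<le> 3 powr p * (?u powr p + ?v powr p + ?w powr p)" using p by (intro powr_add3_le) auto
      also have "\<dots> \<le> 3 powr p * (\<phi> Q x + \<phi> Q' y)"
        using w p powr_mono2[of p ?w "K2 * ?a Q"] by (intro mult_left_mono) (auto simp: \<phi>_def intro: add_increasing2)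
      finally have "norm (b x - b y) powr p / (V x (rho x y))\<^sup>2 \<le> 3 powr p * (\<phi> Q x + \<phi> Q' y) * (1 / (V x (rho x y))\<^sup>2)"
        using Vp by (simp add: divide_right_mono)
      also have "\<dots> = 3 powr p * (\<phi> Q x * (1 / (V x (rho x y))\<^sup>2) + \<phi> Q' y * (1 / (V x (rho x y))\<^sup>2))"
        by (simp add: algebra_simps add_divide_distrib)
      also have "\<dots> \<le> 3 powr p * (\<phi> Q x * (K\<^sup>2 * (1 / (\<mu> Q)\<^sup>2)) + \<phi> Q' y * (K\<^sup>2 * (1 / (\<mu> Q')\<^sup>2)))"
        using Q cubes_pos \<phi>0 by (intro mult_left_mono add_mono vq) auto
      also have "\<dots> = ?C * (\<phi> Q x / (\<mu> Q)\<^sup>2 + \<phi> Q' y / (\<mu> Q')\<^sup>2)" by (simp add: algebra_simps)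
      finally have "ennreal (norm (b x - b y) powr p / (V x (rho x y))\<^sup>2) \<le> ennreal (?C * (\<phi> Q x / (\<mu> Q)\<^sup>2 + \<phi> Q' y / (\<mu> Q')\<^sup>2))"
        by (rule ennreal_leI)
      also have "\<dots> = ennreal ?C * (?h Q x y + ?h Q' y x)"
        using Q C \<phi>0 by (simp add: ennreal_mult ennreal_plus[symmetric] del: ennreal_plus)
      also have "\<dots> \<le> ennreal ?C * (H x y + H y x)" by (intro mult_left_mono add_mono h_le_H Q) simp
      finally show ?thesis .
    qed simp
    have "besov_energy p b \<le> (\<integral>\<^sup>+(x, y). ennreal ?C * (H x y + H y x) \<partial>(M \<Otimes>\<^sub>M M))"
      using pt by (intro nn_integral_mono) (auto simp: space_pair_measure)
    also have "\<dots> = (\<integral>\<^sup>+u. ennreal ?C * ((case u of (x, y) \<Rightarrow> H x y) + (case u of (x, y) \<Rightarrow> H y x)) \<partial>(M \<Otimes>\<^sub>M M))"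
      by (intro nn_integral_cong) auto
    also have "\<dots> = ennreal ?C * (\<integral>\<^sup>+u. (case u of (x, y) \<Rightarrow> H x y) + (case u of (x, y) \<Rightarrow> H y x) \<partial>(M \<Otimes>\<^sub>M M))"
      using Hm Hm' by (intro nn_integral_cmult borel_measurable_add)
    also have "\<dots> = ennreal ?C * ((\<integral>\<^sup>+(x, y). H x y \<partial>(M \<Otimes>\<^sub>M M)) + (\<integral>\<^sup>+(x, y). H y x \<partial>(M \<Otimes>\<^sub>M M)))"
      using Hm Hm' by (subst nn_integral_add) auto
    also have "(\<integral>\<^sup>+(x, y). H y x \<partial>(M \<Otimes>\<^sub>M M)) = (\<integral>\<^sup>+x. \<integral>\<^sup>+y. H y x \<partial>M \<partial>M)"
      using nn_integral_fst[OF Hm'] by simp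
    also have "\<dots> = (\<integral>\<^sup>+x. \<integral>\<^sup>+y. H x y \<partial>M \<partial>M)" by (rule P.Fubini'[OF Hm])
    also have "\<dots> = (\<integral>\<^sup>+(x, y). H x y \<partial>(M \<Otimes>\<^sub>M M))" using nn_integral_fst[OF Hm] by simp
    finally have 1: "besov_energy p b \<le> ennreal ?C * ((\<integral>\<^sup>+(x, y). H x y \<partial>(M \<Otimes>\<^sub>M M)) + (\<integral>\<^sup>+(x, y). H x y \<partial>(M \<Otimes>\<^sub>M M)))" .
    have "(\<integral>\<^sup>+(x, y). H x y \<partial>(M \<Otimes>\<^sub>M M)) = (\<integral>\<^sup>+u. (\<Sum>\<^sub>D Q. (case u of (x, y) \<Rightarrow> ?h Q x y)) \<partial>(M \<Otimes>\<^sub>M M))"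
      by (simp add: H_def case_prod_unfold)
    also have "\<dots> = (\<Sum>\<^sub>D Q. (\<integral>\<^sup>+(x, y). ?h Q x y \<partial>(M \<Otimes>\<^sub>M M)))"
      using hm by (intro nn_integral_count_space_nn_integral) auto
    also have "\<dots> \<le> (\<Sum>\<^sub>D Q. ennreal ball_factor * (ennreal (1 / \<mu> Q) * cube_energy p b Q
        + ennreal (K2 powr p) * ennreal (?a Q powr p)))"
    proof (intro nn_integral_mono)
      fix Q assume "Q \<in> space (count_space (cubes D))"
      then have Q: "Q \<in> cubes D" by simp
      note [measurable] = cubes_sets[OF Q] BQ_sets[OF Q]
      have emB: "emeasure M (BQ Q) = ennreal (\<mu> (BQ Q))" and emQ: "emeasure M Q = ennreal (\<mu> Q)"
        using BQ_finite[OF Q] cubes_finite[OF Q] by (auto intro!: emeasure_eq_ennreal_measure)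
      note Qp = cubes_pos[OF Q]
      have "(\<integral>\<^sup>+(x, y). ?h Q x y \<partial>(M \<Otimes>\<^sub>M M)) = (\<integral>\<^sup>+x. (\<integral>\<^sup>+y. ?h Q x y \<partial>M) \<partial>M)"
        using nn_integral_fst[OF hm[OF Q]] by simp
      also have "\<dots> = (\<integral>\<^sup>+x. ennreal (\<mu> (BQ Q) / (\<mu> Q)\<^sup>2) * (ennreal (\<phi> Q x) * indicator Q x) \<partial>M)"
      proof (intro nn_integral_cong)
        fix x
        have "(\<integral>\<^sup>+y. ?h Q x y \<partial>M) = (\<integral>\<^sup>+y. ennreal (indicator Q x / (\<mu> Q)\<^sup>2 * \<phi> Q x) * indicator (BQ Q) y \<partial>M)"
          using \<phi>0 by (intro nn_integral_cong) (auto simp: indicator_def)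
        also have "\<dots> = ennreal (indicator Q x / (\<mu> Q)\<^sup>2 * \<phi> Q x) * ennreal (\<mu> (BQ Q))"
          by (subst nn_integral_cmult_indicator) (auto simp: emB)
        also have "\<dots> = ennreal (\<mu> (BQ Q) / (\<mu> Q)\<^sup>2) * (ennreal (\<phi> Q x) * indicator Q x)"
          using \<phi>0[of Q x] by (cases "x \<in> Q") (simp_all add: ennreal_mult[symmetric] mult.commute)
        finally show "(\<integral>\<^sup>+y. ?h Q x y \<partial>M) = ennreal (\<mu> (BQ Q) / (\<mu> Q)\<^sup>2) * (ennreal (\<phi> Q x) * indicator Q x)" .
      qed
      also have "\<dots> = ennreal (\<mu> (BQ Q) / (\<mu> Q)\<^sup>2) * (\<integral>\<^sup>+x. ennreal (\<phi> Q x) * indicator Q x \<partial>M)"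
        unfolding \<phi>_def by (intro nn_integral_cmult) measurable
      also have "\<mu> (BQ Q) / (\<mu> Q)\<^sup>2 \<le> ball_factor * (1 / \<mu> Q)"
        using BQ_le[OF Q] Qp by (simp add: field_simps power2_eq_square)
      then have "ennreal (\<mu> (BQ Q) / (\<mu> Q)\<^sup>2) * (\<integral>\<^sup>+x. ennreal (\<phi> Q x) * indicator Q x \<partial>M) \<le>
          ennreal (ball_factor * (1 / \<mu> Q)) * (\<integral>\<^sup>+x. ennreal (\<phi> Q x) * indicator Q x \<partial>M)"
        by (intro mult_right_mono ennreal_leI) auto
      also have "(\<integral>\<^sup>+x. ennreal (\<phi> Q x) * indicator Q x \<partial>M) =
          (\<integral>\<^sup>+x. ennreal (norm (b x - avg M Q b) powr p) * indicator Q x + ennreal ((K2 * ?a Q) powr p) * indicator Q x \<partial>M)"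
        by (intro nn_integral_cong) (simp add: \<phi>_def distrib_right)
      also have "\<dots> = cube_energy p b Q + ennreal ((K2 * ?a Q) powr p) * ennreal (\<mu> Q)"
        by (subst nn_integral_add) (auto simp: nn_integral_cmult_indicator emQ)
      also have "ennreal (ball_factor * (1 / \<mu> Q)) * \<dots> = ennreal ball_factor * (ennreal (1 / \<mu> Q) * cube_energy p b Q
          + (ennreal (1 / \<mu> Q) * ennreal (\<mu> Q)) * ennreal ((K2 * ?a Q) powr p))"
      proof -
        have "ennreal (ball_factor * (1 / \<mu> Q)) = ennreal ball_factor * ennreal (1 / \<mu> Q)"
          using ball_factor_ge_1 Qp by (intro ennreal_mult) auto
        then show ?thesis by (simp only: distrib_left ac_simps)
      qed
      also have "ennreal (1 / \<mu> Q) * ennreal (\<mu> Q) = 1" using Qp by (simp add: ennreal_mult[symmetric])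
      also have "ennreal ((K2 * ?a Q) powr p) = ennreal (K2 powr p) * ennreal (?a Q powr p)"
        using K2 by (simp add: powr_mult ennreal_mult)
      finally show "(\<integral>\<^sup>+(x, y). ?h Q x y \<partial>(M \<Otimes>\<^sub>M M)) \<le> ennreal ball_factor * (ennreal (1 / \<mu> Q) * cube_energy p b Q
        + ennreal (K2 powr p) * ennreal (?a Q powr p))" by simp
    qed
    also have "\<dots> = ennreal ball_factor * ((\<Sum>\<^sub>D Q. ennreal (1 / \<mu> Q) * cube_energy p b Q)
        + ennreal (K2 powr p) * osc_energy p b)"
      by (simp add: nn_integral_cmult nn_integral_add)
    also have "\<dots> \<le> ennreal ball_factor * (ennreal L * osc_energy p b + ennreal (K2 powr p) * osc_energy p b)"
      by (intro mult_left_mono add_right_mono L(2)[rule_format] b) simp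
    also have "\<dots> = ennreal (ball_factor * (L + K2 powr p)) * osc_energy p b"
      using ball_factor_ge_1 L(1) by (simp add: ennreal_mult distrib_right[symmetric] mult.assoc)
    finally have 2: "(\<integral>\<^sup>+(x, y). H x y \<partial>(M \<Otimes>\<^sub>M M)) \<le> ennreal (ball_factor * (L + K2 powr p)) * osc_energy p b" .
    have "besov_energy p b \<le> ennreal ?C * (2 * (ennreal (ball_factor * (L + K2 powr p)) * osc_energy p b))"
      by (rule order_trans[OF 1]) (intro mult_left_mono; simp add: mult_2 add_mono 2)
    also have "\<dots> = (ennreal 2 * ennreal ?C * ennreal (ball_factor * (L + K2 powr p))) * osc_energy p b"
      by (simp add: ac_simps)
    also have "ennreal 2 * ennreal ?C * ennreal (ball_factor * (L + K2 powr p)) = ennreal (2 * ?C * ball_factor * (L + K2 powr p))"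
    proof -
      have "0 \<le> 2 * ?C" "0 \<le> ball_factor * (L + K2 powr p)" using C ball_factor_ge_1 L(1) by auto
      then have "ennreal 2 * ennreal ?C * ennreal (ball_factor * (L + K2 powr p)) = ennreal (2 * ?C * (ball_factor * (L + K2 powr p)))"
        by (simp only: ennreal_mult ennreal_mult[of 2 ?C, OF zero_le_numeral less_imp_le[OF C]])
      then show ?thesis by (simp only: mult.assoc)
    qed
    finally show ?thesis .
  qed
  have pos: "0 < 2 * ?C * ball_factor * (L + K2 powr p)"
    using C ball_factor_ge_1 L(1) by (intro mult_pos_pos add_pos_nonneg) auto
  show ?thesis by (intro exI[of _ "2 * ?C * ball_factor * (L + K2 powr p)"] conjI ballI) (rule pos, (rule main; assumption))
qed

section \<open>Comparison of the norms\<close>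

lemma osc_besov_comparable:
  assumes p: "1 < p"
  shows "comparable_on (L1_loc M rho) (osc_norm M rho \<delta> D z c p (ennreal p)) (besov_norm M rho p)"
proof -
  obtain K1 where K1: "K1 > 0" "\<forall>b\<in>L1_loc M rho. osc_energy p b \<le> ennreal K1 * besov_energy p b"
    using osc_energy_le_besov_energy[OF p] by (elim exE conjE)
  obtain K2 where K2: "K2 > 0" "\<forall>b\<in>L1_loc M rho. besov_energy p b \<le> ennreal K2 * osc_energy p b"
    using besov_energy_le_osc_energy[OF p] by (elim exE conjE)
  have osc: "osc_norm M rho \<delta> D z c p (ennreal p) b = epowr (osc_energy p b) (1 / p)" for b
    unfolding osc_norm_def using p by (subst lorentz_norm_diagonal) auto
  have bes: "besov_norm M rho p b = epowr (besov_energy p b) (1 / p)" for b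
    by (simp add: besov_norm_def)
  have root: "epowr x (1 / p) \<le> ennreal (K powr (1 / p)) * epowr y (1 / p)" if "0 < K" "x \<le> ennreal K * y" for K x y
    using epowr_mono[OF _ that(2), of "1 / p"] epowr_mult[OF that(1), of "1 / p" y] p by simp
  show ?thesis
  proof (rule comparable_onI)
    show "0 < K1 powr (1 / p)" "0 < K2 powr (1 / p)" using K1(1) K2(1) by auto
    fix b assume b: "b \<in> L1_loc M rho"
    show "osc_norm M rho \<delta> D z c p (ennreal p) b \<le> ennreal (K1 powr (1 / p)) * besov_norm M rho p b"
      unfolding osc bes by (rule root[OF K1(1) K1(2)[rule_format, OF b]])
    show "besov_norm M rho p b \<le> ennreal (K2 powr (1 / p)) * osc_norm M rho \<delta> D z c p (ennreal p) b"
      unfolding osc bes by (rule root[OF K2(1) K2(2)[rule_format, OF b]])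
  qed
qed

end

section \<open>Weak-type comparison in Ahlfors regular spaces\<close>

text \<open>Over the box, the density \<open>t\<^sup>-\<^sup>d\<^sup>-\<^sup>1\<close> lies between its values at the two ends.\<close>

lemma (in sigma_finite_measure) nu_box:
  assumes Q: "Q \<in> sets M" and fin: "emeasure M Q < \<infinity>" and s: "0 < s" "s \<le> t" and d: "0 < d"
  shows "Q \<times> {s..<t} \<in> sets (nu M d)"
    and "ennreal (measure M Q * ((t - s) / t powr (d + 1))) \<le> emeasure (nu M d) (Q \<times> {s..<t})"
    and "emeasure (nu M d) (Q \<times> {s..<t}) \<le> ennreal (measure M Q * ((t - s) / s powr (d + 1)))"
proof -
  let ?R = "restrict_space lborel {0<..} :: real measure"
  let ?W = "Q \<times> {s..<t}"
  let ?f = "\<lambda>(x, t). ennreal (1 / t powr (d + 1)) :: ennreal"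
  interpret R: sigma_finite_measure ?R
    by (rule sigma_finite_measure_restrict_space) (auto intro: lborel.sigma_finite_measure_axioms)
  have I: "{s..<t} \<in> sets ?R" using s by (subst sets_restrict_space_iff) auto
  have eI: "emeasure ?R {s..<t} = ennreal (t - s)" using s by (subst emeasure_restrict_space) auto
  have eQ: "emeasure M Q = ennreal (measure M Q)" using fin by (intro emeasure_eq_ennreal_measure) auto
  have W: "?W \<in> sets (M \<Otimes>\<^sub>M ?R)" using Q I by (rule pair_measureI)
  then show "?W \<in> sets (nu M d)" by (simp add: nu_def)
  have eW: "emeasure (M \<Otimes>\<^sub>M ?R) ?W = ennreal (measure M Q * (t - s))"
    using Q I s by (simp add: R.emeasure_pair_measure_Times eI eQ ennreal_mult)
  have "(\<lambda>t::real. ennreal (1 / t powr (d + 1))) \<in> borel_measurable ?R"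
    by (rule measurable_restrict_space1) measurable
  then have fm: "?f \<in> borel_measurable (M \<Otimes>\<^sub>M ?R)" by measurable
  have nu: "emeasure (nu M d) ?W = (\<integral>\<^sup>+u. ?f u * indicator ?W u \<partial>(M \<Otimes>\<^sub>M ?R))"
    unfolding nu_def using fm W by (rule emeasure_density)
  have cW: "(\<integral>\<^sup>+u. ennreal (1 / r powr (d + 1)) * indicator ?W u \<partial>(M \<Otimes>\<^sub>M ?R)) = ennreal (measure M Q * ((t - s) / r powr (d + 1)))" for r
    using W s by (simp add: nn_integral_cmult_indicator eW ennreal_mult[symmetric] ac_simps)
  show "ennreal (measure M Q * ((t - s) / t powr (d + 1))) \<le> emeasure (nu M d) ?W"
    unfolding nu cW[of t, symmetric]
  proof (intro nn_integral_mono)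
    fix u
    have "1 / t powr (d + 1) \<le> 1 / snd u powr (d + 1)" if "u \<in> ?W"
      using that s d by (intro divide_left_mono powr_mono2) (auto intro: mult_pos_pos)
    then show "ennreal (1 / t powr (d + 1)) * indicator ?W u \<le> ?f u * indicator ?W u"
      by (auto simp: case_prod_unfold indicator_def intro!: ennreal_leI)
  qed
  show "emeasure (nu M d) ?W \<le> ennreal (measure M Q * ((t - s) / s powr (d + 1)))"
    unfolding nu cW[of s, symmetric]
  proof (intro nn_integral_mono)
    fix u
    have "1 / snd u powr (d + 1) \<le> 1 / s powr (d + 1)" if "u \<in> ?W"
      using that s d by (intro divide_left_mono powr_mono2) (auto intro: mult_pos_pos)
    then show "?f u * indicator ?W u \<le> ennreal (1 / s powr (d + 1)) * indicator ?W u"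
      by (auto simp: case_prod_unfold indicator_def intro!: ennreal_leI)
  qed
qed

locale ahlfors_dyadic_space = dyadic_space +
  fixes d CA :: real
  assumes d: "0 < d" and CA: "1 \<le> CA"
    and regular: "\<And>x r. x \<in> space M \<Longrightarrow> 0 < r \<Longrightarrow> (1 / CA) * r powr d \<le> vol M rho x r \<and> vol M rho x r \<le> CA * r powr d"
    and levels_disjoint: "\<And>k l. k \<noteq> l \<Longrightarrow> D k \<inter> D l = {}"
begin

text \<open>The volumes of balls are unbounded, but a cube lies in a ball.\<close>

lemma cube_neq_X:
  assumes Q: "Q \<in> D k"
  shows "Q \<noteq> X"
proof
  assume QX: "Q = X"
  let ?z = "z k Q" and ?R = "C0 * \<delta> powi k"
  define v where "v = V ?z ?R + 1"
  have v: "1 \<le> v" by (simp add: v_def)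
  define r where "r = (CA * v) powr (1 / d)"
  have r: "0 < r" using CA v by (simp add: r_def)
  have "(1 / CA) * r powr d = v" using CA v d by (simp add: r_def powr_powr)
  then have "v \<le> V ?z r" using regular[OF centre[OF Q] r] by simp
  moreover have "V ?z r \<le> V ?z ?R"
    unfolding vol_def[of M rho ?z r] using outer_ball[OF Q] QX centre[OF Q] by (intro measure_le_vol) auto
  ultimately show False by (simp add: v_def)
qed

lemma cube_level_eq: "Q \<in> D k \<Longrightarrow> cube_level D Q = k"
  using cube_level(1)[of Q] cube_neq_X[of Q k] levels_disjoint[of "cube_level D Q" k] by (auto simp: cubes_iff)

lemma cube_mass:
  assumes Q: "Q \<in> D k"
  shows "(c0 * \<delta> powi k) powr d / CA \<le> \<mu> Q" and "\<mu> Q \<le> CA * (C0 * \<delta> powi k) powr d"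
proof -
  have "V (z k Q) (c0 * \<delta> powi k) \<le> \<mu> Q"
    unfolding vol_def using inner_ball[OF Q] cube_sets[OF Q] cube_emeasure_finite[OF Q] centre[OF Q]
    by (intro measure_mono_fmeasurable) (auto simp: fmeasurable_def)
  then show "(c0 * \<delta> powi k) powr d / CA \<le> \<mu> Q"
    using regular[OF centre[OF Q], of "c0 * \<delta> powi k"] c0 by simp
  have "\<mu> Q \<le> V (z k Q) (C0 * \<delta> powi k)"
    using outer_ball[OF Q] cube_sets[OF Q] centre[OF Q] by (intro measure_le_vol)
  then show "\<mu> Q \<le> CA * (C0 * \<delta> powi k) powr d"
    using regular[OF centre[OF Q], of "C0 * \<delta> powi k"] C0 by simp
qed

text \<open>A Whitney box: its height above \<open>X\<close> is comparable with the size of \<open>Q\<close>. The factor \<open>\<tau>\<close> is free because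
  the two comparisons need boxes at different heights.\<close>

definition whitney :: "real \<Rightarrow> 'a set \<Rightarrow> ('a \<times> real) set" where
  "whitney \<tau> Q = Q \<times> {\<tau> * \<delta> powi (cube_level D Q + 1)..<\<tau> * \<delta> powi cube_level D Q}"

text \<open>For \<open>Q\<close> of level \<open>k\<close>, the mass of \<open>Q\<close> is comparable with \<open>\<delta>\<^sup>k\<^sup>d\<close>, and the integral of \<open>t\<^sup>-\<^sup>d\<^sup>-\<^sup>1\<close> over the
  heights with \<open>\<delta>\<^sup>-\<^sup>k\<^sup>d\<close>.\<close>

lemma whitney_mass:
  assumes \<tau>: "0 < \<tau>" and Q: "Q \<in> cubes D"
  shows "whitney \<tau> Q \<in> sets (nu M d)"
    and "ennreal (c0 powr d / CA * (1 - \<delta>) / \<tau> powr d) \<le> emeasure (nu M d) (whitney \<tau> Q)"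
    and "emeasure (nu M d) (whitney \<tau> Q) \<le> ennreal (CA * C0 powr d * (1 - \<delta>) / (\<delta> powr (d + 1) * \<tau> powr d))"
proof -
  interpret sigma_finite_measure M by (rule sigma_finite)
  obtain k where k: "Q \<in> D k" using Q cubes_iff by blast
  let ?e = "\<delta> powi k"
  have T: "whitney \<tau> Q = Q \<times> {\<tau> * (\<delta> * ?e)..<\<tau> * ?e}" by (simp add: whitney_def cube_level_eq[OF k] scale_Suc)
  have st: "0 < \<tau> * (\<delta> * ?e)" "\<tau> * (\<delta> * ?e) \<le> \<tau> * ?e" using \<tau> \<delta> by auto
  note nt = nu_box[OF cube_sets[OF k] cube_emeasure_finite[OF k] st d]
  show "whitney \<tau> Q \<in> sets (nu M d)" unfolding T by (rule nt(1))
  have e1: "(\<tau> * ?e) powr (d + 1) = \<tau> powr d * ?e powr d * (\<tau> * ?e)"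
    using \<tau> by (simp add: powr_add powr_mult)
  have e2: "(\<tau> * (\<delta> * ?e)) powr (d + 1) = \<delta> powr (d + 1) * \<tau> powr d * ?e powr d * (\<tau> * ?e)"
    using \<tau> \<delta> by (simp add: powr_add powr_mult)
  have alg: "a * E * ((u - \<delta> * u) / (t * E * u)) = a * (1 - \<delta>) / t" if "0 < E" "0 < u" "0 < t" for a E u t :: real
    using that by (simp add: field_simps)
  have diff: "\<tau> * ?e - \<tau> * (\<delta> * ?e) = \<tau> * ?e - \<delta> * (\<tau> * ?e)" by simp
  have "c0 powr d / CA * (1 - \<delta>) / \<tau> powr d = (c0 * ?e) powr d / CA * ((\<tau> * ?e - \<tau> * (\<delta> * ?e)) / (\<tau> * ?e) powr (d + 1))"
    unfolding e1 diff using alg[of "?e powr d" "\<tau> * ?e" "\<tau> powr d" "c0 powr d / CA"] c0 \<tau> \<delta>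
    by (simp add: powr_mult)
  also have "\<dots> \<le> \<mu> Q * ((\<tau> * ?e - \<tau> * (\<delta> * ?e)) / (\<tau> * ?e) powr (d + 1))"
    using st by (intro mult_right_mono cube_mass(1)[OF k]) auto
  finally show "ennreal (c0 powr d / CA * (1 - \<delta>) / \<tau> powr d) \<le> emeasure (nu M d) (whitney \<tau> Q)"
    unfolding T by (intro order_trans[OF _ nt(2)] ennreal_leI)
  have "\<mu> Q * ((\<tau> * ?e - \<tau> * (\<delta> * ?e)) / (\<tau> * (\<delta> * ?e)) powr (d + 1)) \<le>
      CA * (C0 * ?e) powr d * ((\<tau> * ?e - \<tau> * (\<delta> * ?e)) / (\<tau> * (\<delta> * ?e)) powr (d + 1))"
    using st by (intro mult_right_mono cube_mass(2)[OF k]) auto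
  also have "\<dots> = CA * C0 powr d * (1 - \<delta>) / (\<delta> powr (d + 1) * \<tau> powr d)"
    unfolding e2 diff using alg[of "?e powr d" "\<tau> * ?e" "\<delta> powr (d + 1) * \<tau> powr d" "CA * C0 powr d"] C0 \<tau> \<delta>
    by (simp add: powr_mult)
  finally show "emeasure (nu M d) (whitney \<tau> Q) \<le> ennreal (CA * C0 powr d * (1 - \<delta>) / (\<delta> powr (d + 1) * \<tau> powr d))"
    unfolding T by (intro order_trans[OF nt(3)] ennreal_leI)
qed

lemma whitney_disjoint:
  assumes \<tau>: "0 < \<tau>" and Q: "Q \<in> cubes D" "P \<in> cubes D" "Q \<noteq> P"
  shows "whitney \<tau> Q \<inter> whitney \<tau> P = {}"
proof (rule ccontr)
  assume "whitney \<tau> Q \<inter> whitney \<tau> P \<noteq> {}"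
  then obtain x t where xt: "(x, t) \<in> whitney \<tau> Q" "(x, t) \<in> whitney \<tau> P" by auto
  obtain k l where kl: "Q \<in> D k" "P \<in> D l" using Q cubes_iff by blast
  have lt: "k' \<le> l'" if "\<tau> * \<delta> powi (k' + 1) \<le> t" "t < \<tau> * \<delta> powi k'" "\<tau> * \<delta> powi (l' + 1) \<le> t" "t < \<tau> * \<delta> powi l'" for k' l'
  proof (rule ccontr)
    assume "\<not> k' \<le> l'"
    then have "\<delta> powi k' \<le> \<delta> powi (l' + 1)" by (intro scale_antimono) simp
    then have "\<tau> * \<delta> powi k' \<le> \<tau> * \<delta> powi (l' + 1)" using \<tau> by (intro mult_left_mono) auto
    with that show False by linarith
  qed
  have "k = l" using xt lt[of k l] lt[of l k] by (auto simp: whitney_def cube_level_eq[OF kl(1)] cube_level_eq[OF kl(2)] intro!: antisym)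
  then have "Q = P" using same_level_eq[of Q k P x] kl xt by (auto simp: whitney_def)
  with Q show False by simp
qed

lemma space_nu: "space (nu M d) = X \<times> {0<..}"
  by (simp add: nu_def space_pair_measure space_restrict_space)

lemma distr_fun_osc: 
  "distr_fun (count_space (cubes D)) (\<lambda>Q. osc b Q) \<kappa> = (\<integral>\<^sup>+Q. 1 \<partial>count_space {Q \<in> cubes D. \<kappa> < osc b Q})"
proof -
  let ?S = "{Q \<in> cubes D. \<kappa> < osc b Q}"
  have "emeasure (count_space (cubes D)) ?S = emeasure (count_space ?S) ?S"
    by (cases "finite ?S") (auto simp: emeasure_count_space_finite emeasure_count_space_infinite)
  then show ?thesis by (simp add: distr_fun_count_space)
qed

text \<open>With this \<open>\<tau>\<close> the ball \<open>B(x, t)\<close> contains \<open>B\<^sub>Q\<close> whenever \<open>(x, t)\<close> lies in the Whitney box over \<open>Q\<close>, and has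
  comparable volume. So \<open>m\<^sub>b\<close> is large on the boxes over all cubes with large oscillation, and these
  boxes are disjoint with masses bounded below.\<close>

lemma ex_osc_le_m_fun:
  "\<exists>\<gamma>>0. \<exists>K>0. \<forall>b\<in>L1_loc M rho. \<forall>\<kappa>>0.
    distr_fun (count_space (cubes D)) (\<lambda>Q. osc b Q) \<kappa> \<le> ennreal \<gamma> * distr_fun (nu M d) (m_fun M rho b) (\<kappa> / K)"
proof -
  define \<tau> where "\<tau> = A0 * (C0 + c) / \<delta>"
  have \<tau>: "0 < \<tau>" using A0_pos C0 c_pos \<delta> by (simp add: \<tau>_def)
  let ?K = "2 * doubling_factor (A0 * (C0 + \<tau>) / c0)"
  have K: "0 < ?K" using doubling_factor_ge_1[of "A0 * (C0 + \<tau>) / c0"] by simp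
  let ?g = "c0 powr d / CA * (1 - \<delta>) / \<tau> powr d"
  have g: "0 < ?g" using c0 CA \<delta> \<tau> by simp
  have main: "distr_fun (count_space (cubes D)) (\<lambda>Q. osc b Q) \<kappa> \<le> ennreal (1 / ?g) * distr_fun (nu M d) (m_fun M rho b) (\<kappa> / ?K)"
    if b: "b \<in> L1_loc M rho" and \<kappa>: "0 < \<kappa>" for b \<kappa>
  proof -
    let ?S = "{Q \<in> cubes D. \<kappa> < osc b Q}"
    let ?E = "{u \<in> space (nu M d). \<kappa> / ?K < \<bar>m_fun M rho b u\<bar>}"
    have sub: "whitney \<tau> Q \<subseteq> ?E" if Q: "Q \<in> ?S" for Q
    proof
      fix u assume "u \<in> whitney \<tau> Q"
      obtain k where k: "Q \<in> D k" using Q cubes_iff by blast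
      obtain x t where u: "u = (x, t)" "x \<in> Q" "\<tau> * (\<delta> * \<delta> powi k) \<le> t" "t < \<tau> * \<delta> powi k"
        using \<open>u \<in> whitney \<tau> Q\<close> by (auto simp: whitney_def cube_level_eq[OF k] scale_Suc)
      have xX: "x \<in> X" using in_cube_in_X[OF k u(2)] .
      have t0: "0 < t" using u(3) \<tau> \<delta> by (meson less_le_trans mult_pos_pos scale_pos)
      let ?z = "z k Q"
      have Qc: "Q \<in> cubes D" using Q by simp
      have BQe: "BQ Q = ball ?z (c * \<delta> powi k)" using BQ_ball[OF cube_neq_X[OF k]] by (simp add: cube_level_eq[OF k])
      have "A0 * (rho x ?z + c * \<delta> powi k) \<le> A0 * (C0 * \<delta> powi k + c * \<delta> powi k)"
        using cube_bounded[OF k u(2)] rho_sym[OF xX centre[OF k]] A0_pos by (intro mult_left_mono add_right_mono) auto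
      also have "\<dots> = \<tau> * (\<delta> * \<delta> powi k)" unfolding distrib_left[symmetric] distrib_right[symmetric] \<tau>_def using \<delta> by simp
      finally have BB: "BQ Q \<subseteq> ball x t" unfolding BQe using u(3) xX centre[OF k] by (intro ball_subset) auto
      have "\<mu> (ball x t) \<le> doubling_factor (A0 * (C0 + \<tau>) / c0) * \<mu> Q"
        unfolding vol_def[symmetric] using u \<tau> xX by (intro vol_le_cube[OF k u(2)]) auto
      also have "\<dots> \<le> doubling_factor (A0 * (C0 + \<tau>) / c0) * \<mu> (BQ Q)"
        using cube_le_BQ[OF Qc] doubling_factor_ge_1[of "A0 * (C0 + \<tau>) / c0"] by (intro mult_left_mono) auto
      finally have "osc b Q \<le> ?K * mean_osc M (ball x t) b"
        using xX Qc BB b by (intro mean_osc_subset_le BQ_sets ball_sets ball_finite BQ_pos L1_loc_integrable) auto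
      then have "\<kappa> < ?K * mean_osc M (ball x t) b" using Q by simp
      then have "\<kappa> / ?K < mean_osc M (ball x t) b" using K by (simp add: pos_divide_less_eq mult.commute)
      then show "u \<in> ?E" using u(1) xX t0 by (auto simp: space_nu m_fun_def)
    qed
    have disj: "disjoint_family_on (whitney \<tau>) ?S"
      using whitney_disjoint[OF \<tau>] by (auto simp: disjoint_family_on_def)
    have "ennreal ?g * (\<integral>\<^sup>+Q. 1 \<partial>count_space ?S) = (\<integral>\<^sup>+Q. ennreal ?g \<partial>count_space ?S)"
      by simp
    also have "\<dots> \<le> (\<integral>\<^sup>+Q. emeasure (nu M d) (whitney \<tau> Q) \<partial>count_space ?S)"
      using whitney_mass(2)[OF \<tau>] by (intro nn_integral_mono) auto
    also have "\<dots> = emeasure (nu M d) (\<Union>Q\<in>?S. whitney \<tau> Q)"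
      using disj whitney_mass(1)[OF \<tau>]
      by (intro emeasure_UN_countable[symmetric] countable_subset[OF _ countable_cubes]) auto
    \<comment> \<open>The set \<open>?E\<close> may be non-measurable; its outer measure is tested on measurable supersets.\<close>
    also have "\<dots> \<le> outer_measure_of (nu M d) ?E"
      unfolding outer_measure_of_def
    proof (rule INF_greatest)
      fix A assume "A \<in> {A \<in> sets (nu M d). ?E \<subseteq> A}"
      then show "emeasure (nu M d) (\<Union>Q\<in>?S. whitney \<tau> Q) \<le> emeasure (nu M d) A"
        using sub by (intro emeasure_mono) blast+
    qed
    also have "\<dots> = distr_fun (nu M d) (m_fun M rho b) (\<kappa> / ?K)" by (simp add: distr_fun_def)
    finally have le: "ennreal ?g * distr_fun (count_space (cubes D)) (\<lambda>Q. osc b Q) \<kappa> \<le> distr_fun (nu M d) (m_fun M rho b) (\<kappa> / ?K)"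
      unfolding distr_fun_osc .
    have "ennreal (1 / ?g) * (ennreal ?g * distr_fun (count_space (cubes D)) (\<lambda>Q. osc b Q) \<kappa>) \<le>
        ennreal (1 / ?g) * distr_fun (nu M d) (m_fun M rho b) (\<kappa> / ?K)"
      using le by (intro mult_left_mono) auto
    also have "ennreal (1 / ?g) * (ennreal ?g * distr_fun (count_space (cubes D)) (\<lambda>Q. osc b Q) \<kappa>) =
        (ennreal (1 / ?g) * ennreal ?g) * distr_fun (count_space (cubes D)) (\<lambda>Q. osc b Q) \<kappa>"
      by (simp only: mult.assoc)
    also have "ennreal (1 / ?g) * ennreal ?g = 1"
    proof -
      have "ennreal (1 / ?g) * ennreal ?g = ennreal (1 / ?g * ?g)" 
        by (rule ennreal_mult[OF less_imp_le[OF divide_pos_pos[OF zero_less_one g]] less_imp_le[OF g], symmetric])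
      also have "1 / ?g * ?g = 1" using g by (metis less_irrefl nonzero_eq_divide_eq)
      finally show ?thesis by simp
    qed
    finally show ?thesis by simp
  qed
  have "0 < 1 / ?g" using g by (rule divide_pos_pos[OF zero_less_one])
  note pos = this
  show ?thesis
    by (intro exI[of _ "1 / ?g"] exI[of _ ?K] conjI ballI allI impI) (rule pos, rule K, (rule main; assumption))
qed

text \<open>A point \<open>(x, t)\<close> with \<open>\<delta>\<^sup>k\<^sup>+\<^sup>1 \<le> t < \<delta>\<^sup>k\<close> lies in the box with \<open>\<tau> = 1\<close> over the cube \<open>Q\<close> of level \<open>k\<close> around
  \<open>x\<close>, and \<open>B(x, t)\<close> lies in \<open>B\<^sub>Q\<close> with comparable volume. So the set where \<open>m\<^sub>b\<close> is large is covered by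
  the boxes over cubes with large oscillation.\<close>

lemma ex_m_fun_le_osc:
  "\<exists>\<gamma>>0. \<exists>K>0. \<forall>b\<in>L1_loc M rho. \<forall>\<kappa>>0.
    distr_fun (nu M d) (m_fun M rho b) \<kappa> \<le> ennreal \<gamma> * distr_fun (count_space (cubes D)) (\<lambda>Q. osc b Q) (\<kappa> / K)"
proof -
  let ?K = "2 * (ball_factor * doubling_factor (A0 * (C0 + 0) / \<delta>))"
  have K: "0 < ?K" using doubling_factor_ge_1[of "A0 * (C0 + 0) / \<delta>"] ball_factor_ge_1 by simp
  let ?g = "CA * C0 powr d * (1 - \<delta>) / (\<delta> powr (d + 1) * 1 powr d)"
  have g: "0 < ?g" using C0 CA \<delta> by simp
  have main: "distr_fun (nu M d) (m_fun M rho b) \<kappa> \<le> ennreal ?g * distr_fun (count_space (cubes D)) (\<lambda>Q. osc b Q) (\<kappa> / ?K)"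
    if b: "b \<in> L1_loc M rho" and \<kappa>: "0 < \<kappa>" for b \<kappa>
  proof -
    let ?S = "{Q \<in> cubes D. \<kappa> / ?K < osc b Q}"
    let ?E = "{u \<in> space (nu M d). \<kappa> < \<bar>m_fun M rho b u\<bar>}"
    have cS: "countable ?S" by (rule countable_subset[OF _ countable_cubes]) auto
    have Um: "(\<Union>Q\<in>?S. whitney 1 Q) \<in> sets (nu M d)"
      using whitney_mass(1)[of 1] by (intro sets.countable_UN' cS) auto
    have sub: "?E \<subseteq> (\<Union>Q\<in>?S. whitney 1 Q)"
    proof
      fix u assume u: "u \<in> ?E"
      obtain x t where xt: "u = (x, t)" "x \<in> X" "0 < t" using u by (auto simp: space_nu)
      have m: "\<kappa> < mean_osc M (ball x t) b" using u xt by (simp add: m_fun_def)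
      obtain k where k: "\<delta> powi (k + 1) \<le> t" "t < \<delta> powi k" using ex_scale[OF xt(3)] by blast
      let ?Q = "cube_at k x"
      have Q: "?Q \<in> D k" "x \<in> ?Q" using cube_at[OF xt(2)] by auto
      have Qc: "?Q \<in> cubes D" using Q cubes_iff by blast
      have BB: "ball x t \<subseteq> BQ ?Q"
      proof
        fix y assume "y \<in> ball x t"
        then show "y \<in> BQ ?Q" using k A0C0_le_c by (intro mem_BQ[OF Q, of y 1]) auto
      qed
      have "\<mu> ?Q \<le> doubling_factor (A0 * (C0 + 0) / \<delta>) * V x (\<delta> * \<delta> powi k)" using xt \<delta> by (intro cube_le_vol[OF Q]) auto
      also have "\<dots> \<le> doubling_factor (A0 * (C0 + 0) / \<delta>) * V x t"
        using k(1) doubling_factor_ge_1[of "A0 * (C0 + 0) / \<delta>"] by (intro mult_left_mono vol_mono[OF xt(2)]) (auto simp: scale_Suc)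
      finally have "ball_factor * \<mu> ?Q \<le> ball_factor * (doubling_factor (A0 * (C0 + 0) / \<delta>) * V x t)" using ball_factor_ge_1 by (intro mult_left_mono) auto
      then have "\<mu> (BQ ?Q) \<le> (ball_factor * doubling_factor (A0 * (C0 + 0) / \<delta>)) * \<mu> (ball x t)"
        using BQ_le[OF Qc] by (simp add: vol_def mult.assoc)
      then have "mean_osc M (ball x t) b \<le> ?K * osc b ?Q"
        using xt Qc BB b vol_pos[OF xt(2,3)]
        by (intro mean_osc_subset_le BQ_sets ball_sets BQ_finite BQ_integrable) (auto simp: vol_def)
      then have "\<kappa> < ?K * osc b ?Q" using m by simp
      then have "\<kappa> / ?K < osc b ?Q" using K by (simp add: pos_divide_less_eq mult.commute)
      then have "?Q \<in> ?S" using Qc by simp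
      moreover have "u \<in> whitney 1 ?Q" using xt Q k by (simp add: whitney_def cube_level_eq[OF Q(1)])
      ultimately show "u \<in> (\<Union>Q\<in>?S. whitney 1 Q)" by (rule UN_I)
    qed
    have disj: "disjoint_family_on (whitney 1) ?S"
      using whitney_disjoint[of 1] by (auto simp: disjoint_family_on_def)
    have "distr_fun (nu M d) (m_fun M rho b) \<kappa> \<le> outer_measure_of (nu M d) (\<Union>Q\<in>?S. whitney 1 Q)"
      unfolding distr_fun_def by (rule outer_measure_of_mono[OF sub])
    also have "\<dots> = emeasure (nu M d) (\<Union>Q\<in>?S. whitney 1 Q)" by (rule outer_measure_of_eq[OF Um])
    also have "\<dots> = (\<integral>\<^sup>+Q. emeasure (nu M d) (whitney 1 Q) \<partial>count_space ?S)"
      using disj whitney_mass(1)[of 1] cS by (intro emeasure_UN_countable) auto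
    also have "\<dots> \<le> (\<integral>\<^sup>+Q. ennreal ?g * 1 \<partial>count_space ?S)"
      unfolding mult_1_right using whitney_mass(3)[of 1] by (intro nn_integral_mono) auto
    also have "\<dots> = ennreal ?g * (\<integral>\<^sup>+Q. 1 \<partial>count_space ?S)" by (rule nn_integral_cmult) simp
    finally show ?thesis unfolding distr_fun_osc .
  qed
  show ?thesis
    by (intro exI[of _ ?g] exI[of _ ?K] conjI ballI allI impI) (rule g, rule K, (rule main; assumption))
qed

lemma osc_m_fun_comparable:
  "comparable_on (L1_loc M rho) (osc_norm M rho \<delta> D z c d \<infinity>) (\<lambda>b. lorentz_norm (nu M d) d \<infinity> (m_fun M rho b))"
proof -
  obtain \<gamma>1 K1 where 1: "\<gamma>1 > 0" "K1 > 0" "\<forall>b\<in>L1_loc M rho. \<forall>\<kappa>>0.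
    distr_fun (count_space (cubes D)) (\<lambda>Q. osc b Q) \<kappa> \<le> ennreal \<gamma>1 * distr_fun (nu M d) (m_fun M rho b) (\<kappa> / K1)"
    using ex_osc_le_m_fun by (elim exE conjE)
  obtain \<gamma>2 K2 where 2: "\<gamma>2 > 0" "K2 > 0" "\<forall>b\<in>L1_loc M rho. \<forall>\<kappa>>0.
    distr_fun (nu M d) (m_fun M rho b) \<kappa> \<le> ennreal \<gamma>2 * distr_fun (count_space (cubes D)) (\<lambda>Q. osc b Q) (\<kappa> / K2)"
    using ex_m_fun_le_osc by (elim exE conjE)
  show ?thesis
    unfolding osc_norm_def
  proof (rule comparable_onI)
    show "0 < K1 * \<gamma>1 powr (1 / d)" "0 < K2 * \<gamma>2 powr (1 / d)" using 1 2 by auto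
  qed (use 1(3) 2(3) in \<open>(intro lorentz_norm_infinity_le d 1(1,2) 2(1,2); blast)+\<close>)
qed

end

theorem proposition1p29:
  fixes M :: "'a measure" and rho :: "'a \<Rightarrow> 'a \<Rightarrow> real"
    and \<delta> c0 C0 :: real
    and D :: "int \<Rightarrow> 'a set set" and z :: "int \<Rightarrow> 'a set \<Rightarrow> 'a"
  assumes "homogeneous_type M rho"
    and "dyadic_system M rho \<delta> c0 C0 D z"
  shows "\<exists>c1>0. \<forall>c\<ge>c1.
    (\<forall>p>1. comparable_on (L1_loc M rho) (osc_norm M rho \<delta> D z c p (ennreal p)) (besov_norm M rho p)) \<and>
    (\<forall>d>0. ahlfors_regular M rho d \<longrightarrow> (\<forall>k l. k \<noteq> l \<longrightarrow> D k \<inter> D l = {}) \<longrightarrow>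
       comparable_on (L1_loc M rho) (osc_norm M rho \<delta> D z c d \<infinity>)
         (\<lambda>b. lorentz_norm (nu M d) d \<infinity> (m_fun M rho b)))"
proof -
  obtain A0 Cd where "homogeneous_space M rho A0 Cd"
    using homogeneous_type_imp_homogeneous_space[OF assms(1)] .
  then interpret homogeneous_space M rho A0 Cd .
  let ?c1 = "A0 * (C0 + A0 * (1 + 2 * A0 * C0))"
  have C0: "0 < C0" using assms(2) by (auto simp: dyadic_system_def)
  have c1: "0 < ?c1" using A0_ge_1 C0 by (intro mult_pos_pos add_pos_pos) auto
  show ?thesis
  proof (intro exI[of _ ?c1] conjI allI impI c1)
    fix c assume c: "?c1 \<le> c"
    interpret dyadic_space M rho A0 Cd \<delta> c0 C0 D z c
      using assms(2) c by unfold_locales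
    show "comparable_on (L1_loc M rho) (osc_norm M rho \<delta> D z c p (ennreal p)) (besov_norm M rho p)" if "1 < p" for p
      using that by (rule osc_besov_comparable)
    fix d :: real assume d: "0 < d" and reg: "ahlfors_regular M rho d" and disj: "\<forall>k l. k \<noteq> l \<longrightarrow> D k \<inter> D l = {}"
    obtain CA where CA: "1 \<le> CA" "\<forall>x\<in>space M. \<forall>r>0. (1 / CA) * r powr d \<le> vol M rho x r \<and> vol M rho x r \<le> CA * r powr d"
      using reg unfolding ahlfors_regular_def by (elim exE conjE)
    interpret ahlfors_dyadic_space M rho A0 Cd \<delta> c0 C0 D z c d CA
      by unfold_locales (use d CA disj in auto)
    show "comparable_on (L1_loc M rho) (osc_norm M rho \<delta> D z c d \<infinity>) (\<lambda>b. lorentz_norm (nu M d) d \<infinity> (m_fun M rho b))"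
      by (rule osc_m_fun_comparable)
  qed
qed

end
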